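(* Let $n\ge 3$ be an integer and let $\mathcal{X}\subseteq\mathbb{C}$ be a perfect space such that for every $\mathbf{x}\in\mathcal{C}^n(\mathcal{X})$ the graph $\Gamma^n(\mathbf{x})$ contains an $n$-cycle. Assume furthermore that - the symmetric group $S_n$ acts transitively on the set of connected components of $\mathcal{C}^n(\mathcal{X})$; and - that action is not free (i.e. the isotropy groups are not trivial). The continuous CS preservers $\phi:\sigma^-(\mathcal{X})\to M_n(\mathbb{C})$ are as follows. (1) If the complex conjugation function $z\mapsto\overline z$ is not of class $C^{n-1}_\Delta(\mathcal{X})$, they are precisely the conjugations and transpose conjugations. (2) If complex conjugation is of class $C^{n-1}_\Delta(\mathcal{X})$, they are precisely the conjugations, the transpose conjugations, and the compositions $\alpha\circ\widetilde\Phi$ of conjugations and transpose conjugations $\alpha$ with the unique continuous extension $\widetilde\Phi:\sigma^-(\mathcal{X})\to M_n(\mathbb{C})$ of the map $$\Phi:\sigma^-_{ss}(\mathcal{X})\to M_n(\mathbb{C}),\qquad (\boldsymbol{\ell}\mid\boldsymbol{\lambda})\mapsto(\boldsymbol{\ell}'\mid\boldsymbol{\lambda}),\qquad \ell'_i:=\Big(\bigoplus_{j\ne i}\ell_j\Big)^{\perp}\quad(1\le i\le n).$$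
   Context: A topological space $\mathcal{X}$ is perfect if every $x\in\mathcal{X}$ lies in the closure of $\mathcal{X}\setminus\{x\}$ (subsets of $\mathbb{C}$ carry the subspace topology; closedness in $\mathbb{C}$ is not required). $\sigma(T)$ is the spectrum (set of eigenvalues) of $T\in M_n(\mathbb{C})$. $\sigma^-(\mathcal{X})$ is the set of all matrices $T\in M_n(\mathbb{C})$ with $\sigma(T)\subseteq\mathcal{X}$, and $\sigma^-_{ss}(\mathcal{X})$ is its subset of semisimple (i.e. diagonalizable) matrices. A CS (commutativity and spectrum) preserver on a set $\mathcal{S}\subseteq M_n(\mathbb{C})$ is a map $\phi:\mathcal{S}\to M_n(\mathbb{C})$ (not assumed linear) with $\sigma(\phi(A))=\sigma(A)$ for all $A\in\mathcal{S}$, and $\phi(A)\phi(B)=\phi(B)\phi(A)$ whenever $A,B\in\mathcal{S}$ and $AB=BA$. A conjugation is a map $A\mapsto TAT^{-1}$ and a transpose conjugation a map $A\mapsto TA^tT^{-1}$, with $T\in\mathrm{GL}_n(\mathbb{C})$; both are understood as restricted to the domain in question. For an $n$-tuple $\boldsymbol{\ell}=(\ell_i)_{i=1}^n$ of lines (one-dimensional subspaces) spanning $\mathbb{C}^n$ and $\boldsymbol{\lambda}=(\lambda_i)\in\mathbb{C}^n$, $(\boldsymbol{\ell}\mid\boldsymbol{\lambda})$ denotes the semisimple operator on $\mathbb{C}^n$ acting as the scalar $\lambda_i$ on $\ell_i$ for each $i$. Orthogonal complements are with respect to the standard inner product on $\mathbb{C}^n$. (The map $\Phi$ is well defined, i.e.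 independent of the representation of an operator as $(\boldsymbol{\ell}\mid\boldsymbol{\lambda})$.) $\mathcal{C}^n(\mathcal{X})=\{(x_1,\dots,x_n)\in\mathcal{X}^n: x_i\text{ distinct}\}$ with the topology induced from $\mathcal{X}^n$. $S_n$ acts on $\mathcal{X}^n$ and $\mathcal{C}^n(\mathcal{X})$ on the right by $(x_i)_i\triangleleft\theta=(x_{\theta i})_i$, hence also on the set of connected components of $\mathcal{C}^n(\mathcal{X})$. For $\mathbf{x}\in\mathcal{X}^n$, the set of coincidences $\mathcal{E}^n(\mathbf{x})$ is the set of pairs $\{i\ne j\}\subseteq\{1,\dots,n\}$ with $x_i=x_j$. For a connected component $\mathcal{C}\subseteq\mathcal{C}^n(\mathcal{X})$, $\Gamma^n(\mathcal{C})$ is the loop-free undirected graph with vertex set $\{1,\dots,n\}$ and with an edge $\{i\neq j\}$ exactly when there is a point $\mathbf{y}\in\mathcal{X}^n$ lying in both $\overline{\mathcal{C}}$ and $\overline{\mathcal{C}\triangleleft(i\,j)}$ (closures in $\mathcal{X}^n$; $(i\,j)$ the transposition) whose only coincidence is $\{i,j\}$, i.e. $\mathcal{E}^n(\mathbf{y})=\{\{i,j\}\}$. For $\mathbf{x}\in\mathcal{C}^n(\mathcal{X})$, $\Gamma^n(\mathbf{x}):=\Gamma^n(\mathcal{C})$ for the connected component $\mathcal{C}$ containing $\mathbf{x}$. For a symmetric complex-valued function $f$ on $\mathcal{C}^m(\mathcal{X})$, $\Delta f$ is the symmetric function on $\mathcal{C}^{m+1}(\mathcal{X})$ given by $$\Delta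 f(z_0,\dots,z_m):=\frac{f(z_1,\dots,z_m)-f(z_0,\dots,z_{m-1})}{z_m-z_0},$$ and $\Delta^k$ is the $k$-fold iterate of $\Delta$. A function $f:\mathcal{X}\to\mathbb{C}$ is of class $C^k_\Delta(\mathcal{X})$ if for every cluster point $z\in\mathcal{X}$ of $\mathcal{X}$ the function $\Delta^kf$ on $\mathcal{C}^{k+1}(\mathcal{X})$ has a finite limit at $(z,\dots,z)\in\mathcal{X}^{k+1}$ (limit as points of $\mathcal{C}^{k+1}(\mathcal{X})$ tend to $(z,\dots,z)$). *)

theory Defs
  imports "HOL-Analysis.Analysis"
begin

section \<open>Matrices, spectra and preservers\<close>

definition spectrum :: "complex^'n^'n \<Rightarrow> complex set" where
  "spectrum T = {c. \<exists>v. v \<noteq> 0 \<and> T *v v = c *s v}"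

definition semisimple :: "complex^'n^'n \<Rightarrow> bool" where
  "semisimple T \<longleftrightarrow>
     (\<exists>(P :: complex^'n^'n) (D :: complex^'n^'n). invertible P \<and> (\<forall>i j. i \<noteq> j \<longrightarrow> D $ i $ j = 0) \<and> T = P ** D ** matrix_inv P)"

definition sigma_minus :: "complex set \<Rightarrow> (complex^'n^'n) set" where
  "sigma_minus X = {T. spectrum T \<subseteq> X}"

definition sigma_minus_ss :: "complex set \<Rightarrow> (complex^'n^'n) set" where
  "sigma_minus_ss X = {T \<in> sigma_minus X. semisimple T}"

text \<open>Maps on a set of matrices are total functions of which only the values on that set matter.\<close>

definition CS_preserver :: "(complex^'n^'n) set \<Rightarrow> (complex^'n^'n \<Rightarrow> complex^'n^'n) \<Rightarrow> bool" where
  "CS_preserver S \<phi> \<longleftrightarrow>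
     (\<forall>A\<in>S. spectrum (\<phi> A) = spectrum A) \<and>
     (\<forall>A\<in>S. \<forall>B\<in>S. A ** B = B ** A \<longrightarrow> \<phi> A ** \<phi> B = \<phi> B ** \<phi> A)"

definition conjugation :: "(complex^'n^'n \<Rightarrow> complex^'n^'n) \<Rightarrow> bool" where
  "conjugation \<alpha> \<longleftrightarrow> (\<exists>T :: complex^'n^'n. invertible T \<and> \<alpha> = (\<lambda>A. T ** A ** matrix_inv T))"

definition transpose_conjugation :: "(complex^'n^'n \<Rightarrow> complex^'n^'n) \<Rightarrow> bool" where
  "transpose_conjugation \<alpha> \<longleftrightarrow>
     (\<exists>T :: complex^'n^'n. invertible T \<and> \<alpha> = (\<lambda>A. T ** Finite_Cartesian_Product.transpose A ** matrix_inv T))"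

section \<open>The map \<open>\<Phi>\<close>\<close>

text \<open>\<open>(\<bullet>)\<close> on \<open>complex^'n\<close> is the real part of this Hermitian inner product.\<close>

definition hermitian_inner :: "complex^'n \<Rightarrow> complex^'n \<Rightarrow> complex" where
  "hermitian_inner v w = (\<Sum>i\<in>UNIV. v $ i * cnj (w $ i))"

definition hermitian_complement :: "(complex^'n) set \<Rightarrow> (complex^'n) set" where
  "hermitian_complement W = {v. \<forall>w\<in>W. hermitian_inner v w = 0}"

definition spanning_lines :: "('n \<Rightarrow> (complex^'n) set) \<Rightarrow> bool" where
  "spanning_lines L \<longleftrightarrow>
     (\<forall>i. vec.subspace (L i) \<and> vec.dim (L i) = 1) \<and> vec.span (\<Union>i. L i) = UNIV"

text \<open>\<open>line_operator L c\<close> is the operator \<open>(L | c)\<close>; it is determined only for \<open>spanning_lines L\<close>.\<close>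

definition line_operator :: "('n \<Rightarrow> (complex^'n) set) \<Rightarrow> ('n \<Rightarrow> complex) \<Rightarrow> complex^'n^'n" where
  "line_operator L c = (THE T. \<forall>i. \<forall>v\<in>L i. T *v v = c i *s v)"

definition dual_lines :: "('n \<Rightarrow> (complex^'n) set) \<Rightarrow> 'n \<Rightarrow> (complex^'n) set" where
  "dual_lines L i = hermitian_complement (vec.span (\<Union>j\<in>- {i}. L j))"

definition Phi :: "complex^'n^'n \<Rightarrow> complex^'n^'n" where
  "Phi T = (THE S. \<exists>L c. spanning_lines L \<and> T = line_operator L c
                       \<and> S = line_operator (dual_lines L) c)"

section \<open>Configuration spaces\<close>

definition perfect :: "'a topology \<Rightarrow> bool" where
  "perfect X \<longleftrightarrow> (\<forall>x\<in>topspace X. x \<in> X closure_of (topspace X - {x}))"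

text \<open>Tuples are indexed by \<open>{..<n}\<close> instead of \<open>{1..n}\<close>, and are extensional functions:
  they take the value \<open>undefined\<close> outside the index set.\<close>

definition tuple_space :: "nat \<Rightarrow> complex set \<Rightarrow> (nat \<Rightarrow> complex) topology" where
  "tuple_space n X = product_topology (\<lambda>_. top_of_set X) {..<n}"

definition configurations :: "nat \<Rightarrow> complex set \<Rightarrow> (nat \<Rightarrow> complex) set" where
  "configurations n X = {x \<in> topspace (tuple_space n X). inj_on x {..<n}}"

definition configuration_space :: "nat \<Rightarrow> complex set \<Rightarrow> (nat \<Rightarrow> complex) topology" where
  "configuration_space n X = subtopology (tuple_space n X) (configurations n X)"

definition tuple_act :: "nat \<Rightarrow> (nat \<Rightarrow> complex) \<Rightarrow> (nat \<Rightarrow> nat) \<Rightarrow> (nat \<Rightarrow> complex)" where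
  "tuple_act n x \<theta> = (\<lambda>i\<in>{..<n}. x (\<theta> i))"

definition set_act :: "nat \<Rightarrow> (nat \<Rightarrow> complex) set \<Rightarrow> (nat \<Rightarrow> nat) \<Rightarrow> (nat \<Rightarrow> complex) set" where
  "set_act n C \<theta> = (\<lambda>x. tuple_act n x \<theta>) ` C"

definition transitive_on_components :: "nat \<Rightarrow> complex set \<Rightarrow> bool" where
  "transitive_on_components n X \<longleftrightarrow>
     (\<forall>C \<in> connected_components_of (configuration_space n X).
      \<forall>C' \<in> connected_components_of (configuration_space n X).
        \<exists>\<theta>. \<theta> permutes {..<n} \<and> set_act n C \<theta> = C')"

definition free_on_components :: "nat \<Rightarrow> complex set \<Rightarrow> bool" where
  "free_on_components n X \<longleftrightarrow>
     (\<forall>C \<in> connected_components_of (configuration_space n X).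
      \<forall>\<theta>. \<theta> permutes {..<n} \<and> set_act n C \<theta> = C \<longrightarrow> \<theta> = id)"

section \<open>The graphs \<open>\<Gamma>\<close>\<close>

definition coincidences :: "nat \<Rightarrow> (nat \<Rightarrow> complex) \<Rightarrow> nat set set" where
  "coincidences n x = {{i, j} | i j. i < n \<and> j < n \<and> i \<noteq> j \<and> x i = x j}"

text \<open>The graph on the vertex set \<open>{..<n}\<close> is given by its set of edges \<open>{i, j}\<close>.\<close>

definition Gamma_component :: "nat \<Rightarrow> complex set \<Rightarrow> (nat \<Rightarrow> complex) set \<Rightarrow> nat set set" where
  "Gamma_component n X C = {{i, j} | i j. i < n \<and> j < n \<and> i \<noteq> j \<and>
     (\<exists>y \<in> topspace (tuple_space n X).
        y \<in> tuple_space n X closure_of C \<and>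
        y \<in> tuple_space n X closure_of (set_act n C (Transposition.transpose i j)) \<and>
        coincidences n y = {{i, j}})}"

definition Gamma_graph :: "nat \<Rightarrow> complex set \<Rightarrow> (nat \<Rightarrow> complex) \<Rightarrow> nat set set" where
  "Gamma_graph n X x =
     Gamma_component n X (connected_component_of_set (configuration_space n X) x)"

text \<open>For \<open>k \<ge> 3\<close>: the graph with edge set \<open>E\<close> contains a cycle of length \<open>k\<close>.\<close>

definition contains_cycle :: "nat \<Rightarrow> nat set set \<Rightarrow> bool" where
  "contains_cycle k E \<longleftrightarrow>
     (\<exists>vs. length vs = k \<and> distinct vs \<and> (\<forall>i<k. {vs ! i, vs ! (Suc i mod k)} \<in> E))"

section \<open>Iterated difference quotients\<close>

definition Delta :: "nat \<Rightarrow> ((nat \<Rightarrow> complex) \<Rightarrow> complex) \<Rightarrow> (nat \<Rightarrow> complex) \<Rightarrow> complex" where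
  "Delta m f z = (f (\<lambda>i\<in>{..<m}. z (Suc i)) - f (\<lambda>i\<in>{..<m}. z i)) / (z m - z 0)"

text \<open>\<open>Delta_iter k f\<close> is \<open>\<Delta>\<^sup>k f\<close>, a function on \<open>configurations (Suc k) X\<close>; \<open>configurations 1 X\<close>
  is identified with \<open>X\<close>.\<close>

primrec Delta_iter :: "nat \<Rightarrow> (complex \<Rightarrow> complex) \<Rightarrow> (nat \<Rightarrow> complex) \<Rightarrow> complex" where
  "Delta_iter 0 f = (\<lambda>z. f (z 0))"
| "Delta_iter (Suc k) f = Delta (Suc k) (Delta_iter k f)"

definition C_Delta :: "nat \<Rightarrow> complex set \<Rightarrow> (complex \<Rightarrow> complex) \<Rightarrow> bool" where
  "C_Delta k X f \<longleftrightarrow>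
     (\<forall>z\<in>X. z islimpt X \<longrightarrow>
        (\<exists>L. (Delta_iter k f \<longlongrightarrow> L)
               (atin_within (tuple_space (Suc k) X) (\<lambda>i\<in>{..<Suc k}. z) (configurations (Suc k) X))))"

end

theory Submission
  imports Defs "HOL-Computational_Algebra.Fundamental_Theorem_Algebra"
begin

text \<open>
  Let \<open>C\<close> be a connected component of the configuration space with nontrivial stabilizer. For a
  frame \<open>g\<close> and \<open>x \<in> C\<close> the matrices \<open>\<phi>(g diag(x) g\<^sup>-\<^sup>1)\<close> commute, and connectedness of \<open>C\<close>
  makes their spectral projections \<open>Q\<^sub>k(g)\<close> independent of \<open>x\<close>. Passing to a point of the closure
  whose only coincidence is \<open>{i, j}\<close> shows that \<open>Q\<^sub>k(g)\<close>, \<open>k \<noteq> i, j\<close>, is unchanged when \<open>g\<close> is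
  multiplied by \<open>1 + t e\<^sub>i\<^sub>j\<close>; as the \<open>n\<close>-cycle minus the vertex \<open>k\<close> is a path, commutators give
  this for all \<open>i, j \<noteq> k\<close>.

  Factoring the matrices \<open>1 + a e\<^sub>1\<^sub>2 + b e\<^sub>2\<^sub>3 + c e\<^sub>1\<^sub>3\<close> in three ways and using \<open>\<Sum> Q\<^sub>k = 1\<close>, one finds
  that the increments \<open>K\<^sub>i\<^sub>j(t) = Q\<^sub>i(g (1 + t e\<^sub>i\<^sub>j)) - Q\<^sub>i(g)\<close> are additive in \<open>t\<close>, and idempotency of the
  \<open>Q\<^sub>k\<close> then forces the Jordan relation \<open>K\<^sub>1\<^sub>3(a b) = - (K\<^sub>1\<^sub>2(a) K\<^sub>2\<^sub>3(b) + K\<^sub>2\<^sub>3(b) K\<^sub>1\<^sub>2(a))\<close>. Hence either all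
  increments vanish, which the nontrivial stabilizer excludes, or \<open>Q\<^sub>k(g) = \<Lambda>(g e\<^sub>k\<^sub>k g\<^sup>-\<^sup>1)\<close> where, up to
  conjugation, \<open>\<Lambda>\<close> is the identity, the transpose, the entrywise complex conjugate or the adjoint.

  In the first two cases \<open>\<phi>\<close> is a conjugation or transpose conjugation on the dense set of matrices
  with simple spectrum. In the other two cases \<open>\<phi>(A)\<close> determines \<open>f(A)\<close> for \<open>f\<close> the complex
  conjugation. At a bidiagonal matrix the corner entry of \<open>f(A)\<close> is the divided difference of \<open>f\<close> at
  the \<open>n\<close> eigenvalues, so continuity of \<open>\<phi>\<close> gives the class \<open>C\<^sup>n\<^sup>-\<^sup>1\<close>. Conversely, for \<open>f\<close> of this class the
  divided differences of all lower orders have limits, and Newton's formula extends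
  \<open>A \<mapsto> f(A)\<close> continuously.
\<close>

section \<open>Matrix preliminaries\<close>

text \<open>A nontrivial stabilizer rules out constant projections because a permutation \<theta>
  preserving \<open>C\<close> describes one matrix in two ways, as diag(x o \<theta>) in the
  standard frame and as diag(x) in a permuted one; constant \<open>Q\<close> would send the two
  descriptions to different matrices. Transitivity has another role: the eigenvalues of every matrix
  with simple spectrum can be listed as a tuple in \<open>C\<close>, so the frames attached to one
  component decide everything. Entrywise conjugation acts on the projections but not on the
  eigenvalues, and the identity \<Sum> x_k cnj(P_k) = cnj(\<Sum> cnj(x_k) P_k) moves it into the
  functional calculus. The adjoint case is \<open>Phi\<close>, because the frame dual to the columns
  of P consists of the columns of the inverse adjoint of P. The obstacle to extending the functional
  calculus is that the eigenvalues of a convergent sequence of matrices come in no convergent order.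
  Limits are therefore taken along subsequences, and they agree because the limits of divided
  differences depend only on the limiting tuple of nodes.\<close>

lemma matrix_mult_nth: "(A ** B) $ i $ j = (\<Sum>k\<in>UNIV. A $ i $ k * B $ k $ j)"
  by (simp add: matrix_matrix_mult_def)

lemma matrix_diff_ldistrib: "A ** (B - C) = A ** B - A ** (C :: 'a::ring_1^'n^'m)"
  by (simp add: vec_eq_iff matrix_mult_nth right_diff_distrib sum_subtractf)

lemma matrix_diff_rdistrib: "(B - C) ** A = B ** A - C ** (A :: 'a::ring_1^'n^'m)"
  by (simp add: vec_eq_iff matrix_mult_nth left_diff_distrib sum_subtractf)

lemma matrix_add_rdistrib: "(B + C) ** A = B ** A + C ** (A :: 'a::ring_1^'n^'m)"
  by (simp add: vec_eq_iff matrix_mult_nth distrib_right sum.distrib)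

lemma matrix_mult_minus_left: "(- B) ** A = - (B ** (A :: 'a::ring_1^'n^'m))"
  by (simp add: vec_eq_iff matrix_mult_nth sum_negf)

lemma matrix_mult_minus_right: "B ** (- A) = - (B ** (A :: 'a::ring_1^'n^'m))"
  by (simp add: vec_eq_iff matrix_mult_nth sum_negf)

lemmas matrix_ring = matrix_add_ldistrib matrix_add_rdistrib matrix_diff_ldistrib
  matrix_diff_rdistrib matrix_mult_minus_left matrix_mult_minus_right

lemma matrix_sum_ldistrib: "A ** (\<Sum>i\<in>I. B i) = (\<Sum>i\<in>I. A ** (B i :: 'a::ring_1^'n^'m))"
  by (induction I rule: infinite_finite_induct) (auto simp: matrix_ring)

lemma matrix_sum_rdistrib: "(\<Sum>i\<in>I. B i) ** A = (\<Sum>i\<in>I. B i ** (A :: 'a::ring_1^'n^'m))"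
  by (induction I rule: infinite_finite_induct) (auto simp: matrix_ring)

lemma matrix_inv_right: "invertible A \<Longrightarrow> A ** matrix_inv A = mat 1"
  and matrix_inv_left: "invertible A \<Longrightarrow> matrix_inv A ** A = mat 1"
  for A :: "'a::field^'n^'n"
  unfolding invertible_def matrix_inv_def by (metis (mono_tags, lifting) someI_ex)+

lemma invertible_matrix_inv: "invertible A \<Longrightarrow> invertible (matrix_inv A)"
  for A :: "'a::field^'n^'n"
  using matrix_inv_left matrix_inv_right invertible_def by blast

lemma matrix_inv_unique_left: "A ** B = mat 1 \<Longrightarrow> matrix_inv A = B"
  for A :: "'a::field^'n^'n"
  by (metis invertible_right_inverse matrix_inv_left matrix_mul_assoc matrix_mul_lid matrix_mul_rid)

lemma matrix_inv_mult:
  "invertible A \<Longrightarrow> invertible B \<Longrightarrow> matrix_inv (A ** B) = matrix_inv B ** matrix_inv A"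
  for A B :: "'a::field^'n^'n"
  by (rule matrix_inv_unique_left) (metis matrix_inv_right matrix_mul_assoc matrix_mul_rid)

lemma matrix_inv_one [simp]: "matrix_inv (mat 1 :: 'a::field^'n^'n) = mat 1"
  by (rule matrix_inv_unique_left) simp

lemma invertible_one [simp]: "invertible (mat 1 :: 'a::field^'n^'n)"
  unfolding invertible_def by (metis matrix_mul_lid)

lemma matrix_mult_mat_commute: "A ** mat c = mat c ** (A :: 'a::field^'n^'n)"
  by (simp add: vec_eq_iff matrix_mult_nth mat_def if_distrib if_distribR
      sum.delta sum.delta' mult.commute cong: if_cong)

lemma mat_mult_nth: "(mat c ** A) $ i $ j = c * (A $ i $ j :: 'a::field)"
  by (simp add: matrix_mult_nth mat_def if_distrib if_distribR sum.delta sum.delta' cong: if_cong)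

section \<open>Diagonal matrices, conjugation and spectra\<close>

definition diag_mat :: "('n \<Rightarrow> complex) \<Rightarrow> complex^'n^'n" where
  "diag_mat c = (\<chi> i j. if i = j then c i else 0)"

definition transvection :: "'n \<Rightarrow> 'n \<Rightarrow> complex \<Rightarrow> complex^'n^'n" where
  "transvection i j t = (\<chi> a b. (if a = b then 1 else 0) + (if a = i \<and> b = j then t else 0))"

definition coord_proj :: "'n \<Rightarrow> complex^'n^'n" where
  "coord_proj k = diag_mat (\<lambda>i. if i = k then 1 else 0)"

definition conj_by :: "complex^'n^'n \<Rightarrow> complex^'n^'n \<Rightarrow> complex^'n^'n" where
  "conj_by T A = T ** A ** matrix_inv T"

lemma diag_mat_nth: "diag_mat c $ i $ j = (if i = j then c i else 0)"
  by (simp add: diag_mat_def)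

lemma diag_mult_nth: "(diag_mat c ** A) $ i $ j = c i * A $ i $ j"
  by (simp add: matrix_mult_nth diag_mat_def if_distrib if_distribR sum.delta sum.delta' cong: if_cong)

lemma mult_diag_nth: "(A ** diag_mat c) $ i $ j = A $ i $ j * c j"
  by (simp add: matrix_mult_nth diag_mat_def if_distrib if_distribR sum.delta sum.delta' cong: if_cong)

lemma diag_mat_mult: "diag_mat c ** diag_mat d = diag_mat (\<lambda>i. c i * d i)"
  by (simp add: vec_eq_iff diag_mult_nth diag_mat_nth)

lemma diag_mat_one: "diag_mat (\<lambda>i. 1) = mat 1"
  by (simp add: vec_eq_iff diag_mat_nth mat_def)

lemma diag_mat_diff_mat: "diag_mat c - mat a = diag_mat (\<lambda>i. c i - a)"
  by (simp add: vec_eq_iff diag_mat_nth mat_def)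

lemma invertible_diag: "(\<And>i. d i \<noteq> 0) \<Longrightarrow> invertible (diag_mat d)"
  unfolding invertible_def
  by (intro exI[of _ "diag_mat (\<lambda>i. inverse (d i))"]) (simp add: diag_mat_mult diag_mat_one)

lemma det_diag: "det (diag_mat c) = (\<Prod>i\<in>UNIV. c i)"
  by (subst det_diagonal) (auto simp: diag_mat_nth)

lemma commute_diag_imp_diag:
  assumes "B ** diag_mat x = diag_mat x ** B" "inj x"
  shows "B = diag_mat (\<lambda>i. B $ i $ i)"
proof -
  have "B $ i $ j = 0" if "i \<noteq> j" for i j
  proof -
    have "B $ i $ j * x j = x i * B $ i $ j"
      using assms(1) by (metis diag_mult_nth mult_diag_nth)
    then have "(x j - x i) * B $ i $ j = 0" by (simp add: algebra_simps)
    then show ?thesis using that assms(2) by (auto dest: injD)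
  qed
  then show ?thesis by (auto simp: vec_eq_iff diag_mat_nth)
qed

lemma conj_by_mult: "invertible T \<Longrightarrow> conj_by T A ** conj_by T B = conj_by T (A ** B)"
proof -
  assume T: "invertible T"
  have "conj_by T A ** conj_by T B = T ** A ** (matrix_inv T ** T) ** B ** matrix_inv T"
    by (simp add: conj_by_def matrix_mul_assoc)
  with T show ?thesis by (simp add: matrix_inv_left conj_by_def matrix_mul_assoc)
qed

lemma conj_by_add: "conj_by T (A + B) = conj_by T A + conj_by T B"
  and conj_by_diff: "conj_by T (A - B) = conj_by T A - conj_by T B"
  by (simp_all add: conj_by_def matrix_ring)

lemma conj_by_sum: "conj_by T (\<Sum>i\<in>I. A i) = (\<Sum>i\<in>I. conj_by T (A i))"
  by (simp add: conj_by_def matrix_sum_ldistrib matrix_sum_rdistrib)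

lemma conj_by_mat: "invertible T \<Longrightarrow> conj_by T (mat c) = mat c"
  by (simp add: conj_by_def matrix_mult_mat_commute[of T]) (metis matrix_inv_right matrix_mul_assoc matrix_mul_rid)

lemma conj_by_mat_mult: "conj_by T (mat c ** A) = mat c ** conj_by T A"
  by (simp add: conj_by_def matrix_mult_mat_commute[of T] matrix_mul_assoc)

lemma conj_by_conj_by:
  "invertible S \<Longrightarrow> invertible T \<Longrightarrow> conj_by S (conj_by T A) = conj_by (S ** T) A"
  by (simp add: conj_by_def matrix_inv_mult matrix_mul_assoc)

lemma conj_by_one [simp]: "conj_by (mat 1) A = A"
  by (simp add: conj_by_def)

lemma conj_by_inv: "invertible T \<Longrightarrow> conj_by (matrix_inv T) (conj_by T A) = A"
  and conj_by_inv': "invertible T \<Longrightarrow> conj_by T (conj_by (matrix_inv T) A) = A"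
  by (simp_all add: conj_by_conj_by invertible_matrix_inv matrix_inv_left matrix_inv_right)

lemma conj_by_inject: "invertible T \<Longrightarrow> conj_by T A = conj_by T B \<longleftrightarrow> A = B"
  by (metis conj_by_inv)

lemma conj_by_commuting: "invertible T \<Longrightarrow> T ** A = A ** T \<Longrightarrow> conj_by T A = A"
  by (simp only: conj_by_def matrix_inv_right matrix_mul_rid flip: matrix_mul_assoc)

lemma det_conj_by: "invertible T \<Longrightarrow> det (conj_by T A) = det A"
proof -
  assume "invertible T"
  then have "det T * det (matrix_inv T) = 1" by (metis det_I det_mul matrix_inv_right)
  then show ?thesis by (simp add: conj_by_def det_mul mult.assoc mult.left_commute)
qed

lemma det_conj_by_diff_mat: "invertible T \<Longrightarrow> det (conj_by T A - mat c) = det (A - mat c)"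
  by (metis conj_by_diff conj_by_mat det_conj_by)

lemma spectrum_det: "spectrum T = {c. det (T - mat c) = 0}"
proof -
  have "(\<exists>v. v \<noteq> 0 \<and> T *v v = c *s v) \<longleftrightarrow> det (T - mat c) = 0" for c
  proof -
    have "T *v v = c *s v \<longleftrightarrow> (T - mat c) *v v = 0" for v
    proof -
      have "mat c *v v = c *s v"
        by (simp add: vec_eq_iff matrix_vector_mult_def mat_def if_distrib if_distribR
            sum.delta sum.delta' cong: if_cong)
      then show ?thesis by (simp add: matrix_vector_mult_diff_rdistrib)
    qed
    then show ?thesis
      by (metis invertible_left_inverse invertible_det_nz matrix_left_invertible_ker)
  qed
  then show ?thesis by (simp add: spectrum_def)
qed

lemma spectrum_conj_by: "invertible T \<Longrightarrow> spectrum (conj_by T A) = spectrum A"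
  by (simp add: spectrum_det det_conj_by_diff_mat)

lemma spectrum_diag: "spectrum (diag_mat c) = range c"
  by (auto simp: spectrum_det diag_mat_diff_mat det_diag)

lemma spectrum_transpose: "spectrum (Finite_Cartesian_Product.transpose A) = spectrum A"
proof -
  have "Finite_Cartesian_Product.transpose A - mat c = Finite_Cartesian_Product.transpose (A - mat c)" for c
    by (simp add: vec_eq_iff Finite_Cartesian_Product.transpose_def mat_def)
  then show ?thesis by (simp add: spectrum_det)
qed

text \<open>The head of the list contributes the rightmost factor. With all eigenvalues but one in
  the list this is a multiple of a spectral projection; with the first k nodes it is a Newton basis
  polynomial in \<open>A\<close>.\<close>

definition shifted_prod :: "complex^'n^'n \<Rightarrow> complex list \<Rightarrow> complex^'n^'n" where
  "shifted_prod A xs = foldr (\<lambda>a M. M ** (A - mat a)) xs (mat 1)"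

lemma shifted_prod_simps [simp]:
  "shifted_prod A [] = mat 1" "shifted_prod A (a # xs) = shifted_prod A xs ** (A - mat a)"
  by (simp_all add: shifted_prod_def)

lemma shifted_prod_conj_by:
  "invertible T \<Longrightarrow> shifted_prod (conj_by T A) xs = conj_by T (shifted_prod A xs)"
proof (induction xs)
  case (Cons a xs)
  moreover have "conj_by T A - mat a = conj_by T (A - mat a)"
    using Cons.prems by (simp add: conj_by_diff conj_by_mat)
  ultimately show ?case by (simp add: conj_by_mult)
qed (simp add: conj_by_mat)

lemma shifted_prod_diag: "shifted_prod (diag_mat c) xs = diag_mat (\<lambda>i. \<Prod>a\<leftarrow>xs. c i - a)"
  by (induction xs) (simp_all add: diag_mat_one diag_mat_diff_mat diag_mat_mult mult.commute)

lemma shifted_prod_eigenvector: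
  "A *v v = c *s v \<Longrightarrow> shifted_prod A xs *v v = (\<Prod>a\<leftarrow>xs. c - a) *s v"
proof (induction xs)
  case (Cons a xs)
  have "mat a *v v = a *s v"
    by (simp add: vec_eq_iff matrix_vector_mult_def mat_def if_distrib if_distribR
        sum.delta sum.delta' cong: if_cong)
  then have "(A - mat a) *v v = (c - a) *s v"
    using Cons.prems by (simp add: matrix_vector_mult_diff_rdistrib vector_sub_rdistrib)
  then have "shifted_prod A (a # xs) *v v = (c - a) *s (shifted_prod A xs *v v)"
    by (metis matrix_vector_mul_assoc shifted_prod_simps(2) vector_scalar_commute)
  then show ?case
    using Cons by (simp add: vector_smult_assoc)
qed simp

lemma shifted_prod_commute:
  assumes "A ** B = B ** A" shows "shifted_prod A xs ** B = B ** shifted_prod A xs"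
proof (induction xs)
  case (Cons a xs)
  have "(A - mat a) ** B = B ** (A - mat a)"
    by (simp add: matrix_ring assms matrix_mult_mat_commute)
  then show ?case by (metis Cons matrix_mul_assoc shifted_prod_simps(2))
qed simp

text \<open>Eigenvectors to distinct eigenvalues are independent, so they form the columns of an
  invertible \<open>T\<close>. The order \<open>x\<close> of the eigenvalues is free; this freedom
  later brings the eigenvalue tuple into a prescribed component.\<close>

lemma simple_spectrum_diagonalizable:
  fixes A :: "complex^'n^'n"
  assumes "inj x" "range x \<subseteq> spectrum A"
  obtains T where "invertible T" "A = conj_by T (diag_mat x)"
proof -
  have "\<forall>i. \<exists>v. v \<noteq> 0 \<and> A *v v = x i *s v"
    using assms(2) by (auto simp: spectrum_def)
  then obtain v where v: "\<And>i. v i \<noteq> 0" "\<And>i. A *v v i = x i *s v i" by metis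
  define T :: "complex^'n^'n" where "T = (\<chi> i j. v j $ i)"
  have AT: "A ** T = T ** diag_mat x"
  proof -
    have "(A ** T) $ i $ j = (A *v v j) $ i" for i j
      by (simp add: matrix_mult_nth T_def matrix_vector_mult_def)
    then show ?thesis
      by (simp add: vec_eq_iff mult_diag_nth v(2)) (simp add: T_def)
  qed
  have "w = 0" if "T *v w = 0" for w
  proof -
    have sum0: "(\<Sum>j\<in>UNIV. w $ j *s v j) = 0"
      using that by (simp add: vec_eq_iff matrix_vector_mult_def T_def sum_component mult.commute)
    have "w $ k = 0" for k
    proof -
      \<comment> \<open>The product of all \<open>A - mat (x j)\<close> with
        \<open>j \<noteq> k\<close> annihilates every \<open>v j\<close> except
        \<open>v k\<close>.\<close>
      obtain xs where xs: "set xs = x ` (- {k})" using finite_list[of "x ` (- {k})"] by auto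
      have "0 = shifted_prod A xs *v (\<Sum>j\<in>UNIV. w $ j *s v j)" by (simp add: sum0)
      also have "\<dots> = (\<Sum>j\<in>UNIV. w $ j *s (shifted_prod A xs *v v j))"
        by (simp add: linear_sum[OF matrix_vector_mul_linear] vector_scalar_commute)
      also have "\<dots> = (\<Sum>j\<in>UNIV. (w $ j * (\<Prod>a\<leftarrow>xs. x j - a)) *s v j)"
        by (simp add: shifted_prod_eigenvector[OF v(2)] vector_smult_assoc)
      also have "\<dots> = (\<Sum>j\<in>UNIV. if j = k then (w $ k * (\<Prod>a\<leftarrow>xs. x k - a)) *s v k else 0)"
      proof (intro sum.cong refl)
        fix j
        have "(\<Prod>a\<leftarrow>xs. x j - a) = 0" if "j \<noteq> k"
          using that xs by (auto simp: prod_list_zero_iff)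
        then show "(w $ j * (\<Prod>a\<leftarrow>xs. x j - a)) *s v j =
          (if j = k then (w $ k * (\<Prod>a\<leftarrow>xs. x k - a)) *s v k else 0)" by auto
      qed
      also have "\<dots> = (w $ k * (\<Prod>a\<leftarrow>xs. x k - a)) *s v k" by simp
      finally have "w $ k * (\<Prod>a\<leftarrow>xs. x k - a) = 0"
        using v(1)[of k] by (metis vector_mul_eq_0)
      moreover have "(\<Prod>a\<leftarrow>xs. x k - a) \<noteq> 0"
        using xs assms(1) by (auto simp: prod_list_zero_iff dest: injD)
      ultimately show ?thesis by simp
    qed
    then show ?thesis by (simp add: vec_eq_iff)
  qed
  then have inv: "invertible T"
    by (metis invertible_left_inverse matrix_left_invertible_ker)
  then have "A = conj_by T (diag_mat x)"
    by (metis AT conj_by_def matrix_inv_right matrix_mul_assoc matrix_mul_rid)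
  with inv that show ?thesis by blast
qed

text \<open>The index type carries no order, so triangularity refers to an injective rank
  \<open>h\<close>. A permutation with nonzero product never lowers the rank; as it preserves the
  sum of all ranks, it preserves each of them and is the identity.\<close>

lemma det_upper_triangular:
  fixes U :: "complex^'n^'n" and h :: "'n \<Rightarrow> nat"
  assumes "inj h" "\<And>i j. h j < h i \<Longrightarrow> U $ i $ j = 0"
  shows "det U = (\<Prod>i\<in>UNIV. U $ i $ i)"
proof -
  have z: "(\<Prod>i\<in>UNIV. U $ i $ p i) = 0" if p: "p permutes UNIV" "p \<noteq> id" for p
  proof (rule ccontr)
    assume "(\<Prod>i\<in>UNIV. U $ i $ p i) \<noteq> 0"
    then have le: "h i \<le> h (p i)" for i
      using assms(2)[of "p i" i] by (auto simp: not_less[symmetric])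
    have "(\<Sum>i\<in>UNIV. h (p i)) = (\<Sum>i\<in>UNIV. h i)"
      using sum.permute[OF p(1), of h] by (simp add: o_def)
    moreover have "h i = h (p i)" if "(\<Sum>i\<in>UNIV. h (p i)) = (\<Sum>i\<in>UNIV. h i)" for i
    proof (rule ccontr)
      assume "h i \<noteq> h (p i)"
      then have "(\<Sum>i\<in>UNIV. h i) < (\<Sum>i\<in>UNIV. h (p i))"
        using le by (intro sum_strict_mono_ex1) (auto simp: order_less_le)
      then show False using that by simp
    qed
    ultimately have "h (p i) = h i" for i by metis
    then have "p = id" using assms(1) by (intro ext) (auto dest: injD)
    then show False using p(2) by simp
  qed
  have "det U = (\<Sum>p\<in>{p :: 'n \<Rightarrow> 'n. p permutes UNIV}. if p = id then (\<Prod>i\<in>UNIV. U $ i $ i) else 0)"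
    unfolding det_def by (rule sum.cong[OF refl]) (use z in \<open>auto simp: sign_id\<close>)
  also have "\<dots> = (\<Prod>i\<in>UNIV. U $ i $ i)"
    by (simp add: permutes_id finite_permutations)
  finally show ?thesis .
qed

lemma spectrum_upper_triangular:
  fixes U :: "complex^'n^'n" and h :: "'n \<Rightarrow> nat"
  assumes "inj h" "\<And>i j. h j < h i \<Longrightarrow> U $ i $ j = 0"
  shows "spectrum U = range (\<lambda>i. U $ i $ i)"
proof -
  have "det (U - mat c) = (\<Prod>i\<in>UNIV. (U - mat c) $ i $ i)" for c
    by (rule det_upper_triangular[OF assms(1)]) (auto simp: mat_def assms(2))
  then show ?thesis by (auto simp: spectrum_det mat_def)
qed

section \<open>Transvections\<close>

lemma mult_transvection_nth:
  "(A ** transvection i j t) $ a $ b = A $ a $ b + (if b = j then A $ a $ i * t else 0)"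
proof -
  have "(A ** transvection i j t) $ a $ b =
    (\<Sum>k\<in>UNIV. (if k = b then A $ a $ b else 0) + (if k = i then (if b = j then A $ a $ i * t else 0) else 0))"
    unfolding matrix_mult_nth by (rule sum.cong) (auto simp: transvection_def algebra_simps)
  then show ?thesis by (simp add: sum.distrib)
qed

lemma transvection_mult_nth:
  "(transvection i j t ** A) $ a $ b = A $ a $ b + (if a = i then t * A $ j $ b else 0)"
proof -
  have "(transvection i j t ** A) $ a $ b =
    (\<Sum>k\<in>UNIV. (if k = a then A $ a $ b else 0) + (if k = j then (if a = i then t * A $ j $ b else 0) else 0))"
    unfolding matrix_mult_nth by (rule sum.cong) (auto simp: transvection_def algebra_simps)
  then show ?thesis by (simp add: sum.distrib)
qed

lemma transvection_nth:
  "transvection i j t $ a $ b = (if a = b then 1 else 0) + (if a = i \<and> b = j then t else 0)"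
  by (simp add: transvection_def)

lemma transvection_zero [simp]: "transvection i j 0 = mat 1"
  by (simp add: vec_eq_iff transvection_nth mat_def)

lemma transvection_add: "i \<noteq> j \<Longrightarrow> transvection i j s ** transvection i j t = transvection i j (s + t)"
  by (simp add: vec_eq_iff mult_transvection_nth transvection_nth)

lemma transvection_commute:
  "j \<noteq> k \<Longrightarrow> i \<noteq> l \<Longrightarrow> transvection i j s ** transvection k l t = transvection k l t ** transvection i j s"
  by (auto simp: vec_eq_iff mult_transvection_nth transvection_nth)

lemma transvection_braid:
  "i \<noteq> j \<Longrightarrow> j \<noteq> k \<Longrightarrow> i \<noteq> k \<Longrightarrow>
    transvection i j a ** transvection j k b = transvection j k b ** transvection i j a ** transvection i k (a * b)"
  by (auto simp: vec_eq_iff mult_transvection_nth transvection_nth)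

lemma transvection_inverse: "i \<noteq> j \<Longrightarrow> transvection i j t ** transvection i j (- t) = mat 1"
  by (simp add: transvection_add)

lemma invertible_transvection: "i \<noteq> j \<Longrightarrow> invertible (transvection i j t)"
  unfolding invertible_right_inverse by (blast intro: transvection_inverse)

lemma matrix_inv_transvection: "i \<noteq> j \<Longrightarrow> matrix_inv (transvection i j t) = transvection i j (- t)"
  by (intro matrix_inv_unique_left transvection_inverse)

text \<open>Growth on the right matches the increments \<open>K\<close>, which compare
  \<open>g\<close> with \<open>g ** transvection i j t\<close>; \<open>proj_system_eq\<close> is an
  induction over this predicate.\<close>

inductive transvection_product :: "complex^'n^'n \<Rightarrow> bool" where
  one: "transvection_product (mat 1)"
| step: "transvection_product g \<Longrightarrow> i \<noteq> j \<Longrightarrow> transvection_product (g ** transvection i j t)"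

lemma transvection_product_invertible: "transvection_product g \<Longrightarrow> invertible g"
  by (induction rule: transvection_product.induct) (auto intro: invertible_mult invertible_transvection)

lemma transvection_product_mult:
  "transvection_product h \<Longrightarrow> transvection_product g \<Longrightarrow> transvection_product (g ** h)"
  by (induction rule: transvection_product.induct)
    (auto simp: matrix_mul_assoc intro: transvection_product.step)

lemma transvection_product_transvection: "i \<noteq> j \<Longrightarrow> transvection_product (transvection i j t)"
  using transvection_product.step[OF transvection_product.one] by fastforce

lemma transvection_product_inv: "transvection_product g \<Longrightarrow> transvection_product (matrix_inv g)"
proof (induction rule: transvection_product.induct)
  case (step g i j t)
  then have "matrix_inv (g ** transvection i j t) = transvection i j (- t) ** matrix_inv g"
    by (simp add: matrix_inv_mult transvection_product_invertible invertible_transvection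
        matrix_inv_transvection)
  with step show ?case
    by (simp add: transvection_product_mult transvection_product_transvection)
qed (simp add: transvection_product.one)

text \<open>Row operations with pivot row \<open>k\<close>. The last conjunct is there for
  iteration: a column with a zero in the pivot row is untouched, so columns cleared earlier stay
  cleared.\<close>

lemma transvection_clear_column:
  fixes B :: "complex^'n^'n"
  assumes "B $ k $ k \<noteq> 0" "finite L"
  shows "\<exists>h. transvection_product h \<and> (\<forall>j\<in>L - {k}. (h ** B) $ j $ k = 0)
    \<and> (\<forall>b. (h ** B) $ k $ b = B $ k $ b) \<and> (\<forall>i. B $ k $ i = 0 \<longrightarrow> (\<forall>a. (h ** B) $ a $ i = B $ a $ i))"
  using assms(2)
proof (induction L)
  case empty
  then show ?case by (intro exI[of _ "mat 1"]) (simp add: transvection_product.one)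
next
  case (insert j L)
  then obtain h where h: "transvection_product h" "\<forall>j\<in>L - {k}. (h ** B) $ j $ k = 0"
    "\<forall>b. (h ** B) $ k $ b = B $ k $ b" "\<forall>i. B $ k $ i = 0 \<longrightarrow> (\<forall>a. (h ** B) $ a $ i = B $ a $ i)"
    by blast
  show ?case
  proof (cases "j = k")
    case True
    with h show ?thesis by (intro exI[of _ h]) auto
  next
    case False
    let ?u = "transvection j k (- (h ** B) $ j $ k / B $ k $ k)"
    have "transvection_product (?u ** h)"
      using False h(1) by (intro transvection_product_mult transvection_product_transvection)
    moreover have "((?u ** h) ** B) $ a $ b =
      (h ** B) $ a $ b + (if a = j then - (h ** B) $ j $ k / B $ k $ k * B $ k $ b else 0)" for a b
      using h(3) by (simp add: transvection_mult_nth flip: matrix_mul_assoc)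
    ultimately show ?thesis
      using h False assms(1) by (intro exI[of _ "?u ** h"]) auto
  qed
qed

lemma invertible_mult_vec_nonzero:
  fixes B :: "complex^'n^'n"
  shows "invertible B \<Longrightarrow> w \<noteq> 0 \<Longrightarrow> B *v w \<noteq> 0"
  by (metis invertible_left_inverse matrix_left_invertible_ker)

lemma transvection_diagonalize:
  fixes g :: "complex^'n^'n"
  assumes "invertible g" "finite K"
  shows "\<exists>h. transvection_product h \<and> (\<forall>i\<in>K. \<forall>j. j \<noteq> i \<longrightarrow> (h ** g) $ j $ i = 0)"
  using assms(2)
proof (induction K)
  case empty
  then show ?case using transvection_product.one by blast
next
  case (insert k K)
  then obtain h where h: "transvection_product h" "\<And>i j. i \<in> K \<Longrightarrow> j \<noteq> i \<Longrightarrow> (h ** g) $ j $ i = 0"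
    by blast
  define B where "B = h ** g"
  have invB: "invertible B"
    using h(1) assms(1) by (simp add: B_def invertible_mult transvection_product_invertible)
  have B0: "B $ j $ i = 0" if "i \<in> K" "j \<noteq> i" for i j using h(2)[OF that] by (simp add: B_def)
  have diag: "B $ i $ i \<noteq> 0" if "i \<in> K" for i
  proof
    assume "B $ i $ i = 0"
    then have "B *v axis i 1 = 0"
      using B0[OF that] 
      by (simp add: vec_eq_iff matrix_vector_mult_def axis_def if_distrib cong: if_cong) metis
    moreover have "axis i 1 \<noteq> (0 :: complex^'n)" by (simp add: axis_eq_0_iff)
    ultimately show False using invertible_mult_vec_nonzero[OF invB] by blast
  qed
  \<comment> \<open>If column \<open>k\<close> vanished outside the rows in \<open>K\<close>, it
    would be a combination of the columns in \<open>K\<close>, which are multiples of unit vectors.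
    The vector \<open>w\<close> encodes that relation and would lie in the kernel of
    \<open>B\<close>.\<close>
  obtain l where l: "l \<notin> K" "B $ l $ k \<noteq> 0"
  proof -
    define w where "w = (\<chi> i. if i = k then 1 else if i \<in> K then - B $ i $ k / B $ i $ i else 0)"
    have "w $ k \<noteq> 0" by (simp add: w_def)
    then have "B *v w \<noteq> 0" by (intro invertible_mult_vec_nonzero[OF invB]) auto
    then obtain a where a: "(B *v w) $ a \<noteq> 0" by (auto simp: vec_eq_iff)
    have "(B *v w) $ a = (\<Sum>i\<in>UNIV. (if i = k then B $ a $ k else 0) + (if i = a \<and> a \<in> K then - B $ a $ k else 0))"
      unfolding matrix_vector_mult_def
      by (simp, rule sum.cong) (use insert(2) B0 diag in \<open>auto simp: w_def, metis+\<close>)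
    also have "\<dots> = B $ a $ k - (if a \<in> K then B $ a $ k else 0)"
      by (auto simp: sum.distrib)
    finally show ?thesis using a that[of a] by (auto split: if_splits)
  qed
  \<comment> \<open>A vanishing pivot is repaired by adding row \<open>l\<close> to row
    \<open>k\<close>. The columns in \<open>K\<close> have a zero in row \<open>l\<close>, as
    \<open>l\<close> is outside \<open>K\<close>, and do not change.\<close>
  obtain u where u: "transvection_product u" "(u ** B) $ k $ k \<noteq> 0"
    "\<And>i j. i \<in> K \<Longrightarrow> (u ** B) $ j $ i = B $ j $ i"
  proof (cases "B $ k $ k = 0")
    case True
    then have "l \<noteq> k" using l by auto
    show ?thesis
    proof (rule that[of "transvection k l 1"])
      show "transvection_product (transvection k l 1)"
        using \<open>l \<noteq> k\<close> transvection_product_transvection by metis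
      show "(transvection k l 1 ** B) $ k $ k \<noteq> 0"
        using True l by (simp add: transvection_mult_nth)
      show "(transvection k l 1 ** B) $ j $ i = B $ j $ i" if "i \<in> K" for i j
        using B0[of i l] that l by (auto simp: transvection_mult_nth)
    qed
  next
    case False
    then show ?thesis using that[of "mat 1"] by (simp add: transvection_product.one)
  qed
  obtain v where v: "transvection_product v" "\<forall>j\<in>UNIV - {k}. (v ** (u ** B)) $ j $ k = 0"
    "\<forall>i. (u ** B) $ k $ i = 0 \<longrightarrow> (\<forall>a. (v ** (u ** B)) $ a $ i = (u ** B) $ a $ i)"
    using transvection_clear_column[OF u(2), of UNIV] by auto
  have "transvection_product (v ** u ** h)"
    using h(1) u(1) v(1) by (intro transvection_product_mult)
  moreover have "(v ** u ** h ** g) $ j $ i = 0" if "i \<in> insert k K" "j \<noteq> i" for i j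
  proof -
    have eq: "v ** u ** h ** g = v ** (u ** B)" by (simp add: B_def matrix_mul_assoc)
    show ?thesis
    proof (cases "i = k")
      case True then show ?thesis using v(2) that by (simp add: eq)
    next
      case False
      then have "i \<in> K" using that by simp
      moreover have "(u ** B) $ k $ i = 0" using u(3) B0 False \<open>i \<in> K\<close> by metis
      ultimately show ?thesis using v(3) u(3) B0 that(2) by (simp add: eq)
    qed
  qed
  ultimately show ?case by blast
qed

text \<open>The diagonal factor only rescales the columns of a frame and drops out of
  \<open>conj_by g (diag_mat w)\<close>, so it is enough to know projections on transvection
  products.\<close>

lemma invertible_eq_transvection_product_diag:
  fixes g :: "complex^'n^'n"
  assumes "invertible g"
  obtains h d where "transvection_product h" "g = h ** diag_mat d" "\<And>i. d i \<noteq> 0"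
proof -
  obtain h where h: "transvection_product h" "\<And>i j. j \<noteq> i \<Longrightarrow> (h ** g) $ j $ i = 0"
    using transvection_diagonalize[OF assms, of UNIV] by auto
  define d where "d i = (h ** g) $ i $ i" for i
  have hg: "h ** g = diag_mat d"
    using h(2) by (simp add: vec_eq_iff diag_mat_nth d_def)
  have inv: "invertible h" using h(1) by (rule transvection_product_invertible)
  have "g = matrix_inv h ** diag_mat d"
    by (metis hg inv matrix_inv_left matrix_mul_assoc matrix_mul_lid)
  moreover have "d i \<noteq> 0" for i
  proof -
    have "det (h ** g) \<noteq> 0" using inv assms by (simp add: invertible_det_nz det_mul)
    then show ?thesis by (simp add: hg det_diag)
  qed
  ultimately show ?thesis using that h(1) transvection_product_inv by blast
qed

section \<open>Systems of projections indexed by bases\<close>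

text \<open>The model is the system in which \<open>Q k g\<close> is the spectral projection that a preserver assigns
  to the \<open>k\<close>-th line of the frame formed by the columns of \<open>g\<close>.\<close>

locale proj_system =
  fixes Q :: "'n \<Rightarrow> complex^'n^'n \<Rightarrow> complex^'n^'n"
  assumes sum_one: "invertible g \<Longrightarrow> (\<Sum>k\<in>UNIV. Q k g) = mat 1"
    and idem: "invertible g \<Longrightarrow> Q k g ** Q k g = Q k g"
    and orth: "invertible g \<Longrightarrow> k \<noteq> l \<Longrightarrow> Q k g ** Q l g = 0"
    and fixed: "invertible g \<Longrightarrow> i \<noteq> j \<Longrightarrow> k \<noteq> i \<Longrightarrow> k \<noteq> j \<Longrightarrow> Q k (g ** transvection i j t) = Q k g"
    and cont: "invertible g \<Longrightarrow> i \<noteq> j \<Longrightarrow> continuous_on UNIV (\<lambda>t. Q k (g ** transvection i j t))"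
begin

section \<open>Increments of the projections and their dependence on the base point\<close>

definition K :: "complex^'n^'n \<Rightarrow> 'n \<Rightarrow> 'n \<Rightarrow> complex \<Rightarrow> complex^'n^'n" where
  "K g i j t = Q i (g ** transvection i j t) - Q i g"

lemma Q_step: "Q i (g ** transvection i j t) = Q i g + K g i j t"
  by (simp add: K_def)

text \<open>The projections outside \<open>S\<close> do not move, and all of them add up to the
  identity.\<close>

lemma sum_fixed:
  assumes "invertible g" "i \<noteq> j" "i \<in> S" "j \<in> S"
  shows "(\<Sum>k\<in>S. Q k (g ** transvection i j t)) = (\<Sum>k\<in>S. Q k g)"
proof -
  have 1: "(\<Sum>k\<in>S. Q k g) + (\<Sum>k\<in>-S. Q k g) = mat 1" if "invertible g" for g
    using sum_one[OF that] sum.union_disjoint[of S "-S" "\<lambda>k. Q k g"] by simp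
  have "(\<Sum>k\<in>-S. Q k (g ** transvection i j t)) = (\<Sum>k\<in>-S. Q k g)"
    using assms by (intro sum.cong refl fixed) auto
  with 1[OF assms(1)] 1[of "g ** transvection i j t"] show ?thesis
    using assms by (simp add: invertible_mult invertible_transvection) (metis add_right_cancel)
qed

lemma Q_step':
  assumes "invertible g" "i \<noteq> j"
  shows "Q j (g ** transvection i j t) = Q j g - K g i j t"
proof -
  have "Q i (g ** transvection i j t) + Q j (g ** transvection i j t) = Q i g + Q j g"
    using sum_fixed[OF assms, of "{i, j}" t] assms(2) by simp
  then show ?thesis by (simp add: K_def algebra_simps)
qed

context
  fixes g :: "complex^'n^'n" and i j k :: 'n
  assumes g: "invertible g" and ijk: "i \<noteq> j" "j \<noteq> k" "i \<noteq> k"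
begin

lemma invs: "invertible (g ** transvection i j a)" "invertible (g ** transvection i k a)"
  "invertible (g ** transvection j k a)"
  "invertible (g ** transvection i j a ** transvection i k b)"
  "invertible (g ** transvection i k a ** transvection j k b)"
  "invertible (g ** transvection i j a ** transvection j k b)"
  using g ijk by (auto intro!: invertible_mult invertible_transvection)

text \<open>The two sides of the equation are the values at
  \<open>g (1 + a e\<^sub>i\<^sub>j + b e\<^sub>j\<^sub>k + c e\<^sub>i\<^sub>k)\<close>, a matrix that factors in three ways;
  each factorization exhibits one of the three projections as independent of one parameter.\<close>

lemma heisenberg_sum:
  "Q i (g ** transvection i j a ** transvection i k (c - a * b))
    + Q k (g ** transvection i k c ** transvection j k b)
    + Q j (g ** transvection i j a ** transvection j k b) = Q i g + Q j g + Q k g"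
proof -
  let ?u = "transvection i j a ** transvection i k (c - a * b) ** transvection j k b"
  have u2: "?u = transvection i k c ** transvection j k b ** transvection i j a"
    using ijk by (auto simp: vec_eq_iff mult_transvection_nth transvection_nth algebra_simps)
  have u3: "?u = transvection i j a ** transvection j k b ** transvection i k (c - a * b)"
    using ijk by (auto simp: vec_eq_iff mult_transvection_nth transvection_nth algebra_simps)
  have 1: "Q i (g ** ?u) = Q i (g ** transvection i j a ** transvection i k (c - a * b))"
    using fixed[OF invs(4), of j k i] ijk by (simp add: matrix_mul_assoc)
  have 2: "Q k (g ** ?u) = Q k (g ** transvection i k c ** transvection j k b)"
    unfolding u2 using fixed[OF invs(5), of i j k] ijk by (simp add: matrix_mul_assoc)
  have 3: "Q j (g ** ?u) = Q j (g ** transvection i j a ** transvection j k b)"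
    unfolding u3 using fixed[OF invs(6), of i k j] ijk by (simp add: matrix_mul_assoc)
  have "(\<Sum>l\<in>{i,j,k}. Q l (g ** ?u)) = (\<Sum>l\<in>{i,j,k}. Q l g)"
    using sum_fixed[OF invs(4), of j k "{i,j,k}"] sum_fixed[OF invs(1), of i k "{i,j,k}"]
      sum_fixed[OF g, of i j "{i,j,k}"] ijk
    by (simp add: matrix_mul_assoc)
  then show ?thesis using ijk 1 2 3 by (simp add: ac_simps)
qed

text \<open>Subtract from \<open>heisenberg_sum\<close> its instance at \<open>c = 0\<close>: the
  projection of index \<open>j\<close> cancels. In the resulting equation the side with
  \<open>Q k\<close> does not involve \<open>a\<close>, so putting \<open>a = 0\<close> on the other
  side evaluates both.\<close>

lemma K_shift:
  "Q i (g ** transvection i j a ** transvection i k (c - a * b))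
    - Q i (g ** transvection i j a ** transvection i k (- (a * b))) = K g i k c"
  and K_shift_col:
  "Q k (g ** transvection i k c ** transvection j k b) = Q k (g ** transvection j k b) - K g i k c"
proof -
  have e: "Q i (g ** transvection i j a ** transvection i k (c - a * b))
    - Q i (g ** transvection i j a ** transvection i k (- (a * b)))
    = Q k (g ** transvection j k b) - Q k (g ** transvection i k c ** transvection j k b)" for a c
    using trans[OF heisenberg_sum[of a c b] heisenberg_sum[of a 0 b, symmetric]]
    by (simp add: algebra_simps)
  have "K g i k c = Q k (g ** transvection j k b) - Q k (g ** transvection i k c ** transvection j k b)"
    using e[of 0 c] by (simp add: K_def)
  then have K: "Q k (g ** transvection j k b) - Q k (g ** transvection i k c ** transvection j k b) = K g i k c"
    by simp
  then show "Q k (g ** transvection i k c ** transvection j k b) = Q k (g ** transvection j k b) - K g i k c"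
    by (metis diff_diff_eq2 add_diff_cancel_left')
  show
    "Q i (g ** transvection i j a ** transvection i k (c - a * b))
      - Q i (g ** transvection i j a ** transvection i k (- (a * b))) = K g i k c"
    using e[of a c] K by simp
qed

text \<open>Together with \<open>K_col\<close>, \<open>K_before\<close> and \<open>K_after\<close>
  this describes how an increment changes when the base point moves by a transvection.\<close>

lemma K_row: "K (g ** transvection i j a) i k c = K g i k c"
proof (cases "a = 0")
  case False
  with K_shift[of a c 0] show ?thesis by (simp add: K_def)
qed (simp add: K_def)

lemma K_col: "K (g ** transvection j k b) i k c = K g i k c"
proof -
  have "Q k (g ** transvection j k b ** transvection i k c) = Q k (g ** transvection j k b) - K g i k c"
    using K_shift_col[of c b] ijk transvection_commute[of k i j k b c]
    by (simp flip: matrix_mul_assoc)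
  then show ?thesis
    using Q_step'[OF invs(3), of i k b c] ijk by simp
qed

text \<open>For \<open>a \<noteq> 0\<close> the choice \<open>b = - s / a\<close> in
  \<open>K_shift\<close> turns \<open>- (a * b)\<close> into \<open>s\<close> and gives additivity
  at the base point \<open>g ** transvection i j a\<close>. The value \<open>a = 0\<close> is out of
  reach of this substitution and is obtained as a limit, by the continuity axiom.\<close>

lemma K_add: "K g i k (s + t) = K g i k s + K g i k t"
proof -
  have ne: "Q i (g ** transvection i k (s + t) ** transvection i j a)
     - Q i (g ** transvection i k s ** transvection i j a) = K g i k t" if "a \<noteq> 0" for a
  proof -
    have "a * (- s / a) = - s" using that by simp
    then have "Q i (g ** transvection i j a ** transvection i k (t + s))
      - Q i (g ** transvection i j a ** transvection i k s) = K g i k t"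
      using K_shift[of a t "- s / a"] by simp
    then show ?thesis
      using ijk transvection_commute[of j i i k a] by (simp add: add.commute flip: matrix_mul_assoc)
  qed
  define F where "F a = Q i (g ** transvection i k (s + t) ** transvection i j a)
     - Q i (g ** transvection i k s ** transvection i j a)" for a
  have "continuous_on UNIV F"
    unfolding F_def using ijk invs by (intro continuous_intros cont) auto
  then have "F \<midarrow>0\<rightarrow> F 0" by (simp add: continuous_on_def)
  moreover have "F \<midarrow>0\<rightarrow> K g i k t"
  proof (rule tendsto_eventually)
    show "\<forall>\<^sub>F a in at 0. F a = K g i k t"
      unfolding eventually_at using ne by (intro exI[of _ 1]) (auto simp: F_def)
  qed
  ultimately have "F 0 = K g i k t" by (rule LIM_unique)
  then show ?thesis by (simp add: F_def K_def algebra_simps)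
qed

lemma K_minus: "K g i k (- t) = - K g i k t"
proof -
  have "K g i k 0 = 0" by (simp add: K_def)
  then show ?thesis using K_add[of t "- t"] by (simp add: eq_neg_iff_add_eq_0 add.commute)
qed

text \<open>Of the three projections only the middle one feels both parameters. Its idempotency is
  the source of the Jordan relation.\<close>

lemma Q_mid: "Q j (g ** transvection i j a ** transvection j k b)
    = Q j g - K g i j a + K g i k (a * b) + K g j k b"
proof -
  have solve: "y = s - x - z" if "x + z + y = s" for x y z s :: "complex^'n^'n"
    using that by (auto simp: algebra_simps)
  have 1: "Q i (g ** transvection i j a ** transvection i k (0 - a * b))
     = Q i g + K g i j a - K g i k (a * b)"
    using K_row[of a "- (a * b)"] by (simp add: Q_step K_minus)
  have 2: "Q k (g ** transvection i k 0 ** transvection j k b) = Q k g - K g j k b"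
    using Q_step' g ijk by simp
  show ?thesis
    by (subst solve[OF heisenberg_sum[of a 0 b]]) (simp only: 1 2, simp)
qed

lemma K_before: "K (g ** transvection i j a) j k b = K g j k b + K g i k (a * b)"
  using Q_mid[of a b] Q_step'[OF g ijk(1), of a] by (simp add: K_def)

text \<open>Moving \<open>transvection j k b\<close> to the right of
  \<open>transvection i j a\<close> costs a factor \<open>transvection i k (- (a * b))\<close>; once
  it stands last, \<open>Q i\<close> does not see it.\<close>

lemma K_after: "K (g ** transvection j k b) i j a = K g i j a - K g i k (a * b)"
proof -
  have eq: "transvection j k b ** transvection i j a = 
     transvection i j a ** transvection i k (- (a * b)) ** transvection j k b"
    using ijk by (auto simp: vec_eq_iff mult_transvection_nth transvection_nth algebra_simps)
  have "Q i (g ** transvection j k b ** transvection i j a)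
     = Q i (g ** transvection i j a ** transvection i k (- (a * b)) ** transvection j k b)"
    using eq by (metis matrix_mul_assoc)
  also have "\<dots> = Q i (g ** transvection i j a ** transvection i k (- (a * b)))"
    using fixed[OF invs(4)] ijk by simp
  also have "\<dots> = Q i g + K g i j a - K g i k (a * b)"
    using K_row[of a "- (a * b)"] by (simp add: Q_step K_minus)
  finally show ?thesis using fixed[OF g, of j k i b] ijk by (simp add: K_def)
qed

end

end

section \<open>Quadratic relations between the increments\<close>

lemma third_index:
  fixes i j :: "'n::finite"
  assumes "3 \<le> CARD('n)"
  obtains k where "k \<noteq> i" "k \<noteq> j"
proof -
  have "card {i, j} \<le> 2" by (simp add: card_insert_if)
  then have "card {i, j} < CARD('n)" using assms by simp
  then have "{i, j} \<noteq> UNIV" by auto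
  then show ?thesis using that by blast
qed

lemma scaleR_matrix_mult: "(c *\<^sub>R A) ** B = c *\<^sub>R (A ** B)" "A ** (c *\<^sub>R B) = c *\<^sub>R (A ** B)"
  for A B :: "complex^'n^'n"
  by (simp_all add: vec_eq_iff matrix_mult_nth scaleR_sum_right)

text \<open>Separates a part \<open>x\<close> of degree one from a part \<open>z\<close> of degree
  two by doubling a parameter. Doubling replaces general scaling because the increments are only
  known to be additive.\<close>

lemma pencil_cancel:
  fixes x z w :: "'a::real_vector"
  assumes "x + z = w" "2 *\<^sub>R x + 4 *\<^sub>R z = 2 *\<^sub>R w"
  shows "z = 0"
proof -
  have "4 *\<^sub>R z = 2 *\<^sub>R z + 2 *\<^sub>R z" by (simp flip: scaleR_left_distrib)
  then have "2 *\<^sub>R (x + z) + 2 *\<^sub>R z = 2 *\<^sub>R w"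
    using assms(2) by (simp add: scaleR_add_right add.assoc)
  then show ?thesis by (simp add: assms(1))
qed

context proj_system
begin

text \<open>The third index is the auxiliary \<open>j\<close> of \<open>K_add\<close>; this is one
  of the places where dimension at least 3 enters.\<close>

lemma K_additive:
  assumes "3 \<le> CARD('n)" "invertible g" "i \<noteq> j"
  shows "K g i j (s + t) = K g i j s + K g i j t"
proof -
  obtain k where "k \<noteq> i" "k \<noteq> j" using third_index[OF assms(1)] by metis
  then show ?thesis using K_add[OF assms(2), of i k j] assms(3) by metis
qed

lemma K_double:
  assumes "3 \<le> CARD('n)" "invertible g" "i \<noteq> j"
  shows "K g i j (2 * t) = 2 *\<^sub>R K g i j t"
  using K_additive[OF assms, of t t] by (metis scaleR_2 mult_2)

text \<open>Compare the idempotency equations of \<open>E + L\<close> and \<open>E + 2 L\<close>.\<close>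

lemma idempotent_pencil:
  fixes E L :: "complex^'m^'m"
  assumes "E ** E = E" "(E + L) ** (E + L) = E + L" "(E + 2 *\<^sub>R L) ** (E + 2 *\<^sub>R L) = E + 2 *\<^sub>R L"
  shows "L ** L = 0" "E ** L + L ** E = L"
proof -
  have 1: "E ** L + L ** E + L ** L = L"
    using assms(1,2) by (simp add: matrix_ring algebra_simps)
  have "2 *\<^sub>R (E ** L + L ** E) + 4 *\<^sub>R (L ** L) = 2 *\<^sub>R L"
    using assms(1,3) by (simp add: matrix_ring scaleR_matrix_mult scaleR_add_right add.assoc) 
      (simp add: algebra_simps)
  with 1 show "L ** L = 0" by (rule pencil_cancel)
  with 1 show "E ** L + L ** E = L" by simp
qed

text \<open>The values at \<open>t\<close> and \<open>2 * t\<close> form the pencil of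
  \<open>idempotent_pencil\<close>, with \<open>L\<close> equal to the increment for
  \<open>Q i\<close> and to its negative for \<open>Q j\<close>.\<close>

lemma
  assumes "3 \<le> CARD('n)" "invertible g" "i \<noteq> j"
  shows K_square: "K g i j t ** K g i j t = 0"
    and K_left: "Q i g ** K g i j t + K g i j t ** Q i g = K g i j t"
    and K_right: "Q j g ** K g i j t + K g i j t ** Q j g = K g i j t"
proof -
  have inv: "invertible (g ** transvection i j s)" for s
    using assms by (intro invertible_mult invertible_transvection)
  note a = idem[OF assms(2)] idem[OF inv[of t], of i] idem[OF inv[of "2 * t"], of i]
    idem[OF inv[of t], of j] idem[OF inv[of "2 * t"], of j]
  note b = a[unfolded Q_step Q_step'[OF assms(2,3)] K_double[OF assms]]
  show "K g i j t ** K g i j t = 0" "Q i g ** K g i j t + K g i j t ** Q i g = K g i j t"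
    using idempotent_pencil[OF b(1-3)] by auto
  have "Q j g ** (- K g i j t) + (- K g i j t) ** Q j g = - K g i j t"
    using idempotent_pencil(2)[of "Q j g" "- K g i j t"] b(1,4,5) by simp
  then have "- (Q j g ** K g i j t + K g i j t ** Q j g) = - K g i j t"
    by (simp add: matrix_ring)
  then show "Q j g ** K g i j t + K g i j t ** Q j g = K g i j t"
    by (simp only: neg_equal_iff_equal)
qed

text \<open>Expand the idempotency of the middle projection given by \<open>Q_mid\<close>. The
  unwanted products UW and VW have bidegree (2,1) and (1,2) in \<open>a\<close> and
  \<open>b\<close>, against (1,1) for UV and W, so doubling \<open>a\<close> and then
  \<open>b\<close> removes them.\<close>

lemma K_jordan:
  assumes n: "3 \<le> CARD('n)" and g: "invertible g" and ijk: "i \<noteq> j" "j \<noteq> k" "i \<noteq> k"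
  shows "K g i k (a * b) = - (K g i j a ** K g j k b + K g j k b ** K g i j a)"
proof -
  let ?E = "Q j g" and ?U = "K g i j" and ?V = "K g j k" and ?W = "K g i k"
  \<comment> \<open>By \<open>K_left\<close> and \<open>K_right\<close> the increment for
    \<open>i\<close>, \<open>k\<close> lives in the blocks joining the ranges of
    \<open>Q i g\<close> and \<open>Q k g\<close>, both of which are orthogonal to
    \<open>Q j g\<close>.\<close>
  have EW: "?E ** ?W c = 0" "?W c ** ?E = 0" for c
  proof -
    note kl = K_left[OF n g ijk(3), of c] and kr = K_right[OF n g ijk(3), of c]
    note o = orth[OF g] 
    have "?E ** ?W c = ?E ** (Q i g ** ?W c + ?W c ** Q i g)" by (simp only: kl)
    also have "\<dots> = ?E ** ?W c ** Q i g"
      using o[of j i] ijk by (simp add: matrix_ring matrix_mul_assoc)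
    also have "\<dots> = ?E ** (Q k g ** ?W c + ?W c ** Q k g) ** Q i g" by (simp only: kr)
    also have "\<dots> = (?E ** Q k g) ** ?W c ** Q i g + ?E ** ?W c ** (Q k g ** Q i g)"
      by (simp add: matrix_ring matrix_mul_assoc)
    also have "\<dots> = 0" using o[of j k] o[of k i] ijk by simp
    finally show "?E ** ?W c = 0" .
    have "?W c ** ?E = (Q i g ** ?W c + ?W c ** Q i g) ** ?E" by (simp only: kl)
    also have "\<dots> = Q i g ** ?W c ** ?E"
      using o[of i j] ijk by (simp add: matrix_ring flip: matrix_mul_assoc)
    also have "\<dots> = Q i g ** (Q k g ** ?W c + ?W c ** Q k g) ** ?E" by (simp only: kr)
    also have "\<dots> = (Q i g ** Q k g) ** ?W c ** ?E + Q i g ** ?W c ** (Q k g ** ?E)"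
      by (simp add: matrix_ring matrix_mul_assoc)
    also have "\<dots> = 0" using o[of i k] o[of k j] ijk by simp
    finally show "?W c ** ?E = 0" .
  qed
  have rel: "- (?U a ** ?V b + ?V b ** ?U a) - (?U a ** ?W (a * b) + ?W (a * b) ** ?U a)
      + (?V b ** ?W (a * b) + ?W (a * b) ** ?V b) = ?W (a * b)" for a b
  proof -
    let ?M = "?E - ?U a + ?W (a * b) + ?V b"
    have "invertible (g ** transvection i j a ** transvection j k b)"
      using g ijk by (intro invertible_mult invertible_transvection)
    then have "?M ** ?M = ?M" using idem Q_mid[OF g ijk] by metis
    moreover have "?M ** ?M = ?E ** ?E - (?E ** ?U a + ?U a ** ?E) + (?E ** ?V b + ?V b ** ?E)
      + (?E ** ?W (a * b) + ?W (a * b) ** ?E)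
      + ?U a ** ?U a + ?V b ** ?V b + ?W (a * b) ** ?W (a * b)
      + (- (?U a ** ?V b + ?V b ** ?U a) - (?U a ** ?W (a * b) + ?W (a * b) ** ?U a)
      + (?V b ** ?W (a * b) + ?W (a * b) ** ?V b))"
      by (simp add: matrix_ring algebra_simps)
    ultimately have "?E - ?U a + ?V b + (- (?U a ** ?V b + ?V b ** ?U a) - (?U a ** ?W (a * b) + ?W (a * b) ** ?U a)
      + (?V b ** ?W (a * b) + ?W (a * b) ** ?V b)) = ?M"
      using K_square[OF n g ijk(1)] K_square[OF n g ijk(2)] K_square[OF n g ijk(3)]
        K_right[OF n g ijk(1)] K_left[OF n g ijk(2)] idem[OF g] EW by simp
    then show ?thesis by (simp add: algebra_simps)
  qed
  define UV where "UV = ?U a ** ?V b + ?V b ** ?U a"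
  define UW where "UW = ?U a ** ?W (a * b) + ?W (a * b) ** ?U a"
  define VW where "VW = ?V b ** ?W (a * b) + ?W (a * b) ** ?V b"
  define W where "W = ?W (a * b)"
  have dbl: "?U (2 * a) = 2 *\<^sub>R ?U a" "?V (2 * b) = 2 *\<^sub>R ?V b"
    "?W (2 * a * b) = 2 *\<^sub>R ?W (a * b)" "?W (a * (2 * b)) = 2 *\<^sub>R ?W (a * b)"
    using K_double[OF n g] ijk by (simp_all add: mult.assoc mult.left_commute[of a])
  note sc = scaleR_matrix_mult
  have r1: "- UV + VW + - UW = W"
    using rel[of a b] by (simp add: UV_def UW_def VW_def W_def algebra_simps)
  have "2 *\<^sub>R (- UV + VW) + 4 *\<^sub>R (- UW) = 2 *\<^sub>R W"
    using rel[of "2 * a" b, unfolded dbl sc]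
    by (simp add: UV_def UW_def VW_def W_def scaleR_add_right algebra_simps)
  with r1 have UW: "- UW = 0" by (rule pencil_cancel)
  have "2 *\<^sub>R (- UV + - UW) + 4 *\<^sub>R VW = 2 *\<^sub>R W"
    using rel[of a "2 * b", unfolded dbl sc]
    by (simp add: UV_def UW_def VW_def W_def scaleR_add_right algebra_simps)
  moreover have "- UV + - UW + VW = W" using r1 by (simp add: algebra_simps)
  ultimately have "VW = 0" by (intro pencil_cancel[of "- UV + - UW" VW W])
  with r1 UW have "W = - UV" by simp
  then show ?thesis by (simp add: UV_def W_def)
qed

end

text \<open>Rigidity: a system is determined by its values at the identity and at single
  transvections. Projections and increments are carried through the induction together, since the
  values at the next product need the increments at the present one.\<close>

lemma proj_system_eq:
  fixes Q R :: "'n \<Rightarrow> complex^'n^'n \<Rightarrow> complex^'n^'n"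
  assumes n: "3 \<le> CARD('n)" and Q: "proj_system Q" and R: "proj_system R"
    and base: "\<And>k. Q k (mat 1) = R k (mat 1)"
    and K: "\<And>i j t. i \<noteq> j \<Longrightarrow> Q i (transvection i j t) = R i (transvection i j t)"
    and h: "transvection_product h"
  shows "Q k h = R k h"
proof -
  interpret Q: proj_system Q by fact
  interpret R: proj_system R by fact
  have "(\<forall>k. Q k h = R k h) \<and> (\<forall>i j t. i \<noteq> j \<longrightarrow> Q.K h i j t = R.K h i j t)"
    using h
  proof (induction rule: transvection_product.induct)
    case one
    then show ?case using base K by (simp add: Q.K_def R.K_def)
  next
    case (step g p q a)
    let ?g = "g ** transvection p q a"
    have g: "invertible g" using step by (simp add: transvection_product_invertible)
    have g': "invertible ?g" using g step by (intro invertible_mult invertible_transvection)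
    have Kg: "Q.K g i j t = R.K g i j t" if "i \<noteq> j" for i j t using step that by blast
    have Qg: "Q k g = R k g" for k using step by blast
    have qj: "Q.K ?g q j t = R.K ?g q j t" if "j \<noteq> p" "j \<noteq> q" for j t
      using Q.K_before[OF g, of p q j] R.K_before[OF g, of p q j] that step Kg by metis
    have ip: "Q.K ?g i p t = R.K ?g i p t" if "i \<noteq> p" "i \<noteq> q" for i t
      using Q.K_after[OF g, of i p q] R.K_after[OF g, of i p q] that step Kg by metis
    have "Q k ?g = R k ?g" for k
    proof -
      consider "k = p" | "k = q" "k \<noteq> p" | "k \<noteq> p" "k \<noteq> q" by blast
      then show ?thesis
      proof cases
        case 1 then show ?thesis by (simp add: Q.Q_step R.Q_step Qg Kg step)
      next
        case 2 then show ?thesis by (simp add: Q.Q_step' R.Q_step' Qg Kg step g)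
      next
        case 3 then show ?thesis by (simp add: Q.fixed R.fixed Qg step g)
      qed
    qed
    moreover have "Q.K ?g i j t = R.K ?g i j t" if ij: "i \<noteq> j" for i j t
    proof -
      consider "i = p" "j = q" | "i = p" "j \<noteq> q" | "i = q" "j = p" | "i = q" "j \<noteq> p"
        | "i \<noteq> p" "i \<noteq> q" "j = p" | "i \<noteq> p" "i \<noteq> q" "j = q"
        | "i \<noteq> p" "i \<noteq> q" "j \<noteq> p" "j \<noteq> q" by blast
      then show ?thesis
      proof cases
        case 1
        have "Q.K ?g p q t = Q.K g p q (a + t) - Q.K g p q a" "R.K ?g p q t = R.K g p q (a + t) - R.K g p q a"
          using step by (simp_all add: Q.K_def R.K_def transvection_add flip: matrix_mul_assoc)
        then show ?thesis using 1 step Kg by simp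
      next
        case 2 then show ?thesis
          using Q.K_row[OF g, of p q j] R.K_row[OF g, of p q j] ij step Kg by metis
      next
        case 3
        \<comment> \<open>The increment opposite to the transvection just applied is out of reach of
          the transport rules. The Jordan relation expresses it through increments that pass through
          a third index and are already settled.\<close>
        obtain r where r: "r \<noteq> p" "r \<noteq> q" using third_index[OF n] by metis
        have "Q.K ?g q p t = - (Q.K ?g q r t ** Q.K ?g r p 1 + Q.K ?g r p 1 ** Q.K ?g q r t)"
          using Q.K_jordan[OF n g', of q r p t 1] r step by simp
        moreover have "R.K ?g q p t = - (R.K ?g q r t ** R.K ?g r p 1 + R.K ?g r p 1 ** R.K ?g q r t)"
          using R.K_jordan[OF n g', of q r p t 1] r step by simp
        ultimately show ?thesis using 3 qj ip r by simp
      next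
        case 4 then show ?thesis using qj ij by metis
      next
        case 5 then show ?thesis using ip by metis
      next
        case 6 then show ?thesis
          using Q.K_col[OF g, of i p q] R.K_col[OF g, of i p q] step Kg by metis
      next
        case 7
        have "g ** transvection p q a ** transvection i j t = g ** transvection i j t ** transvection p q a"
          using transvection_commute[of q i p j] 7 by (simp flip: matrix_mul_assoc)
        moreover have "invertible (g ** transvection i j t)"
          using g ij by (intro invertible_mult invertible_transvection)
        ultimately have "Q i (?g ** transvection i j t) = Q i (g ** transvection i j t)"
          "R i (?g ** transvection i j t) = R i (g ** transvection i j t)"
          using 7 step Q.fixed R.fixed by metis+
        then have "Q.K ?g i j t = Q.K g i j t" "R.K ?g i j t = R.K g i j t"
          using 7 step g by (simp_all add: Q.K_def R.K_def Q.fixed R.fixed)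
        then show ?thesis using Kg ij by simp
      qed
    qed
    ultimately show ?case by blast
  qed
  then show ?thesis by blast
qed

text \<open>Continuity excludes the wild automorphisms: the map fixes the rationals, hence the reals
  by closure, and sends \<open>\<i>\<close> to a square root of -1.\<close>

lemma continuous_ring_hom_complex:
  fixes \<sigma> :: "complex \<Rightarrow> complex"
  assumes add: "\<And>s t. \<sigma> (s + t) = \<sigma> s + \<sigma> t" and mult: "\<And>s t. \<sigma> (s * t) = \<sigma> s * \<sigma> t"
    and one: "\<sigma> 1 = 1" and cont: "continuous_on UNIV \<sigma>"
  shows "\<sigma> = id \<or> \<sigma> = cnj"
proof -
  have zero: "\<sigma> 0 = 0" using add[of 0 0] by simp
  have minus: "\<sigma> (- s) = - \<sigma> s" for s
    using add[of s "- s"] zero by (simp add: eq_neg_iff_add_eq_0 add.commute)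
  have nat: "\<sigma> (of_nat m) = of_nat m" for m by (induction m) (simp_all add: zero add one)
  have int: "\<sigma> (of_int m) = of_int m" for m
    by (cases m rule: int_cases2) (simp_all add: nat minus)
  have rat: "\<sigma> (of_real r) = of_real r" if "r \<in> \<rat>" for r
  proof -
    obtain a b :: int where "b \<noteq> 0" "r = of_int a / of_int b"
      using \<open>r \<in> \<rat>\<close> unfolding Rats_eq_int_div_int by blast
    then have "of_real r * of_int b = (of_int a :: complex)" by simp
    then have "\<sigma> (of_real r) * of_int b = of_int a" by (metis int mult)
    then have "\<sigma> (of_real r) = of_int a / of_int b" using \<open>b \<noteq> 0\<close> by (simp add: field_simps)
    then show ?thesis by (simp add: \<open>r = _\<close>)
  qed
  have "closed {r. \<sigma> (of_real r) = of_real r}"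
    by (intro closed_Collect_eq continuous_on_compose2[OF cont] continuous_intros) auto
  then have "closure \<rat> \<subseteq> {r. \<sigma> (of_real r) = of_real r}"
    using rat by (intro closure_minimal) auto
  then have real: "\<sigma> (of_real r) = of_real r" for r by (auto simp: Rats_closure_real)
  have "\<sigma> \<i> * \<sigma> \<i> = -1" using mult[of \<i> \<i>] minus[of 1] one by simp
  then have "(\<sigma> \<i> - \<i>) * (\<sigma> \<i> + \<i>) = 0" by (simp add: algebra_simps)
  then have i: "\<sigma> \<i> = \<i> \<or> \<sigma> \<i> = - \<i>" by (auto simp: eq_neg_iff_add_eq_0)
  have dec: "\<sigma> z = of_real (Re z) + \<sigma> \<i> * of_real (Im z)" for z
    using complex_eq[of z] add mult real by metis
  have "\<sigma> z = id z" if "\<sigma> \<i> = \<i>" for z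
    by (subst dec) (simp add: that complex_eq_iff)
  moreover have "\<sigma> z = cnj z" if "\<sigma> \<i> = - \<i>" for z
    by (subst dec) (simp add: that complex_eq_iff)
  ultimately show ?thesis using i by blast
qed

text \<open>Here \<open>p i j t\<close> plays the role of the matrix entry of \<open>1 + t e\<^sub>i\<^sub>j\<close>.\<close>

lemma coordinatize:
  fixes p :: "'n::finite \<Rightarrow> 'n \<Rightarrow> complex \<Rightarrow> complex"
  assumes n: "3 \<le> CARD('n)"
    and add: "\<And>i j s t. i \<noteq> j \<Longrightarrow> p i j (s + t) = p i j s + p i j t"
    and cont: "\<And>i j. i \<noteq> j \<Longrightarrow> continuous_on UNIV (p i j)"
    and mult: "\<And>i j k a b. i \<noteq> j \<Longrightarrow> j \<noteq> k \<Longrightarrow> i \<noteq> k \<Longrightarrow> p i k (a * b) = p i j a * p j k b"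
    and nz: "i0 \<noteq> j0" "p i0 j0 t0 \<noteq> 0"
  obtains c \<sigma> where "\<And>i. c i \<noteq> 0" "\<sigma> = id \<or> \<sigma> = cnj" "\<And>i j t. i \<noteq> j \<Longrightarrow> p i j t = c i / c j * \<sigma> t"
proof -
  have third: "\<exists>k. k \<noteq> i \<and> k \<noteq> j" for i j :: 'n using third_index[OF n] by metis
  \<comment> \<open>As \<open>t = 1 * t = t * 1\<close>, one nonvanishing value forces nonvanishing
    values at 1 for the two pairs through any third index.\<close>
  have st: "p i k 1 \<noteq> 0 \<and> p k j 1 \<noteq> 0" if "p i j t \<noteq> 0" "i \<noteq> j" "k \<noteq> i" "k \<noteq> j" for i j k t
    using mult[of i k j 1 t] mult[of i k j t 1] that by auto
  have nz1: "p i0 j0 1 \<noteq> 0"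
  proof -
    obtain k where "k \<noteq> i0" "k \<noteq> j0" using third by blast
    with st[OF nz(2,1)] mult[of i0 j0 k 1 1] nz(1) show ?thesis by fastforce
  qed
  have row: "p i b 1 \<noteq> 0" if "p i j 1 \<noteq> 0" "i \<noteq> j" "b \<noteq> i" for i j b
    using st[OF that(1,2)] that by metis
  have col: "p a j 1 \<noteq> 0" if "p i j 1 \<noteq> 0" "i \<noteq> j" "a \<noteq> j" for i j a
    using st[OF that(1,2)] that by metis
  have all: "p a b 1 \<noteq> 0" if "a \<noteq> b" for a b
  proof (cases "b = i0")
    case False
    then show ?thesis using row[OF nz1 nz(1), of b] col that by metis
  next
    case True
    obtain c where c: "c \<noteq> a" "c \<noteq> i0" using third by blast
    have "p a c 1 \<noteq> 0" using row[OF nz1 nz(1), of c] col c by metis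
    then show ?thesis using row c that by metis
  qed
  \<comment> \<open>Normalized to take the value 1 at 1. The factor that depends on the pair
    cancels, and \<open>mult\<close> shows independence first of the column, then of the
    row.\<close>
  define s where "s i j t = p i j t / p i j 1" for i j t
  have s_row: "s i k t = s i j t" if "i \<noteq> j" "i \<noteq> k" for i j k t
  proof (cases "j = k")
    case False
    then show ?thesis
      using mult[of i j k t 1] mult[of i j k 1 1] that all[of j k] by (simp add: s_def)
  qed simp
  have s_col: "s i k t = s j k t" if "i \<noteq> k" "j \<noteq> k" for i j k t
  proof (cases "i = j")
    case False
    then show ?thesis
      using mult[of i j k 1 t] mult[of i j k 1 1] that all[of i j] by (simp add: s_def)
  qed simp
  define \<sigma> where "\<sigma> = s i0 j0"
  have s_eq: "s i j t = \<sigma> t" if "i \<noteq> j" for i j t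
  proof -
    have *: "s i j t = \<sigma> t" if "i \<noteq> j" "j \<noteq> i0" for i j
      using s_row[of i0 j j0 t] s_col[of i j i0 t] that nz(1) by (simp add: \<sigma>_def)
    show ?thesis
    proof (cases "j = i0")
      case True
      obtain k where "k \<noteq> i" "k \<noteq> i0" using third by blast
      then show ?thesis using *[of i k] s_row[of i k j t] that by metis
    qed (use * that in auto)
  qed
  have p_eq: "p i j t = p i j 1 * \<sigma> t" if "i \<noteq> j" for i j t
    using s_eq[OF that, of t] all[OF that] by (simp add: s_def field_simps)
  \<comment> \<open>The scalars \<open>c\<close> are determined up to a common factor; setting the
    one at \<open>i0\<close> to 1 forces the others.\<close>
  define c where "c i = (if i = i0 then 1 else p i i0 1)" for i
  have c0: "c i \<noteq> 0" for i using all by (simp add: c_def)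
  have p1: "p i j 1 = c i / c j" if "i \<noteq> j" for i j
  proof -
    consider "j = i0" | "i = i0" "j \<noteq> i0" | "i \<noteq> i0" "j \<noteq> i0" by blast
    then show ?thesis
    proof cases
      case 2
      obtain k where k: "k \<noteq> j" "k \<noteq> i0" using third by blast
      \<comment> \<open>\<open>mult\<close> asks for three distinct indices and so says nothing
        directly about \<open>p i0 j 1 * p j i0 1\<close>. The product is made to act on
        \<open>p i0 k 1\<close> and that factor is cancelled.\<close>
      have "p i0 k 1 = p i0 j 1 * (p j i0 1 * p i0 k 1)"
        using mult[of i0 j k 1 1] mult[of j i0 k 1 1] k 2 by simp
      then have "p i0 j 1 * p j i0 1 = 1" using all[of i0 k] k by simp
      then show ?thesis using 2 all[of j i0] by (simp add: c_def field_simps)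
    next
      case 3
      then show ?thesis using mult[of i j i0 1 1] that all[of j i0] by (simp add: c_def)
    qed (use that in \<open>simp add: c_def\<close>)
  qed
  have "\<sigma> = id \<or> \<sigma> = cnj"
  proof (rule continuous_ring_hom_complex)
    show "\<sigma> (s + t) = \<sigma> s + \<sigma> t" for s t
      using add[OF nz(1)] by (simp add: \<sigma>_def s_def add_divide_distrib)
    show "\<sigma> 1 = 1" using nz1 by (simp add: \<sigma>_def s_def)
    show "continuous_on UNIV \<sigma>"
      unfolding \<sigma>_def s_def by (intro continuous_intros cont nz(1)) (use nz1 in auto)
    show "\<sigma> (a * b) = \<sigma> a * \<sigma> b" for a b
    proof -
      obtain k where k: "k \<noteq> i0" "k \<noteq> j0" using third by blast
      have "p i0 j0 (a * b) = p i0 k a * p k j0 b" using mult[of i0 k j0 a b] k nz(1) by simp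
      then have "p i0 j0 1 * \<sigma> (a * b) = (p i0 k 1 * \<sigma> a) * (p k j0 1 * \<sigma> b)"
        unfolding p_eq[OF nz(1), of "a * b"] p_eq[OF k(1)[symmetric], of a] p_eq[OF k(2), of b] .
      also have "\<dots> = (p i0 k 1 * p k j0 1) * (\<sigma> a * \<sigma> b)" by (simp only: ac_simps)
      also have "p i0 k 1 * p k j0 1 = p i0 j0 1" using mult[of i0 k j0 1 1] k nz(1) by simp
      finally have "p i0 j0 1 * \<sigma> (a * b) = p i0 j0 1 * (\<sigma> a * \<sigma> b)" .
      then show ?thesis using nz1 by simp
    qed
  qed
  moreover have "p i j t = c i / c j * \<sigma> t" if "i \<noteq> j" for i j t
    by (subst p_eq[OF that]) (simp only: p1[OF that])
  ultimately show ?thesis using that[of c \<sigma>] c0 by blast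
qed

section \<open>Continuity of matrix operations\<close>

lemma continuous_on_matrix_mult [continuous_intros]:
  fixes A B :: "'a::topological_space \<Rightarrow> complex^'n^'n"
  shows "continuous_on S A \<Longrightarrow> continuous_on S B \<Longrightarrow> continuous_on S (\<lambda>x. A x ** B x)"
  unfolding matrix_matrix_mult_def by (intro continuous_intros)

lemma continuous_on_conj_by [continuous_intros]:
  "continuous_on S A \<Longrightarrow> continuous_on S (\<lambda>x. conj_by T (A x))"
  unfolding conj_by_def by (intro continuous_intros)

lemma continuous_on_if_const:
  "(P \<Longrightarrow> continuous_on S f) \<Longrightarrow> (\<not> P \<Longrightarrow> continuous_on S g) \<Longrightarrow> continuous_on S (\<lambda>x. if P then f x else g x)"
  by (cases P) auto

lemma continuous_on_transvection [continuous_intros]: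
  "continuous_on S f \<Longrightarrow> continuous_on S (\<lambda>x. transvection i j (f x))"
  unfolding transvection_def
  by (intro continuous_intros continuous_on_if_const)

lemma continuous_on_diag_mat [continuous_intros]:
  assumes "\<And>i. continuous_on S (\<lambda>x. c x i)"
  shows "continuous_on S (\<lambda>x. diag_mat (c x))"
  unfolding diag_mat_def using assms
  by (intro continuous_intros continuous_on_if_const)

lemma continuous_on_map_matrix [continuous_intros]:
  assumes "continuous_on UNIV \<sigma>" "continuous_on S A"
  shows "continuous_on S (\<lambda>x. map_matrix \<sigma> (A x :: complex^'n^'n) :: complex^'n^'n)"
proof -
  have "continuous_on S (\<lambda>x. \<chi> i j. \<sigma> (A x $ i $ j))"
    by (intro continuous_intros continuous_on_compose2[OF assms(1)] assms(2)) auto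
  then show ?thesis by (simp add: map_matrix_def)
qed

lemma continuous_on_transpose [continuous_intros]:
  fixes A :: "'a::topological_space \<Rightarrow> complex^'n^'n"
  shows "continuous_on S A \<Longrightarrow> continuous_on S (\<lambda>x. Finite_Cartesian_Product.transpose (A x))"
  unfolding Finite_Cartesian_Product.transpose_def by (intro continuous_intros)

section \<open>The model systems\<close>

lemma coord_proj_nth: "coord_proj k $ i $ j = (if i = k \<and> j = k then 1 else 0)"
  by (simp add: coord_proj_def diag_mat_nth)

lemma coord_proj_mult: "coord_proj k ** coord_proj l = (if k = l then coord_proj k else 0)"
  by (auto simp: coord_proj_def diag_mat_mult vec_eq_iff diag_mat_nth)

lemma sum_coord_proj: "(\<Sum>k\<in>UNIV. coord_proj k) = mat 1"
  by (auto simp: vec_eq_iff mat_def coord_proj_nth intro!: sum.neutral)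

lemma diag_mat_eq_sum: "diag_mat x = (\<Sum>k\<in>UNIV. mat (x k) ** coord_proj k)"
proof -
  have "diag_mat x $ i $ j = (\<Sum>k\<in>UNIV. (mat (x k) ** coord_proj k) $ i $ j)" for i j
  proof -
    have "(\<Sum>k\<in>UNIV. (mat (x k) ** coord_proj k) $ i $ j) = (\<Sum>k\<in>UNIV. if k = i then diag_mat x $ i $ j else 0)"
      by (rule sum.cong) (auto simp: mat_mult_nth coord_proj_nth diag_mat_nth)
    then show ?thesis by simp
  qed
  then show ?thesis by (simp add: vec_eq_iff)
qed

lemma coord_proj_commute_transvection:
  "i \<noteq> k \<Longrightarrow> j \<noteq> k \<Longrightarrow> transvection i j t ** coord_proj k = coord_proj k ** transvection i j t"
  by (auto simp: vec_eq_iff mult_transvection_nth transvection_mult_nth coord_proj_nth)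

lemma conj_by_transvection_coord_proj_nth:
  assumes "i \<noteq> j"
  shows "conj_by (transvection i j t) (coord_proj i) $ a $ b =
    (if a = i \<and> b = i then 1 else if a = i \<and> b = j then - t else 0)"
  using assms unfolding conj_by_def matrix_inv_transvection[OF assms]
  by (auto simp: mult_transvection_nth transvection_mult_nth coord_proj_nth)

lemma proj_system_const: "proj_system (\<lambda>k g. coord_proj k)"
  by unfold_locales (auto simp: sum_coord_proj coord_proj_mult)

text \<open>An additive unital map may preserve or reverse products, because the relations between
  orthogonal idempotents are symmetric. Invariance holds as \<open>coord_proj k\<close> commutes
  with a transvection whose two indices differ from \<open>k\<close>.\<close>

lemma proj_system_hom:
  fixes \<Lambda> :: "complex^'n^'n \<Rightarrow> complex^'n^'n"
  assumes add: "\<And>A B. \<Lambda> (A + B) = \<Lambda> A + \<Lambda> B" and one: "\<Lambda> (mat 1) = mat 1"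
    and mult: "(\<forall>A B. \<Lambda> (A ** B) = \<Lambda> A ** \<Lambda> B) \<or> (\<forall>A B. \<Lambda> (A ** B) = \<Lambda> B ** \<Lambda> A)"
    and cont: "continuous_on UNIV \<Lambda>"
  shows "proj_system (\<lambda>k g. \<Lambda> (conj_by g (coord_proj k)))"
proof
  have zero: "\<Lambda> 0 = 0" using add[of 0 0] by simp
  have sum: "\<Lambda> (\<Sum>k\<in>S. A k) = (\<Sum>k\<in>S. \<Lambda> (A k))" if "finite S" for S :: "'n set" and A
    using that by (induction S) (auto simp: zero add)
  fix g :: "complex^'n^'n" assume g: "invertible g"
  show "(\<Sum>k\<in>UNIV. \<Lambda> (conj_by g (coord_proj k))) = mat 1"
    using g by (simp add: sum_coord_proj conj_by_mat one flip: sum conj_by_sum)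
  have prod: "\<Lambda> (conj_by g (coord_proj k)) ** \<Lambda> (conj_by g (coord_proj l)) =
     (if k = l then \<Lambda> (conj_by g (coord_proj k)) else 0)" for k l
  proof -
    have "conj_by g (coord_proj k) ** conj_by g (coord_proj l) =
       (if k = l then conj_by g (coord_proj k) else 0)" for k l
      by (simp add: conj_by_mult[OF g] coord_proj_mult) (simp add: conj_by_def)
    then show ?thesis using mult zero by metis
  qed
  fix k
  show "\<Lambda> (conj_by g (coord_proj k)) ** \<Lambda> (conj_by g (coord_proj k)) = \<Lambda> (conj_by g (coord_proj k))"
    by (simp add: prod)
  show "\<Lambda> (conj_by g (coord_proj k)) ** \<Lambda> (conj_by g (coord_proj l)) = 0" if "k \<noteq> l" for l
    by (simp add: prod that)
  fix i j :: 'n assume ij: "i \<noteq> j"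
  have eq: "conj_by (g ** transvection i j t) A = conj_by g (conj_by (transvection i j t) A)" for t A
    using g ij by (simp add: conj_by_conj_by invertible_transvection)
  show "\<Lambda> (conj_by (g ** transvection i j t) (coord_proj k)) = \<Lambda> (conj_by g (coord_proj k))"
    if "k \<noteq> i" "k \<noteq> j" for t
    using that ij by (simp add: eq conj_by_commuting invertible_transvection coord_proj_commute_transvection)
  have "conj_by (transvection i j t) A = transvection i j t ** A ** transvection i j (- t)" for t A
    using ij by (simp add: conj_by_def matrix_inv_transvection)
  then show "continuous_on UNIV (\<lambda>t. \<Lambda> (conj_by (g ** transvection i j t) (coord_proj k)))"
    unfolding eq by (auto intro!: continuous_intros continuous_on_compose2[OF cont])
qed

lemma map_matrix_mult:
  fixes A B :: "complex^'n^'n"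
  assumes "\<sigma> = id \<or> \<sigma> = cnj"
  shows "map_matrix \<sigma> (A ** B) = map_matrix \<sigma> A ** map_matrix \<sigma> B"
    and "map_matrix \<sigma> (A + B) = map_matrix \<sigma> A + map_matrix \<sigma> B"
    and "map_matrix \<sigma> (mat 1) = (mat 1 :: complex^'n^'n)"
    and "continuous_on UNIV \<sigma>"
  using assms by (auto simp: vec_eq_iff matrix_mult_nth mat_def intro: continuous_intros)

lemma
  fixes \<sigma> :: "complex \<Rightarrow> complex" and D :: "complex^'n^'n"
  assumes \<sigma>: "\<sigma> = id \<or> \<sigma> = cnj" and D: "invertible D"
  shows proj_system_conj: "proj_system (\<lambda>k g. conj_by D (map_matrix \<sigma> (conj_by g (coord_proj k))))"
    and proj_system_transpose_conj:
    "proj_system (\<lambda>k g. conj_by D (Finite_Cartesian_Product.transpose (map_matrix \<sigma> (conj_by g (coord_proj k)))))"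
proof -
  note m = map_matrix_mult[OF \<sigma>]
  show "proj_system (\<lambda>k g. conj_by D (map_matrix \<sigma> (conj_by g (coord_proj k))))"
    by (rule proj_system_hom)
      (auto simp: m(1-3) conj_by_add conj_by_mat conj_by_mult D intro!: continuous_intros m(4))
  show "proj_system (\<lambda>k g. conj_by D (Finite_Cartesian_Product.transpose (map_matrix \<sigma> (conj_by g (coord_proj k)))))"
  proof (rule proj_system_hom)
    show "continuous_on UNIV (\<lambda>A. conj_by D (Finite_Cartesian_Product.transpose (map_matrix \<sigma> A)))"
      by (intro continuous_intros m(4))
    have "Finite_Cartesian_Product.transpose (A + B) =
      Finite_Cartesian_Product.transpose A + Finite_Cartesian_Product.transpose B" for A B :: "complex^'n^'n"
      by (simp add: vec_eq_iff Finite_Cartesian_Product.transpose_def)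
    then show "conj_by D (Finite_Cartesian_Product.transpose (map_matrix \<sigma> (A + B))) =
       conj_by D (Finite_Cartesian_Product.transpose (map_matrix \<sigma> A)) +
       conj_by D (Finite_Cartesian_Product.transpose (map_matrix \<sigma> B))" for A B
      by (simp add: m conj_by_add)
  qed (auto simp: m(1-3) transpose_mat conj_by_mat conj_by_mult D matrix_transpose_mul)
qed

text \<open>At the standard frame the Jordan relation becomes multiplicativity of two families of
  matrix entries \<open>p\<close> and \<open>q\<close>, and the vanishing squares give
  \<open>p i j t * q i j t = 0\<close>. Once one family is coordinatized it is nonzero for all
  nonzero \<open>t\<close>, so the other vanishes. \<open>proj_system_eq\<close> carries the
  agreement with a model from transvections to their products.\<close>

theorem proj_system_classification:
  fixes Q :: "'n \<Rightarrow> complex^'n^'n \<Rightarrow> complex^'n^'n"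
  assumes n: "3 \<le> CARD('n)" and "proj_system Q" and base: "\<And>k. Q k (mat 1) = coord_proj k"
  obtains "\<And>h k. transvection_product h \<Longrightarrow> Q k h = coord_proj k"
  | D \<sigma> where "invertible D" "\<sigma> = id \<or> \<sigma> = cnj"
      "\<And>h k. transvection_product h \<Longrightarrow> Q k h = conj_by D (map_matrix \<sigma> (conj_by h (coord_proj k)))"
  | D \<sigma> where "invertible D" "\<sigma> = id \<or> \<sigma> = cnj"
      "\<And>h k. transvection_product h \<Longrightarrow>
        Q k h = conj_by D (Finite_Cartesian_Product.transpose (map_matrix \<sigma> (conj_by h (coord_proj k))))"
proof -
  interpret proj_system Q by fact
  let ?K = "K (mat 1)"
  have inv1: "invertible (mat 1 :: complex^'n^'n)" by simp
  have Qtv: "Q i (transvection i j t) = coord_proj i + ?K i j t" for i j t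
    using base by (simp add: K_def)
  have Eleft: "(coord_proj i ** L) $ a $ b = (if a = i then L $ a $ b else 0)"
    and Eright: "(L ** coord_proj i) $ a $ b = (if b = i then L $ a $ b else 0)" for i a b and L :: "complex^'n^'n"
    by (simp_all add: coord_proj_def diag_mult_nth mult_diag_nth)
  \<comment> \<open>Where an entry \<open>(a, b)\<close> is nonzero, \<open>K_left\<close> says that
    exactly one of \<open>a\<close>, \<open>b\<close> is \<open>i\<close>, and
    \<open>K_right\<close> that exactly one of them is \<open>j\<close>.\<close>
  have supp: "?K i j t $ a $ b = 0" if ij: "i \<noteq> j" and ab: "\<not> (a = i \<and> b = j)" "\<not> (a = j \<and> b = i)" for i j t a b
  proof -
    have "(if a = i then ?K i j t $ a $ b else 0) + (if b = i then ?K i j t $ a $ b else 0) = ?K i j t $ a $ b"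
      using arg_cong[OF K_left[OF n inv1 ij, of t], of "\<lambda>M. M $ a $ b"] by (simp add: base Eleft Eright)
    moreover have "(if a = j then ?K i j t $ a $ b else 0) + (if b = j then ?K i j t $ a $ b else 0) = ?K i j t $ a $ b"
      using arg_cong[OF K_right[OF n inv1 ij, of t], of "\<lambda>M. M $ a $ b"] by (simp add: base Eleft Eright)
    ultimately show ?thesis using ij ab by (auto split: if_splits)
  qed
  have single: "(\<Sum>m\<in>UNIV. f m) = f m0" if "\<And>m. m \<noteq> m0 \<Longrightarrow> f m = 0" for f :: "'n \<Rightarrow> complex" and m0
    using that by (subst sum.mono_neutral_right[of UNIV "{m0}"]) auto
  \<comment> \<open>The minus sign absorbs the one in the Jordan relation, so that \<open>p\<close>
    and \<open>q\<close> are multiplicative.\<close>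
  define p where "p i j t = - ?K i j t $ i $ j" for i j t
  define q where "q i j t = - ?K i j t $ j $ i" for i j t
  have jord: "?K i k (a * b) = - (?K i j a ** ?K j k b + ?K j k b ** ?K i j a)"
    if "i \<noteq> j" "j \<noteq> k" "i \<noteq> k" for i j k a b
    using K_jordan[OF n inv1 that] .
  have p_mult: "p i k (a * b) = p i j a * p j k b" if ijk: "i \<noteq> j" "j \<noteq> k" "i \<noteq> k" for i j k a b
  proof -
    have "(?K i j a ** ?K j k b) $ i $ k = ?K i j a $ i $ j * ?K j k b $ j $ k"
      unfolding matrix_mult_nth by (rule single) (use ijk supp in auto)
    moreover have "(?K j k b ** ?K i j a) $ i $ k = 0"
      unfolding matrix_mult_nth by (rule sum.neutral) (use ijk supp in auto)
    ultimately show ?thesis by (simp add: p_def jord[OF ijk])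
  qed
  have q_mult: "q i k (a * b) = q i j a * q j k b" if ijk: "i \<noteq> j" "j \<noteq> k" "i \<noteq> k" for i j k a b
  proof -
    have "(?K j k b ** ?K i j a) $ k $ i = ?K j k b $ k $ j * ?K i j a $ j $ i"
      unfolding matrix_mult_nth by (rule single) (use ijk supp in auto)
    moreover have "(?K i j a ** ?K j k b) $ k $ i = 0"
      unfolding matrix_mult_nth by (rule sum.neutral) (use ijk supp in auto)
    ultimately show ?thesis by (simp add: q_def jord[OF ijk])
  qed
  have pq: "p i j t * q i j t = 0" if ij: "i \<noteq> j" for i j t
  proof -
    have "(?K i j t ** ?K i j t) $ i $ i = ?K i j t $ i $ j * ?K i j t $ j $ i"
      unfolding matrix_mult_nth by (rule single) (use ij supp in auto)
    then show ?thesis using K_square[OF n inv1 ij] by (simp add: p_def q_def)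
  qed
  have add: "p i j (s + t) = p i j s + p i j t" "q i j (s + t) = q i j s + q i j t" if "i \<noteq> j" for i j s t
    using K_additive[OF n inv1 that] by (simp_all add: p_def q_def)
  have contK: "continuous_on UNIV (?K i j)" if "i \<noteq> j" for i j
    using cont[OF inv1 that, of i] by (simp add: K_def[abs_def] continuous_intros)
  have contp: "continuous_on UNIV (p i j)" "continuous_on UNIV (q i j)" if "i \<noteq> j" for i j
    unfolding p_def q_def by (intro continuous_intros contK that)+
  have eqI: "Q k h = R k h" if R: "proj_system R" "transvection_product h" "\<And>k. R k (mat 1) = coord_proj k"
    and Rtv: "\<And>i j t a b. i \<noteq> j \<Longrightarrow> R i (transvection i j t) $ a $ b =
      (if a = i \<and> b = i then 1 else if a = i \<and> b = j then - p i j t else if a = j \<and> b = i then - q i j t else 0)" for R k h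
  proof (rule proj_system_eq[OF n \<open>proj_system Q\<close> R(1) _ _ R(2)])
    show "Q k (mat 1) = R k (mat 1)" for k by (simp add: base R(3))
    show "Q i (transvection i j t) = R i (transvection i j t)" if ij: "i \<noteq> j" for i j t
    proof -
      have "Q i (transvection i j t) $ a $ b = R i (transvection i j t) $ a $ b" for a b
        unfolding Rtv[OF ij] Qtv using ij supp[OF ij]
        by (auto simp: coord_proj_nth p_def q_def)
      then show ?thesis by (simp add: vec_eq_iff)
    qed
  qed
  have coord_map: "map_matrix \<sigma> (coord_proj k) = (coord_proj k :: complex^'n^'n)"
     if "\<sigma> = id \<or> \<sigma> = cnj" for \<sigma> :: "complex \<Rightarrow> complex" and k
    using that by (auto simp: vec_eq_iff coord_proj_nth)
  have conj_diag_nth: "conj_by (diag_mat c) M $ a $ b = c a * M $ a $ b / c b"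
    if "\<And>i. c i \<noteq> 0" for c and M :: "complex^'n^'n" and a b
  proof -
    have "matrix_inv (diag_mat c) = diag_mat (\<lambda>i. inverse (c i))"
      by (rule matrix_inv_unique_left) (simp add: diag_mat_mult that diag_mat_one)
    then show ?thesis by (simp add: conj_by_def mult_diag_nth diag_mult_nth divide_inverse)
  qed
  consider (zero) "\<And>i j t. i \<noteq> j \<Longrightarrow> p i j t = 0 \<and> q i j t = 0"
    | (p) i j t where "i \<noteq> j" "p i j t \<noteq> 0" | (q) i j t where "i \<noteq> j" "q i j t \<noteq> 0" by blast
  then show ?thesis
  proof cases
    case zero
    have "Q k h = coord_proj k" if "transvection_product h" for k h
      using that zero by (intro eqI[OF proj_system_const]) (auto simp: coord_proj_nth)
    then show ?thesis by (rule that(1))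
  next
    case p
    obtain c \<sigma> where c: "\<And>i. c i \<noteq> 0" and \<sigma>: "\<sigma> = id \<or> \<sigma> = cnj"
      and eq: "\<And>i j t. i \<noteq> j \<Longrightarrow> p i j t = c i / c j * \<sigma> t"
      by (rule coordinatize[of p i j t], rule n, erule add(1), erule contp(1), erule (2) p_mult,
          rule p(1), rule p(2), rule that)
    have q0: "q i j t = 0" if "i \<noteq> j" for i j t
    proof (cases "t = 0")
      case True then show ?thesis using add(2)[OF that, of 0 0] by simp
    next
      case False
      then have "p i j t \<noteq> 0" using eq[OF that] c \<sigma> by auto
      then show ?thesis using pq[OF that, of t] by simp
    qed
    have D: "invertible (diag_mat c)" using c by (rule invertible_diag)
    have "Q k h = conj_by (diag_mat c) (map_matrix \<sigma> (conj_by h (coord_proj k)))"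
      if "transvection_product h" for k h
    proof (rule eqI[OF proj_system_conj[OF \<sigma> D] that])
      show "conj_by (diag_mat c) (map_matrix \<sigma> (conj_by (mat 1) (coord_proj k))) = coord_proj k" for k
        using c by (auto simp: coord_map[OF \<sigma>] vec_eq_iff conj_diag_nth coord_proj_nth)
      show "conj_by (diag_mat c) (map_matrix \<sigma> (conj_by (transvection i j t) (coord_proj i))) $ a $ b =
        (if a = i \<and> b = i then 1 else if a = i \<and> b = j then - p i j t else if a = j \<and> b = i then - q i j t else 0)"
        if "i \<noteq> j" for i j t a b
        using that c \<sigma> by (auto simp: conj_diag_nth conj_by_transvection_coord_proj_nth eq q0)
    qed
    then show ?thesis using that(2)[OF D \<sigma>] by blast
  next
    case q
    obtain c \<sigma> where c: "\<And>i. c i \<noteq> 0" and \<sigma>: "\<sigma> = id \<or> \<sigma> = cnj"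
      and eq: "\<And>i j t. i \<noteq> j \<Longrightarrow> q i j t = c i / c j * \<sigma> t"
      by (rule coordinatize[of q i j t], rule n, erule add(2), erule contp(2), erule (2) q_mult,
          rule q(1), rule q(2), rule that)
    have p0: "p i j t = 0" if "i \<noteq> j" for i j t
    proof (cases "t = 0")
      case True then show ?thesis using add(1)[OF that, of 0 0] by simp
    next
      case False
      then have "q i j t \<noteq> 0" using eq[OF that] c \<sigma> by auto
      then show ?thesis using pq[OF that, of t] by simp
    qed
    \<comment> \<open>The family \<open>q\<close> sits at the transposed position
      \<open>(j, i)\<close>, where conjugation by a diagonal matrix scales by the reciprocal
      ratio.\<close>
    let ?D = "diag_mat (\<lambda>i. inverse (c i))"
    have c': "inverse (c i) \<noteq> 0" for i using c by simp
    have D: "invertible ?D" using c' by (rule invertible_diag)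
    have "Q k h = conj_by ?D (Finite_Cartesian_Product.transpose (map_matrix \<sigma> (conj_by h (coord_proj k))))"
      if "transvection_product h" for k h
    proof (rule eqI[OF proj_system_transpose_conj[OF \<sigma> D] that])
      show "conj_by ?D (Finite_Cartesian_Product.transpose (map_matrix \<sigma> (conj_by (mat 1) (coord_proj k)))) = coord_proj k" for k
        unfolding vec_eq_iff conj_diag_nth[OF c']
        using c by (auto simp: coord_map[OF \<sigma>] coord_proj_nth Finite_Cartesian_Product.transpose_def)
      show "conj_by ?D (Finite_Cartesian_Product.transpose (map_matrix \<sigma> (conj_by (transvection i j t) (coord_proj i)))) $ a $ b =
        (if a = i \<and> b = i then 1 else if a = i \<and> b = j then - p i j t else if a = j \<and> b = i then - q i j t else 0)"
        if "i \<noteq> j" for i j t a b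
        unfolding conj_diag_nth[OF c'] using that c \<sigma>
        by (auto simp: conj_by_transvection_coord_proj_nth eq p0
            Finite_Cartesian_Product.transpose_def divide_inverse)
    qed
    then show ?thesis using that(3)[OF D \<sigma>] by blast
  qed
qed

section \<open>Preservers on matrices with simple spectrum\<close>

lemma conj_by_eq_iff:
  assumes "invertible P" "invertible R"
  shows "conj_by P A = conj_by R B \<longleftrightarrow> (matrix_inv R ** P) ** A = B ** (matrix_inv R ** P)"
proof -
  let ?S = "matrix_inv R ** P"
  have S: "invertible ?S" using assms by (intro invertible_mult invertible_matrix_inv)
  have "conj_by P A = conj_by R B \<longleftrightarrow> conj_by (matrix_inv R) (conj_by P A) = B"
    by (metis assms(2) conj_by_inv conj_by_inv')
  also have "\<dots> \<longleftrightarrow> conj_by ?S A = B"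
    using assms by (simp add: conj_by_conj_by invertible_matrix_inv)
  also have "\<dots> \<longleftrightarrow> ?S ** A = B ** ?S"
    unfolding conj_by_def using S by (metis matrix_inv_left matrix_inv_right matrix_mul_assoc matrix_mul_rid)
  finally show ?thesis .
qed

text \<open>The change of frame intertwines the two diagonal matrices, so its nonzero entries join
  only equal eigenvalues. It therefore intertwines the images under \<open>f\<close> as
  well.\<close>

lemma functional_calculus_unique:
  assumes "invertible P" "invertible R" "conj_by P (diag_mat x) = conj_by R (diag_mat y)"
  shows "conj_by P (diag_mat (f \<circ> x)) = conj_by R (diag_mat (f \<circ> y))"
proof -
  let ?S = "matrix_inv R ** P"
  have "?S ** diag_mat x = diag_mat y ** ?S" using assms conj_by_eq_iff by blast
  then have "?S $ i $ j * x j = y i * ?S $ i $ j" for i j by (metis mult_diag_nth diag_mult_nth)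
  then have "?S $ i $ j = 0 \<or> x j = y i" for i j by (metis mult.commute mult_cancel_left)
  then have "?S $ i $ j * f (x j) = f (y i) * ?S $ i $ j" for i j by (metis mult.commute mult_zero_left)
  then have "?S ** diag_mat (f \<circ> x) = diag_mat (f \<circ> y) ** ?S"
    by (simp add: vec_eq_iff mult_diag_nth diag_mult_nth)
  then show ?thesis using assms conj_by_eq_iff by blast
qed

lemma conj_by_diag_right:
  assumes "invertible h" "\<And>i. d i \<noteq> 0"
  shows "conj_by (h ** diag_mat d) (diag_mat x) = conj_by h (diag_mat x)"
  by (simp add: assms conj_by_commuting diag_mat_mult invertible_diag mult.commute flip: conj_by_conj_by)

lemma tendsto_matrix_iff: "(f \<longlongrightarrow> (A :: complex^'n^'m)) F \<longleftrightarrow> (\<forall>i j. ((\<lambda>x. f x $ i $ j) \<longlongrightarrow> A $ i $ j) F)"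
  by (auto intro: tendsto_vec_nth vec_tendstoI)

lemma tendsto_matrix_mult [tendsto_intros]:
  fixes f g :: "'a \<Rightarrow> complex^'n^'n"
  shows "(f \<longlongrightarrow> A) F \<Longrightarrow> (g \<longlongrightarrow> B) F \<Longrightarrow> ((\<lambda>x. f x ** g x) \<longlongrightarrow> A ** B) F"
  by (simp add: tendsto_matrix_iff matrix_mult_nth tendsto_intros)

lemma tendsto_conj_by [tendsto_intros]: "(f \<longlongrightarrow> A) F \<Longrightarrow> ((\<lambda>x. conj_by T (f x)) \<longlongrightarrow> conj_by T A) F"
  unfolding conj_by_def by (intro tendsto_intros)

lemma tendsto_diag_mat:
  "(\<And>i. ((\<lambda>x. c x i) \<longlongrightarrow> d i) F) \<Longrightarrow> ((\<lambda>x. diag_mat (c x)) \<longlongrightarrow> diag_mat d) F"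
  by (auto simp: tendsto_matrix_iff diag_mat_nth)

lemma continuous_on_shifted_prod [continuous_intros]:
  "continuous_on S A \<Longrightarrow> continuous_on S (\<lambda>x. shifted_prod (A x) xs)"
  by (induction xs) (auto intro!: continuous_intros)

lemma sigma_minus_conj_diag:
  "invertible g \<Longrightarrow> range x \<subseteq> X \<Longrightarrow> conj_by g (diag_mat x) \<in> sigma_minus X"
  by (simp add: sigma_minus_def spectrum_conj_by spectrum_diag)

text \<open>Every \<open>\<phi> (B v)\<close> commutes with \<open>\<phi> (B v0)\<close>, whose
  spectrum is simple, so a frame diagonalizing the latter diagonalizes them all. What connectedness
  adds is that the eigenvalues stay in the same order.\<close>

lemma CS_preserver_diagonalization:
  fixes \<phi> :: "complex^'n^'n \<Rightarrow> complex^'n^'n" and V :: "(complex^'n) set"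
  assumes cont: "continuous_on (sigma_minus X) \<phi>" and CS: "CS_preserver (sigma_minus X) \<phi>"
    and V: "connected V" "\<And>v. v \<in> V \<Longrightarrow> inj (($) v) \<and> range (($) v) \<subseteq> X"
    and g: "invertible g"
  shows "\<exists>T. invertible T \<and> (\<forall>v\<in>V. \<phi> (conj_by g (diag_mat (($) v))) = conj_by T (diag_mat (($) v)))"
proof (cases "V = {}")
  case True
  then show ?thesis by (intro exI[of _ "mat 1"]) simp
next
  case False
  then obtain v0 where v0: "v0 \<in> V" by blast
  define B where "B v = conj_by g (diag_mat (($) v))" for v :: "complex^'n"
  have BX: "B v \<in> sigma_minus X" if "v \<in> V" for v
    unfolding B_def using g V(2)[OF that] by (intro sigma_minus_conj_diag) auto
  have spec: "spectrum (\<phi> (B v)) = range (($) v)" if "v \<in> V" for v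
    using CS BX[OF that] g by (simp add: CS_preserver_def B_def spectrum_conj_by spectrum_diag)
  obtain T where T: "invertible T" "\<phi> (B v0) = conj_by T (diag_mat (($) v0))"
    using simple_spectrum_diagonalizable[of "($) v0" "\<phi> (B v0)"] V(2)[OF v0] spec[OF v0] by auto
  define D where "D v = conj_by (matrix_inv T) (\<phi> (B v))" for v
  have Dd: "D v = diag_mat (\<lambda>i. D v $ i $ i)" if "v \<in> V" for v
  proof (rule commute_diag_imp_diag)
    have "B v ** B v0 = B v0 ** B v"
      using g by (simp add: B_def conj_by_mult diag_mat_mult mult.commute)
    then have "\<phi> (B v) ** \<phi> (B v0) = \<phi> (B v0) ** \<phi> (B v)"
      using CS BX that v0 by (auto simp: CS_preserver_def)
    moreover have "diag_mat (($) v0) = D v0" using T by (simp add: D_def conj_by_inv)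
    ultimately show "D v ** diag_mat (($) v0) = diag_mat (($) v0) ** D v"
      using T(1) by (simp add: D_def conj_by_mult invertible_matrix_inv)
    show "inj (($) v0)" using V(2)[OF v0] by blast
  qed
  have ex: "\<exists>j. D v $ i $ i = v $ j" if "v \<in> V" for v i
  proof -
    have "spectrum (D v) = range (($) v)"
      using T(1) spec[OF that] by (simp add: D_def spectrum_conj_by invertible_matrix_inv)
    moreover have "spectrum (D v) = range (\<lambda>i. D v $ i $ i)"
      using Dd[OF that] spectrum_diag by metis
    ultimately show ?thesis by (metis rangeE rangeI)
  qed
  have contD: "continuous_on V D"
    unfolding D_def
  proof (intro continuous_intros continuous_on_compose2[OF cont])
    show "continuous_on V B" unfolding B_def by (intro continuous_intros)
    show "B ` V \<subseteq> sigma_minus X" using BX by blast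
  qed
  have eq: "D v $ i $ i = v $ i" if "v \<in> V" for v i
  proof (rule ccontr)
    assume ne: "D v $ i $ i \<noteq> v $ i"
    \<comment> \<open>The coordinates of a point of \<open>V\<close> are distinct, so the set where
      the \<open>i\<close>-th diagonal entry is the \<open>i\<close>-th coordinate and the set where
      it is another one are disjoint closed sets covering \<open>V\<close>. The first contains
      \<open>v0\<close>, the second would contain \<open>v\<close>.\<close>
    define F where "F j = V \<inter> {w. D w $ i $ i = w $ j}" for j
    have cl: "closedin (top_of_set V) (F j)" for j
    proof -
      have "closedin (top_of_set V) (V \<inter> (\<lambda>w. D w $ i $ i - w $ j) -` {0})"
        by (intro continuous_closedin_preimage continuous_intros contD)
      then show ?thesis by (simp add: F_def vimage_def)
    qed
    have "closedin (top_of_set V) (\<Union>j\<in>-{i}. F j)" by (intro closedin_Union) (auto simp: cl)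
    moreover have "V \<subseteq> F i \<union> (\<Union>j\<in>-{i}. F j)"
    proof
      fix w assume "w \<in> V"
      moreover from this obtain j where "D w $ i $ i = w $ j" using ex by blast
      ultimately show "w \<in> F i \<union> (\<Union>j\<in>-{i}. F j)" by (cases "j = i") (auto simp: F_def)
    qed
    moreover have "F i \<inter> (\<Union>j\<in>-{i}. F j) = {}" using V(2) by (fastforce simp: F_def dest: injD)
    moreover have "v0 \<in> F i" using v0 T by (simp add: F_def D_def conj_by_inv diag_mat_nth)
    moreover have "v \<in> (\<Union>j\<in>-{i}. F j)"
    proof -
      obtain j where "D v $ i $ i = v $ j" using ex[OF \<open>v \<in> V\<close>] by blast
      then show ?thesis using ne \<open>v \<in> V\<close> by (cases "j = i") (auto simp: F_def)
    qed
    ultimately show False using V(1) cl[of i] unfolding connected_closedin by blast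
  qed
  have "\<phi> (B v) = conj_by T (diag_mat (($) v))" if "v \<in> V" for v
  proof -
    have "D v = diag_mat (($) v)" by (subst Dd[OF that]) (simp add: eq[OF that])
    then show ?thesis using T(1) by (metis D_def conj_by_inv')
  qed
  then show ?thesis using T(1) by (auto simp: B_def)
qed

text \<open>The projection is the functional calculus for the indicator of \<open>y k\<close>, which
  picks out the index \<open>k\<close> alone because this eigenvalue is simple.\<close>

lemma conj_by_coord_proj_eqI:
  assumes T: "invertible T" "invertible T'" and eq: "conj_by T (diag_mat y) = conj_by T' (diag_mat y)"
    and k: "\<And>a. a \<noteq> k \<Longrightarrow> y a \<noteq> y k"
  shows "conj_by T (coord_proj k) = conj_by T' (coord_proj k)"
proof -
  have "conj_by T (diag_mat ((\<lambda>z. if z = y k then 1 else 0) \<circ> y))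
      = conj_by T' (diag_mat ((\<lambda>z. if z = y k then 1 else 0) \<circ> y))"
    using functional_calculus_unique[OF T eq] .
  moreover have "(\<lambda>z. if z = y k then 1 else 0) \<circ> y = (\<lambda>i. if i = k then 1 else 0 :: complex)"
    using k by (auto simp: fun_eq_iff)
  ultimately show ?thesis by (simp add: coord_proj_def)
qed

lemma conj_by_diag_eq_sum: "conj_by T (diag_mat x) = (\<Sum>k\<in>UNIV. mat (x k) ** conj_by T (coord_proj k))"
  by (simp add: diag_mat_eq_sum[of x] conj_by_sum conj_by_mat_mult)

lemma transvection_commutator:
  "i \<noteq> j \<Longrightarrow> j \<noteq> l \<Longrightarrow> i \<noteq> l \<Longrightarrow> transvection i l t =
    transvection i j (- t) ** transvection j l (- 1) ** transvection i j t ** transvection j l 1"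
proof -
  assume "i \<noteq> j" "j \<noteq> l" "i \<noteq> l"
  then have "transvection i j (- t) ** transvection j l (- 1) ** (transvection i j t ** transvection j l 1)
    = transvection i j (- t) ** (transvection j l (- 1) ** transvection j l 1) ** transvection i j t ** transvection i l t"
    by (simp add: transvection_braid[of i j l t 1]) (simp only: matrix_mul_assoc)
  also have "\<dots> = transvection i l t"
    using \<open>i \<noteq> j\<close> \<open>j \<noteq> l\<close> by (simp add: transvection_add)
  finally show ?thesis by (simp only: matrix_mul_assoc)
qed

text \<open>The edges of the paper's \<open>\<Gamma>\<close>, for a component \<open>V\<close> whose tuples are written as vectors
  over the index type of the matrices.\<close>

definition coincidence_edge :: "complex set \<Rightarrow> (complex^'n) set \<Rightarrow> 'n \<Rightarrow> 'n \<Rightarrow> bool" where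
  "coincidence_edge X V i j \<longleftrightarrow> i \<noteq> j \<and>
     (\<exists>y\<in>closure V. range (($) y) \<subseteq> X \<and> y $ i = y $ j \<and> (\<forall>a b. a \<noteq> b \<and> y $ a = y $ b \<longrightarrow> {a, b} = {i, j}))"

definition coincidence_cycle :: "complex set \<Rightarrow> (complex^'n) set \<Rightarrow> bool" where
  "coincidence_cycle X V \<longleftrightarrow> (\<exists>vs. length vs = CARD('n) \<and> distinct vs \<and>
     (\<forall>i<CARD('n). coincidence_edge X V (vs ! i) (vs ! (Suc i mod CARD('n)))))"

lemma coincidence_edge_sym: "coincidence_edge X V i j \<Longrightarrow> coincidence_edge X V j i"
  unfolding coincidence_edge_def insert_commute[of j i] eq_commute[of j i] eq_commute[of "_ $ j" "_ $ i"]
  by blast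

lemma coincidence_edge_fixed:
  fixes \<phi> :: "complex^'n^'n \<Rightarrow> complex^'n^'n" and V :: "(complex^'n) set"
  assumes cont: "continuous_on (sigma_minus X) \<phi>"
    and V: "\<And>v. v \<in> V \<Longrightarrow> range (($) v) \<subseteq> X"
    and T: "\<And>g. invertible g \<Longrightarrow> invertible (T g)"
    and eq: "\<And>g v. invertible g \<Longrightarrow> v \<in> V \<Longrightarrow> \<phi> (conj_by g (diag_mat (($) v))) = conj_by (T g) (diag_mat (($) v))"
    and edge: "coincidence_edge X V i j" and k: "k \<noteq> i" "k \<noteq> j" and g: "invertible g"
  shows "conj_by (T (g ** transvection i j t)) (coord_proj k) = conj_by (T g) (coord_proj k)"
proof -
  obtain y where ij: "i \<noteq> j" and y: "y \<in> closure V" "range (($) y) \<subseteq> X" "y $ i = y $ j"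
    "\<And>a b. a \<noteq> b \<Longrightarrow> y $ a = y $ b \<Longrightarrow> {a, b} = {i, j}"
    using edge unfolding coincidence_edge_def by blast
  obtain w where w: "\<And>n. w n \<in> V" "w \<longlonglongrightarrow> y"
    using y(1) by (auto simp: closure_sequential)
  have lim: "\<phi> (conj_by g (diag_mat (($) y))) = conj_by (T g) (diag_mat (($) y))" if g: "invertible g" for g
  proof -
    have w': "(\<lambda>n. conj_by h (diag_mat (($) (w n)))) \<longlonglongrightarrow> conj_by h (diag_mat (($) y))" for h
      by (intro tendsto_intros tendsto_diag_mat tendsto_vec_nth w(2))
    have "(\<lambda>n. \<phi> (conj_by g (diag_mat (($) (w n))))) \<longlonglongrightarrow> \<phi> (conj_by g (diag_mat (($) y)))"
      using continuous_on_sequentially[THEN iffD1, OF cont, rule_format, of "conj_by g (diag_mat (($) y))"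
          "\<lambda>n. conj_by g (diag_mat (($) (w n)))"] w' sigma_minus_conj_diag[OF g] y(2) V w(1)
      by (auto simp: o_def)
    then have "(\<lambda>n. conj_by (T g) (diag_mat (($) (w n)))) \<longlonglongrightarrow> \<phi> (conj_by g (diag_mat (($) y)))"
      by (simp add: eq[OF g w(1)])
    then show ?thesis using w' LIMSEQ_unique by blast
  qed
  have g': "invertible (g ** transvection i j t)"
    using g ij by (intro invertible_mult invertible_transvection)
  \<comment> \<open>The coincidence \<open>y $ i = y $ j\<close> makes the two frames
    \<open>g\<close> and \<open>g ** transvection i j t\<close> describe the same matrix.\<close>
  have "transvection i j t ** diag_mat (($) y) = diag_mat (($) y) ** transvection i j t"
    using y(3) by (auto simp: vec_eq_iff mult_transvection_nth transvection_mult_nth diag_mat_nth)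
  then have "conj_by (g ** transvection i j t) (diag_mat (($) y)) = conj_by g (diag_mat (($) y))"
    using g ij by (simp add: conj_by_commuting invertible_transvection flip: conj_by_conj_by)
  then have "conj_by (T (g ** transvection i j t)) (diag_mat (($) y)) = conj_by (T g) (diag_mat (($) y))"
    using lim[OF g] lim[OF g'] by simp
  then show ?thesis
  proof (rule conj_by_coord_proj_eqI[OF T[OF g'] T[OF g]])
    fix a assume "a \<noteq> k"
    then show "y $ a \<noteq> y $ k" using y(4)[of a k] k by (auto simp: doubleton_eq_iff)
  qed
qed

lemma coincidence_cycle_fixed:
  fixes Q :: "'n \<Rightarrow> complex^'n^'n \<Rightarrow> complex^'n^'n" and V :: "(complex^'n) set"
  assumes cyc: "coincidence_cycle X V"
    and edge: "\<And>i j k g t. coincidence_edge X V i j \<Longrightarrow> k \<noteq> i \<Longrightarrow> k \<noteq> j \<Longrightarrow> invertible g \<Longrightarrow>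
      Q k (g ** transvection i j t) = Q k g"
    and ijk: "i \<noteq> j" "k \<noteq> i" "k \<noteq> j" and g: "invertible g"
  shows "Q k (g ** transvection i j t) = Q k g"
proof -
  define good where "good i j \<longleftrightarrow> i \<noteq> j \<and> (\<forall>g t. invertible g \<longrightarrow> Q k (g ** transvection i j t) = Q k g)" for i j
  have good_trans: "good i l" if "good i j" "good j l" "i \<noteq> l" for i j l
  proof -
    have "Q k (g ** transvection i l t) = Q k g" if g: "invertible g" for g t
    proof -
      have ij: "i \<noteq> j" "j \<noteq> l" using \<open>good i j\<close> \<open>good j l\<close> by (auto simp: good_def)
      note inv = invertible_mult[OF g invertible_transvection[OF ij(1)], of "- t"]
      note inv2 = invertible_mult[OF inv invertible_transvection[OF ij(2)], of "- 1"]
      note inv3 = invertible_mult[OF inv2 invertible_transvection[OF ij(1)], of t]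
      show ?thesis
        using that \<open>good i j\<close> \<open>good j l\<close> inv inv2 inv3
        unfolding transvection_commutator[OF ij \<open>i \<noteq> l\<close>] by (simp add: good_def matrix_mul_assoc)
    qed
    then show ?thesis using \<open>i \<noteq> l\<close> by (simp add: good_def)
  qed
  obtain vs where vs: "length vs = CARD('n)" "distinct vs"
    "\<And>i. i < CARD('n) \<Longrightarrow> coincidence_edge X V (vs ! i) (vs ! (Suc i mod CARD('n)))"
    using cyc unfolding coincidence_cycle_def by blast
  let ?n = "CARD('n)"
  have UN: "set vs = UNIV" using vs(1,2) by (metis card_subset_eq distinct_card finite subset_UNIV)
  then obtain m where m: "m < ?n" "vs ! m = k" using vs(1) by (metis UNIV_I in_set_conv_nth)
  \<comment> \<open>The cycle is rotated to start at \<open>k\<close>, so that positions 1, 2, ...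
    form the path avoiding \<open>k\<close>.\<close>
  define u where "u = rotate m vs"
  have u: "length u = ?n" "distinct u" "set u = UNIV" using vs UN by (simp_all add: u_def)
  have u_nth: "u ! a = vs ! ((m + a) mod ?n)" if "a < ?n" for a
    using that vs(1) by (simp add: u_def nth_rotate)
  have u0: "u ! 0 = k" using u_nth[of 0] m by simp
  have u_edge: "coincidence_edge X V (u ! a) (u ! Suc a)" if "Suc a < ?n" for a
    using vs(3)[of "(m + a) mod ?n"] that by (simp add: u_nth mod_Suc_eq)
  have good: "good (u ! a) (u ! Suc a) \<and> good (u ! Suc a) (u ! a)" if a: "0 < a" "Suc a < ?n" for a
  proof -
    have "k \<noteq> u ! a" "k \<noteq> u ! Suc a" "u ! a \<noteq> u ! Suc a"
      using a u(1,2) unfolding u0[symmetric] by (simp_all add: nth_eq_iff_index_eq)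
    then show ?thesis
      using u_edge[OF a(2)] coincidence_edge_sym edge unfolding good_def by metis
  qed
  have path: "good (u ! a) (u ! b) \<and> good (u ! b) (u ! a)" if "0 < a" "a < b" "b < ?n" for a b
    using that(2,3)
  proof (induction b)
    case (Suc b)
    show ?case
    proof (cases "a = b")
      case True
      then show ?thesis using good Suc.prems that(1) by simp
    next
      case False
      then have ab: "a < b" "b < ?n" using Suc.prems by auto
      moreover have "u ! a \<noteq> u ! Suc b" using Suc.prems u(1,2) by (simp add: nth_eq_iff_index_eq)
      ultimately show ?thesis using Suc.IH good[of b] good_trans Suc.prems(2) that(1)
        by (metis less_trans)
    qed
  qed simp
  obtain a b where "a < ?n" "b < ?n" "u ! a = i" "u ! b = j"
    using u by (metis UNIV_I in_set_conv_nth)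
  moreover from this have "0 < a" "0 < b" "a \<noteq> b" using ijk u0 by (auto intro: gr0I)
  ultimately have "good i j" using path by (metis linorder_neqE_nat)
  then show ?thesis using g by (simp add: good_def)
qed

theorem CS_preserver_simple_spectrum:
  fixes \<phi> :: "complex^'n^'n \<Rightarrow> complex^'n^'n" and V :: "(complex^'n) set"
  assumes n: "3 \<le> CARD('n)"
    and cont: "continuous_on (sigma_minus X) \<phi>" and CS: "CS_preserver (sigma_minus X) \<phi>"
    and V: "connected V" "V \<noteq> {}" "\<And>v. v \<in> V \<Longrightarrow> inj (($) v) \<and> range (($) v) \<subseteq> X"
    and cyc: "coincidence_cycle X V"
    and nonfree: "\<theta> \<noteq> id" "\<And>v. v \<in> V \<Longrightarrow> (\<chi> i. v $ \<theta> i) \<in> V"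
    and trans: "\<And>w :: 'n \<Rightarrow> complex. inj w \<Longrightarrow> range w \<subseteq> X \<Longrightarrow> \<exists>\<pi>. bij \<pi> \<and> (\<chi> i. w (\<pi> i)) \<in> V"
  obtains D \<sigma> where "invertible D" "\<sigma> = id \<or> \<sigma> = cnj"
      "\<And>g w. invertible g \<Longrightarrow> inj w \<Longrightarrow> range w \<subseteq> X \<Longrightarrow>
        \<phi> (conj_by g (diag_mat w)) = conj_by D (map_matrix \<sigma> (conj_by g (diag_mat (\<sigma> \<circ> w))))"
  | D \<sigma> where "invertible D" "\<sigma> = id \<or> \<sigma> = cnj"
      "\<And>g w. invertible g \<Longrightarrow> inj w \<Longrightarrow> range w \<subseteq> X \<Longrightarrow>
        \<phi> (conj_by g (diag_mat w)) =
          conj_by D (Finite_Cartesian_Product.transpose (map_matrix \<sigma> (conj_by g (diag_mat (\<sigma> \<circ> w)))))"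
proof -
  have "\<forall>g. \<exists>T. invertible g \<longrightarrow> invertible T \<and>
    (\<forall>v\<in>V. \<phi> (conj_by g (diag_mat (($) v))) = conj_by T (diag_mat (($) v)))"
    using CS_preserver_diagonalization[OF cont CS V(1,3)] by blast
  then obtain T where T: "\<And>g. invertible g \<Longrightarrow> invertible (T g)"
    and eq: "\<And>g v. invertible g \<Longrightarrow> v \<in> V \<Longrightarrow> \<phi> (conj_by g (diag_mat (($) v))) = conj_by (T g) (diag_mat (($) v))"
    by metis
  obtain v0 where v0: "v0 \<in> V" using V(2) by blast
  define T1 where "T1 = T (mat 1)"
  have T1: "invertible T1" by (simp add: T1_def T)
  \<comment> \<open>Conjugation by the inverse of \<open>T1\<close> normalizes the system to
    \<open>coord_proj\<close> at the identity frame, as the classification requires.\<close>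
  define Q where "Q k g = conj_by (matrix_inv T1) (conj_by (T g) (coord_proj k))" for k g
  have \<phi>Q: "\<phi> (conj_by g (diag_mat (($) v))) = conj_by T1 (\<Sum>k\<in>UNIV. mat (v $ k) ** Q k g)"
    if "invertible g" "v \<in> V" for g v
    using eq[OF that] T1 by (simp add: conj_by_diag_eq_sum conj_by_sum conj_by_mat_mult Q_def conj_by_inv')
  interpret proj_system Q
  proof
    fix g :: "complex^'n^'n" assume g: "invertible g"
    note Tg = T[OF g]
    have T1': "invertible (matrix_inv T1)" using T1 by (rule invertible_matrix_inv)
    show "(\<Sum>k\<in>UNIV. Q k g) = mat 1"
      by (simp add: Q_def sum_coord_proj conj_by_mat Tg T1' flip: conj_by_sum)
    show "Q k g ** Q k g = Q k g" for k
      by (simp add: Q_def conj_by_mult T1' Tg coord_proj_mult)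
    show "Q k g ** Q l g = 0" if "k \<noteq> l" for k l
      using that by (simp add: Q_def conj_by_mult T1' Tg coord_proj_mult) (simp add: conj_by_def)
    show "Q k (g ** transvection i j t) = Q k g" if "i \<noteq> j" "k \<noteq> i" "k \<noteq> j" for i j k t
    proof (rule coincidence_cycle_fixed[OF cyc _ that g])
      show "Q k (g ** transvection i j t) = Q k g"
        if "coincidence_edge X V i j" "k \<noteq> i" "k \<noteq> j" "invertible g" for i j k t g
        using coincidence_edge_fixed[OF cont _ T eq that] V(3) by (simp add: Q_def)
    qed
    fix k i j :: 'n assume ij: "i \<noteq> j"
    have inv: "invertible (g ** transvection i j t)" for t
      using g ij by (intro invertible_mult invertible_transvection)
    \<comment> \<open>The frames \<open>T h\<close> are arbitrary choices, so continuity in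
      \<open>t\<close> cannot be read off from them. The projection is instead written as a fixed
      polynomial in \<open>\<phi>\<close> of a continuously varying matrix.\<close>
    obtain xs where xs: "set xs = ($) v0 ` (- {k})" using finite_list[of "($) v0 ` (- {k})"] by auto
    define c where "c = (\<Prod>a\<leftarrow>xs. v0 $ k - a)"
    have "c \<noteq> 0" using xs V(3)[OF v0] by (auto simp: c_def prod_list_zero_iff dest: injD)
    have sp: "shifted_prod (diag_mat (($) v0)) xs = mat c ** coord_proj k"
    proof -
      have "(\<Prod>a\<leftarrow>xs. v0 $ i - a) = (if i = k then c else 0)" for i
        using xs by (auto simp: c_def prod_list_zero_iff)
      then show ?thesis
        by (simp add: shifted_prod_diag) (auto simp: vec_eq_iff diag_mat_nth mat_mult_nth coord_proj_nth)
    qed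
    have "Q k h = mat (inverse c) ** conj_by (matrix_inv T1) (shifted_prod (\<phi> (conj_by h (diag_mat (($) v0)))) xs)"
      if h: "invertible h" for h
    proof -
      have "shifted_prod (\<phi> (conj_by h (diag_mat (($) v0)))) xs = mat c ** conj_by (T h) (coord_proj k)"
        by (simp add: eq[OF h v0] shifted_prod_conj_by T[OF h] sp conj_by_mat_mult)
      moreover have "mat (inverse c) ** (mat c ** A) = A" for A :: "complex^'n^'n"
        using \<open>c \<noteq> 0\<close> by (simp add: vec_eq_iff mat_mult_nth)
      ultimately show ?thesis by (simp add: conj_by_mat_mult Q_def)
    qed
    then have Qeq: "Q k (g ** transvection i j t) = mat (inverse c) ** conj_by (matrix_inv T1)
        (shifted_prod (\<phi> (conj_by (g ** transvection i j t) (diag_mat (($) v0)))) xs)" for t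
      using inv by blast
    show "continuous_on UNIV (\<lambda>t. Q k (g ** transvection i j t))"
      unfolding Qeq
    proof (intro continuous_intros continuous_on_compose2[OF cont])
      have "conj_by (g ** transvection i j t) A = conj_by g (transvection i j t ** A ** transvection i j (- t))" for t A
        using g ij by (simp add: invertible_transvection matrix_inv_transvection flip: conj_by_conj_by)
          (simp add: conj_by_def matrix_inv_transvection)
      then show "continuous_on UNIV (\<lambda>t. conj_by (g ** transvection i j t) (diag_mat (($) v0)))"
        by (simp add: continuous_intros)
      show "(\<lambda>t. conj_by (g ** transvection i j t) (diag_mat (($) v0))) ` UNIV \<subseteq> sigma_minus X"
        using sigma_minus_conj_diag[OF inv] V(3)[OF v0] by auto
    qed
  qed
  have base: "Q k (mat 1) = coord_proj k" for k using T1 by (simp add: Q_def conj_by_inv flip: T1_def)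
  \<comment> \<open>Transitivity reorders the eigenvalues into \<open>V\<close>, the frame is chosen
    for that order, and its diagonal factor is dropped.\<close>
  have reduce: "\<exists>h \<pi>. transvection_product h \<and> bij \<pi> \<and> (\<chi> i. w (\<pi> i)) \<in> V \<and>
      conj_by g (diag_mat w) = conj_by h (diag_mat (w \<circ> \<pi>))"
    if g: "invertible g" and w: "inj w" "range w \<subseteq> X" for g :: "complex^'n^'n" and w
  proof -
    obtain \<pi> where \<pi>: "bij \<pi>" "(\<chi> i. w (\<pi> i)) \<in> V" using trans[OF w] by blast
    have "inj (w \<circ> \<pi>)" using w(1) \<pi>(1) by (simp add: bij_is_inj inj_compose)
    moreover have "range (w \<circ> \<pi>) \<subseteq> spectrum (conj_by g (diag_mat w))"
      using g by (auto simp: spectrum_conj_by spectrum_diag)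
    ultimately obtain P where P: "invertible P" "conj_by g (diag_mat w) = conj_by P (diag_mat (w \<circ> \<pi>))"
      by (rule simple_spectrum_diagonalizable)
    obtain h d where h: "transvection_product h" "P = h ** diag_mat d" "\<And>i. d i \<noteq> 0"
      using invertible_eq_transvection_product_diag[OF P(1)] by blast
    have "conj_by P (diag_mat (w \<circ> \<pi>)) = conj_by h (diag_mat (w \<circ> \<pi>))"
      unfolding h(2) using h by (intro conj_by_diag_right transvection_product_invertible)
    then show ?thesis using P(2) h(1) \<pi> by metis
  qed
  have sum_form: "\<phi> (conj_by h (diag_mat (w \<circ> \<pi>))) = conj_by T1 (\<Sum>k\<in>UNIV. mat (w (\<pi> k)) ** Q k h)"
    if "transvection_product h" "(\<chi> i. w (\<pi> i)) \<in> V" for h w \<pi>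
  proof -
    have "($) (\<chi> i. w (\<pi> i)) = w \<circ> \<pi>" by (auto simp: fun_eq_iff)
    with \<phi>Q[OF transvection_product_invertible[OF that(1)] that(2)] show ?thesis by simp
  qed
  have map_sum: "map_matrix \<sigma> (conj_by h (diag_mat (\<sigma> \<circ> x))) = (\<Sum>k\<in>UNIV. mat (x k) ** map_matrix \<sigma> (conj_by h (coord_proj k)))"
    if "\<sigma> = id \<or> \<sigma> = cnj" for \<sigma> :: "complex \<Rightarrow> complex" and h :: "complex^'n^'n" and x
    using that unfolding conj_by_diag_eq_sum
    by (auto simp: vec_eq_iff mat_mult_nth sum_component)
  show ?thesis
  proof (rule proj_system_classification[OF n proj_system_axioms base])
    assume const: "\<And>h k. transvection_product h \<Longrightarrow> Q k h = coord_proj k"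
    define v' where "v' = (\<chi> i. v0 $ \<theta> i)"
    have v': "v' \<in> V" using nonfree(2)[OF v0] by (simp add: v'_def)
    have "range (($) v0) \<subseteq> spectrum (conj_by (mat 1) (diag_mat (($) v')))"
    proof -
      have "inj (($) v')" using V(3)[OF v'] by blast
      then have "inj \<theta>" by (auto simp: inj_def v'_def)
      then have "surj \<theta>" by (simp add: finite_UNIV_inj_surj)
      then have "range (($) v') = range (($) v0)" by (auto simp: v'_def) (metis surjD rangeI)
      then show ?thesis by (simp add: spectrum_diag)
    qed
    then obtain P where P: "invertible P" "conj_by (mat 1) (diag_mat (($) v')) = conj_by P (diag_mat (($) v0))"
      using simple_spectrum_diagonalizable[of "($) v0"] V(3)[OF v0] by metis
    obtain h d where h: "transvection_product h" "P = h ** diag_mat d" "\<And>i. d i \<noteq> 0"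
      using invertible_eq_transvection_product_diag[OF P(1)] by blast
    note inv = transvection_product_invertible[OF h(1)]
    have "conj_by (mat 1) (diag_mat (($) v')) = conj_by h (diag_mat (($) v0))"
      unfolding P(2) h(2) using inv h by (intro conj_by_diag_right)
    then have "conj_by T1 (\<Sum>k\<in>UNIV. mat (v' $ k) ** Q k (mat 1)) = conj_by T1 (\<Sum>k\<in>UNIV. mat (v0 $ k) ** Q k h)"
      using \<phi>Q[OF inv v0] \<phi>Q[OF _ v', of "mat 1"] by simp
    then have "diag_mat (($) v') = diag_mat (($) v0)"
      using T1 by (simp add: conj_by_inject base const[OF h(1)] flip: diag_mat_eq_sum)
    then have "v' $ i = v0 $ i" for i by (metis diag_mat_nth)
    then have "\<theta> = id" using V(3)[OF v0] by (auto simp: v'_def fun_eq_iff dest: injD)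
    then show ?thesis using nonfree(1) by simp
  next
    fix D \<sigma> assume D: "invertible D" and \<sigma>: "\<sigma> = id \<or> \<sigma> = cnj"
      and Q: "\<And>h k. transvection_product h \<Longrightarrow> Q k h = conj_by D (map_matrix \<sigma> (conj_by h (coord_proj k)))"
    have "\<phi> (conj_by g (diag_mat w)) = conj_by (T1 ** D) (map_matrix \<sigma> (conj_by g (diag_mat (\<sigma> \<circ> w))))"
      if gw: "invertible g" "inj w" "range w \<subseteq> X" for g w
    proof -
      obtain h \<pi> where h: "transvection_product h" "(\<chi> i. w (\<pi> i)) \<in> V"
        "conj_by g (diag_mat w) = conj_by h (diag_mat (w \<circ> \<pi>))" using reduce[OF gw] by blast
      have "conj_by g (diag_mat (\<sigma> \<circ> w)) = conj_by h (diag_mat (\<sigma> \<circ> (w \<circ> \<pi>)))"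
        using functional_calculus_unique[OF gw(1) transvection_product_invertible[OF h(1)] h(3)] .
      then show ?thesis
        using sum_form[OF h(1), of w \<pi>] h(2) T1 D
        by (simp add: h(3) Q[OF h(1)] map_sum[OF \<sigma>] conj_by_sum conj_by_mat_mult flip: conj_by_conj_by)
    qed
    then show ?thesis using that(1)[OF invertible_mult[OF T1 D] \<sigma>] by blast
  next
    fix D \<sigma> assume D: "invertible D" and \<sigma>: "\<sigma> = id \<or> \<sigma> = cnj"
      and Q: "\<And>h k. transvection_product h \<Longrightarrow> Q k h =
         conj_by D (Finite_Cartesian_Product.transpose (map_matrix \<sigma> (conj_by h (coord_proj k))))"
    have tr: "Finite_Cartesian_Product.transpose (\<Sum>k\<in>UNIV. mat (x k) ** A k) =
       (\<Sum>k\<in>UNIV. mat (x k) ** Finite_Cartesian_Product.transpose (A k))" for x and A :: "'n \<Rightarrow> complex^'n^'n"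
      by (simp add: vec_eq_iff Finite_Cartesian_Product.transpose_def sum_component mat_mult_nth)
    have "\<phi> (conj_by g (diag_mat w)) =
       conj_by (T1 ** D) (Finite_Cartesian_Product.transpose (map_matrix \<sigma> (conj_by g (diag_mat (\<sigma> \<circ> w)))))"
      if gw: "invertible g" "inj w" "range w \<subseteq> X" for g w
    proof -
      obtain h \<pi> where h: "transvection_product h" "(\<chi> i. w (\<pi> i)) \<in> V"
        "conj_by g (diag_mat w) = conj_by h (diag_mat (w \<circ> \<pi>))" using reduce[OF gw] by blast
      have "conj_by g (diag_mat (\<sigma> \<circ> w)) = conj_by h (diag_mat (\<sigma> \<circ> (w \<circ> \<pi>)))"
        using functional_calculus_unique[OF gw(1) transvection_product_invertible[OF h(1)] h(3)] .
      then show ?thesis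
        using sum_form[OF h(1), of w \<pi>] h(2) T1 D
        by (simp add: h(3) Q[OF h(1)] map_sum[OF \<sigma>] tr conj_by_sum conj_by_mat_mult flip: conj_by_conj_by)
    qed
    then show ?thesis using that(2)[OF invertible_mult[OF T1 D] \<sigma>] by blast
  qed
qed

section \<open>Configurations as vectors\<close>

text \<open>One arbitrary numbering with two uses: it identifies tuples over
  \<open>{..<CARD('n)}\<close> with vectors, and it gives the index type the order that triangular
  matrices refer to.\<close>

definition tuple_index :: "'n::finite \<Rightarrow> nat" where
  "tuple_index = (SOME h. bij_betw h UNIV {..<CARD('n)})"

definition tuple_vec :: "(nat \<Rightarrow> complex) \<Rightarrow> complex^'n" where
  "tuple_vec x = (\<chi> i. x (tuple_index i))"

lemma tuple_vec_nth [simp]: "tuple_vec x $ i = x (tuple_index i)"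
  by (simp add: tuple_vec_def)

lemma bij_tuple_index: "bij_betw (tuple_index :: 'n::finite \<Rightarrow> nat) UNIV {..<CARD('n)}"
proof -
  obtain h where "bij_betw h (UNIV :: 'n set) {0..<CARD('n)}"
    using ex_bij_betw_finite_nat[of "UNIV :: 'n set"] by auto
  then have "\<exists>h. bij_betw h (UNIV :: 'n set) {..<CARD('n)}" by (auto simp: lessThan_atLeast0)
  then show ?thesis unfolding tuple_index_def by (rule someI_ex)
qed

lemma tuple_index_less [simp]: "tuple_index (i :: 'n) < CARD('n::finite)"
  using bij_betwE[OF bij_tuple_index[where 'n='n]] by auto

lemma inj_tuple_index: "inj (tuple_index :: 'n::finite \<Rightarrow> nat)"
  using bij_tuple_index by (rule bij_betw_imp_inj_on)

lemma tuple_index_inject [simp]: "tuple_index i = tuple_index j \<longleftrightarrow> i = j"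
  using inj_tuple_index by (auto dest: injD)

lemma tuple_index_inv [simp]:
  "p < CARD('n::finite) \<Longrightarrow> tuple_index (inv (tuple_index :: 'n \<Rightarrow> nat) p) = p"
  using bij_tuple_index[where 'n='n] by (intro f_inv_into_f) (auto simp: bij_betw_def)

lemma inv_tuple_index [simp]: "inv tuple_index (tuple_index i) = i"
  by (rule inv_f_f[OF inj_tuple_index])

section \<open>Transport of components, closures and cycles to vectors\<close>

lemma topspace_tuple_space: "topspace (tuple_space n X) = {..<n} \<rightarrow>\<^sub>E X"
  by (simp add: tuple_space_def)

lemma configurations_iff: "x \<in> configurations n X \<longleftrightarrow> x \<in> {..<n} \<rightarrow>\<^sub>E X \<and> inj_on x {..<n}"
  by (simp add: configurations_def topspace_tuple_space)

lemma topspace_configuration_space: "topspace (configuration_space n X) = configurations n X"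
  by (auto simp: configuration_space_def configurations_def)

lemma tuple_vec_configuration:
  assumes "x \<in> configurations CARD('n) X"
  shows "inj (($) (tuple_vec x :: complex^'n))" "range (($) (tuple_vec x :: complex^'n)) \<subseteq> X"
proof -
  have x: "x \<in> {..<CARD('n)} \<rightarrow>\<^sub>E X" "inj_on x {..<CARD('n)}" using assms by (auto simp: configurations_iff)
  show "inj (($) (tuple_vec x :: complex^'n))"
  proof (rule injI)
    fix i j :: 'n assume "tuple_vec x $ i = tuple_vec x $ j"
    then have "tuple_index i = tuple_index j" by (intro inj_onD[OF x(2)]) auto
    then show "i = j" by simp
  qed
  show "range (($) (tuple_vec x :: complex^'n)) \<subseteq> X"
    using PiE_mem[OF x(1)] by (simp add: image_subset_iff)
qed

lemma tuple_of_family: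
  fixes w :: "'n::finite \<Rightarrow> complex"
  assumes "range w \<subseteq> X"
  obtains x where "x \<in> {..<CARD('n)} \<rightarrow>\<^sub>E X" "\<And>i. x (tuple_index i) = w i"
    "inj w \<Longrightarrow> x \<in> configurations CARD('n) X"
proof
  let ?x = "\<lambda>k\<in>{..<CARD('n)}. w (inv tuple_index k)"
  show 1: "?x \<in> {..<CARD('n)} \<rightarrow>\<^sub>E X" using assms by auto
  show "?x (tuple_index i) = w i" for i by simp
  show "?x \<in> configurations CARD('n) X" if "inj w"
    unfolding configurations_iff
  proof (intro conjI 1 inj_onI)
    fix p q assume pq: "p \<in> {..<CARD('n)}" "q \<in> {..<CARD('n)}" "?x p = ?x q"
    then have "inv (tuple_index :: 'n \<Rightarrow> nat) p = inv tuple_index q" using that by (auto dest: injD)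
    then show "p = q" using pq tuple_index_inv[where 'n='n] by (metis lessThan_iff)
  qed
qed

lemma continuous_map_tuple_vec:
  "continuous_map (tuple_space CARD('n) X) euclidean (tuple_vec :: _ \<Rightarrow> complex^'n)"
proof -
  have eq: "tuple_vec x = (\<Sum>i\<in>UNIV. axis i (x (tuple_index i)))" for x :: "nat \<Rightarrow> complex"
    by (auto simp: vec_eq_iff sum_component axis_def)
  have "continuous_map (tuple_space CARD('n) X) euclidean (\<lambda>x. x (tuple_index i))" for i :: 'n
    using continuous_map_product_projection[of "tuple_index i" "{..<CARD('n)}" "\<lambda>_. top_of_set X"]
    by (auto simp: tuple_space_def continuous_map_in_subtopology)
  moreover have "continuous_map euclidean euclidean (axis i :: complex \<Rightarrow> complex^'n)" for i
    unfolding continuous_map_iff_continuous2 axis_def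
    by (intro continuous_intros continuous_on_if_const)
  ultimately have "continuous_map (tuple_space CARD('n) X) euclidean (\<lambda>x. axis i (x (tuple_index i)) :: complex^'n)" for i :: 'n
    using continuous_map_compose unfolding o_def by blast
  then show ?thesis unfolding eq[abs_def] by (intro continuous_map_sum) auto
qed

lemma connected_tuple_vec_component:
  assumes "C \<in> connected_components_of (configuration_space CARD('n) X)"
  shows "connected (tuple_vec ` C :: (complex^'n) set)"
proof -
  have "continuous_map (configuration_space CARD('n) X) euclidean (tuple_vec :: _ \<Rightarrow> complex^'n)"
    unfolding configuration_space_def by (intro continuous_map_from_subtopology continuous_map_tuple_vec)
  then show ?thesis
    using connectedin_continuous_map_image connectedin_connected_components_of[OF assms]
    by (metis connectedin_iff_connected)
qed

lemma tuple_vec_closure: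
  "y \<in> tuple_space CARD('n) X closure_of C \<Longrightarrow> (tuple_vec y :: complex^'n) \<in> closure (tuple_vec ` C)"
  using continuous_map_image_closure_subset[OF continuous_map_tuple_vec] by fastforce

lemma coincidence_edge_tuple_vec:
  assumes "{a, b} \<in> Gamma_component CARD('n::finite) X C"
  shows "a < CARD('n)" "b < CARD('n)"
    "coincidence_edge X (tuple_vec ` C) (inv tuple_index a) (inv tuple_index b :: 'n)"
proof -
  obtain i j y where ij: "{a, b} = {i, j}" "i < CARD('n)" "j < CARD('n)" "i \<noteq> j"
    and y: "y \<in> topspace (tuple_space CARD('n) X)" "y \<in> tuple_space CARD('n) X closure_of C"
    "coincidences CARD('n) y = {{i, j}}"
    using assms unfolding Gamma_component_def by blast
  show ab: "a < CARD('n)" "b < CARD('n)" using ij by (auto simp: doubleton_eq_iff)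
  have "a \<noteq> b" using ij by (auto simp: doubleton_eq_iff)
  have "{a, b} \<in> coincidences CARD('n) y" using y(3) ij(1) by simp
  then have yab: "y a = y b" by (auto simp: coincidences_def doubleton_eq_iff)
  have co: "{p, q} = {inv tuple_index a, inv tuple_index b}" if pq: "p \<noteq> q" "y (tuple_index p) = y (tuple_index q)" for p q :: 'n
  proof -
    have "{tuple_index p, tuple_index q} \<in> coincidences CARD('n) y"
      unfolding coincidences_def using pq by (intro CollectI exI[of _ "tuple_index p"] exI[of _ "tuple_index q"]) auto
    then have "{tuple_index p, tuple_index q} = {a, b}" using y(3) ij(1) by simp
    then have "inv (tuple_index :: 'n \<Rightarrow> nat) ` {tuple_index p, tuple_index q} = inv tuple_index ` {a, b}" by (rule arg_cong)
    then show ?thesis by (simp only: image_insert image_empty inv_tuple_index)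
  qed
  show "coincidence_edge X (tuple_vec ` C) (inv tuple_index a) (inv tuple_index b :: 'n)"
    unfolding coincidence_edge_def
  proof (intro conjI bexI[of _ "tuple_vec y"])
    show "inv tuple_index a \<noteq> (inv tuple_index b :: 'n)"
      using ab \<open>a \<noteq> b\<close> tuple_index_inv[where 'n='n] by metis
    show "tuple_vec y \<in> closure (tuple_vec ` C :: (complex^'n) set)" using y(2) by (rule tuple_vec_closure)
    show "range (($) (tuple_vec y :: complex^'n)) \<subseteq> X" using PiE_mem[OF y(1)[unfolded topspace_tuple_space]] by (simp add: image_subset_iff)
    show "tuple_vec y $ (inv tuple_index a :: 'n) = tuple_vec y $ (inv tuple_index b :: 'n)"
      using ab yab by simp
    show "\<forall>p q. p \<noteq> q \<and> tuple_vec y $ p = tuple_vec y $ q \<longrightarrow>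
      {p, q} = {inv tuple_index a, inv tuple_index b :: 'n}"
      unfolding tuple_vec_nth using co by blast
  qed
qed

lemma coincidence_cycle_tuple_vec:
  assumes "contains_cycle CARD('n) (Gamma_component CARD('n) X C)"
  shows "coincidence_cycle X (tuple_vec ` C :: (complex^'n) set)"
proof -
  obtain vs where vs: "length vs = CARD('n)" "distinct vs"
    "\<And>i. i < CARD('n) \<Longrightarrow> {vs ! i, vs ! (Suc i mod CARD('n))} \<in> Gamma_component CARD('n) X C"
    using assms unfolding contains_cycle_def by blast
  note edge = coincidence_edge_tuple_vec[OF vs(3)]
  have less: "p < CARD('n)" if "p \<in> set vs" for p
    using that edge(1) vs(1) by (metis in_set_conv_nth)
  show ?thesis
    unfolding coincidence_cycle_def
  proof (intro exI[of _ "map (inv tuple_index) vs"] conjI allI impI)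
    show "distinct (map (inv (tuple_index :: 'n \<Rightarrow> nat)) vs)"
      unfolding distinct_map
      using vs(2) less tuple_index_inv[where 'n='n] by (metis inj_onI)
    fix i assume "i < CARD('n)"
    then show "coincidence_edge X (tuple_vec ` C) (map (inv tuple_index) vs ! i)
       (map (inv tuple_index) vs ! (Suc i mod CARD('n)) :: 'n)"
      using edge(3)[of i] vs(1) by simp
  qed (use vs in auto)
qed

lemma tuple_vec_act:
  assumes "\<theta> permutes {..<CARD('n)}"
  shows "(tuple_vec (tuple_act CARD('n) x \<theta>) :: complex^'n) =
    (\<chi> i. tuple_vec x $ (inv tuple_index (\<theta> (tuple_index i)) :: 'n))"
proof -
  have "\<theta> (tuple_index i) < CARD('n)" for i :: 'n
    using permutes_in_image[OF assms, of "tuple_index i"] by simp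
  then show ?thesis by (simp add: vec_eq_iff tuple_act_def)
qed

lemma permutes_tuple_index:
  assumes "\<theta> permutes {..<CARD('n)}"
  defines "\<pi> \<equiv> (\<lambda>i :: 'n::finite. inv tuple_index (\<theta> (tuple_index i)) :: 'n)"
  shows "bij \<pi>" "\<pi> = id \<Longrightarrow> \<theta> = id"
proof -
  have less: "\<theta> (tuple_index i) < CARD('n)" for i :: 'n
    using permutes_in_image[OF assms(1), of "tuple_index i"] by simp
  then have \<pi>: "tuple_index (\<pi> i) = \<theta> (tuple_index i)" for i by (simp add: \<pi>_def)
  have "inj \<pi>"
  proof (rule injI)
    fix i j assume "\<pi> i = \<pi> j"
    then have "\<theta> (tuple_index i) = \<theta> (tuple_index j)" by (metis \<pi>)
    then have "tuple_index i = tuple_index j" using permutes_inj[OF assms(1)] by (rule injD[rotated])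
    then show "i = j" by simp
  qed
  then show "bij \<pi>" by (simp add: bij_def finite_UNIV_inj_surj)
  show "\<theta> = id" if "\<pi> = id"
  proof
    fix p
    show "\<theta> p = id p"
    proof (cases "p < CARD('n)")
      case True
      then show ?thesis using \<pi>[of "inv tuple_index p"] that by simp
    next
      case False
      then show ?thesis using assms(1) by (simp add: permutes_def)
    qed
  qed
qed

theorem CS_preserver_simple_spectrum_configurations:
  fixes \<phi> :: "complex^'n^'n \<Rightarrow> complex^'n^'n" and X :: "complex set"
  assumes n: "CARD('n::finite) \<ge> 3"
    and cyc: "\<forall>x \<in> configurations CARD('n) X. contains_cycle CARD('n) (Gamma_graph CARD('n) X x)"
    and trans: "transitive_on_components CARD('n) X"
    and nonfree: "\<not> free_on_components CARD('n) X"
    and cont: "continuous_on (sigma_minus X) \<phi>" and CS: "CS_preserver (sigma_minus X) \<phi>"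
  obtains D \<sigma> where "invertible D" "\<sigma> = id \<or> \<sigma> = cnj"
      "\<And>g w. invertible g \<Longrightarrow> inj w \<Longrightarrow> range w \<subseteq> X \<Longrightarrow>
        \<phi> (conj_by g (diag_mat w)) = conj_by D (map_matrix \<sigma> (conj_by g (diag_mat (\<sigma> \<circ> w))))"
  | D \<sigma> where "invertible D" "\<sigma> = id \<or> \<sigma> = cnj"
      "\<And>g w. invertible g \<Longrightarrow> inj w \<Longrightarrow> range w \<subseteq> X \<Longrightarrow>
        \<phi> (conj_by g (diag_mat w)) =
          conj_by D (Finite_Cartesian_Product.transpose (map_matrix \<sigma> (conj_by g (diag_mat (\<sigma> \<circ> w)))))"
proof -
  let ?S = "configuration_space CARD('n) X"
  obtain C \<theta> where C: "C \<in> connected_components_of ?S" and \<theta>: "\<theta> permutes {..<CARD('n)}"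
    "set_act CARD('n) C \<theta> = C" "\<theta> \<noteq> id"
    using nonfree unfolding free_on_components_def by blast
  have CS': "C \<subseteq> configurations CARD('n) X"
    using connected_components_of_subset[OF C] by (simp add: topspace_configuration_space)
  obtain x0 where x0: "x0 \<in> C" using nonempty_connected_components_of[OF C] by blast
  have compC: "connected_component_of_set ?S x = C'"
    if "C' \<in> connected_components_of ?S" "x \<in> C'" for x C'
    using that unfolding connected_components_of_def
    by (auto simp: connected_component_of_equiv) 
  define V where "V = (tuple_vec ` C :: (complex^'n) set)"
  define \<pi> where "\<pi> \<theta> = (\<lambda>i :: 'n. inv tuple_index (\<theta> (tuple_index i)) :: 'n)" for \<theta>
  note \<pi> = permutes_tuple_index[where 'n='n, folded \<pi>_def]
  have act: "(\<chi> i. tuple_vec x $ \<pi> \<theta> i) = (tuple_vec (tuple_act CARD('n) x \<theta>) :: complex^'n)"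
    if "\<theta> permutes {..<CARD('n)}" for x \<theta>
    using tuple_vec_act[OF that] by (simp add: \<pi>_def)
  have 1: "connected V" unfolding V_def by (rule connected_tuple_vec_component[OF C])
  have 2: "V \<noteq> {}" using x0 by (auto simp: V_def)
  have 3: "inj (($) v) \<and> range (($) v) \<subseteq> X" if "v \<in> V" for v
    using that CS' tuple_vec_configuration unfolding V_def by blast
  have 4: "coincidence_cycle X V"
    unfolding V_def using cyc CS' x0 compC[OF C x0]
    by (intro coincidence_cycle_tuple_vec) (auto simp: Gamma_graph_def)
  have 5: "\<pi> \<theta> \<noteq> id" using \<pi>(2)[OF \<theta>(1)] \<theta>(3) by blast
  have 6: "(\<chi> i. v $ \<pi> \<theta> i) \<in> V" if v: "v \<in> V" for v
  proof -
    obtain x where x: "x \<in> C" "v = tuple_vec x" using v by (auto simp: V_def)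
    have "tuple_act CARD('n) x \<theta> \<in> C" using \<theta>(2) x(1) by (auto simp: set_act_def)
    then show ?thesis using act[OF \<theta>(1), of x] x(2) by (auto simp: V_def)
  qed
  have 7: "\<exists>\<pi>. bij \<pi> \<and> (\<chi> i. w (\<pi> i)) \<in> V" if w: "inj w" "range w \<subseteq> X" for w :: "'n \<Rightarrow> complex"
  proof -
    obtain x where x: "x \<in> configurations CARD('n) X" "\<And>i. x (tuple_index i) = w i"
      using tuple_of_family[OF w(2)] w(1) by metis
    define C' where "C' = connected_component_of_set ?S x"
    have C': "C' \<in> connected_components_of ?S" "x \<in> C'"
      using x(1) unfolding C'_def
      by (auto simp: connected_component_in_connected_components_of topspace_configuration_space
          connected_component_of_refl)
    obtain \<eta> where \<eta>: "\<eta> permutes {..<CARD('n)}" "set_act CARD('n) C' \<eta> = C"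
      using trans C C'(1) unfolding transitive_on_components_def by blast
    have "tuple_act CARD('n) x \<eta> \<in> C" using \<eta>(2) C'(2) by (auto simp: set_act_def)
    moreover have "(\<chi> i. w (\<pi> \<eta> i)) = (tuple_vec (tuple_act CARD('n) x \<eta>) :: complex^'n)"
      using act[OF \<eta>(1), of x] x(2) by simp
    ultimately show ?thesis using \<pi>(1)[OF \<eta>(1)] by (intro exI[of _ "\<pi> \<eta>"]) (auto simp: V_def)
  qed
  show ?thesis
    using CS_preserver_simple_spectrum[OF n cont CS 1 2 3 4 5 6 7] that by blast
qed

section \<open>Triangularization and density of simple spectra\<close>

text \<open>The vector \<open>p(A) w\<close>, by Horner's scheme.\<close>

definition krylov :: "complex^'n^'n \<Rightarrow> complex^'n \<Rightarrow> complex poly \<Rightarrow> complex^'n" where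
  "krylov A w p = fold_coeffs (\<lambda>c v. c *s w + A *v v) p 0"

lemma krylov_0 [simp]: "krylov A w 0 = 0"
  by (simp add: krylov_def)

lemma krylov_pCons [simp]: "krylov A w (pCons c p) = c *s w + A *v krylov A w p"
  by (cases "c = 0 \<and> p = 0") (auto simp: krylov_def fold_coeffs_pCons_eq)

lemma krylov_add: "krylov A w (p + q) = krylov A w p + krylov A w q"
  by (induction p q rule: poly_induct2) (simp_all add: matrix_vector_right_distrib vec.scale_left_distrib algebra_simps)

lemma krylov_smult: "krylov A w (smult c p) = c *s krylov A w p"
  by (induction p) (simp_all add: vec.scale_right_distrib vector_smult_assoc vector_scalar_commute)

lemma krylov_sum: "krylov A w (\<Sum>j\<in>J. p j) = (\<Sum>j\<in>J. krylov A w (p j))"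
  by (induction J rule: infinite_finite_induct) (simp_all add: krylov_add)

lemma mat_mult_vec: "mat c *v v = c *s (v :: complex^'n)"
  by (simp add: vec_eq_iff matrix_vector_mult_def mat_def if_distrib if_distribR
      sum.delta sum.delta' cong: if_cong)

lemma krylov_linear_factor: "krylov A w ([:- a, 1:] * q) = (A - mat a) *v krylov A w q"
proof -
  have "[:- a, 1:] * q = smult (- a) q + pCons 0 q" by simp
  then show ?thesis
    by (simp only: krylov_add krylov_smult krylov_pCons) (simp add: matrix_vector_mult_diff_rdistrib mat_mult_vec)
qed

text \<open>The vectors \<open>w\<close>, \<open>A w\<close>, ..., \<open>A^n w\<close> are
  dependent. If the first \<open>n\<close> of them form an invertible matrix, the last is a
  combination of them; otherwise a kernel vector is a relation among the first
  \<open>n\<close>.\<close>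

lemma krylov_annihilator:
  fixes A :: "complex^'n^'n"
  shows "\<exists>p. p \<noteq> 0 \<and> krylov A w p = 0"
proof -
  let ?m = "\<lambda>k. krylov A w (monom 1 k)"
  define Kr :: "complex^'n^'n" where "Kr = (\<chi> i j. ?m (tuple_index j) $ i)"
  have comb: "krylov A w (\<Sum>j\<in>UNIV. monom (c $ j) (tuple_index j)) = Kr *v c" for c :: "complex^'n"
  proof -
    have "krylov A w (monom (c $ j) k) = c $ j *s ?m k" for j k
      by (metis krylov_smult mult.right_neutral smult_monom)
    then show ?thesis
      by (simp add: krylov_sum vec_eq_iff Kr_def matrix_vector_mult_def sum_component mult.commute)
  qed
  have coeff: "coeff (\<Sum>j\<in>UNIV. monom (c $ j) (tuple_index j)) (tuple_index k) = c $ k" for c :: "complex^'n" and k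
    by (simp add: coeff_sum if_distrib cong: if_cong)
  show ?thesis
  proof (cases "invertible Kr")
    case True
    define c where "c = - (matrix_inv Kr *v ?m CARD('n))"
    let ?p = "monom 1 CARD('n) + (\<Sum>j\<in>UNIV. monom (c $ j) (tuple_index j))"
    have "Kr *v c = - ?m CARD('n)"
      using True by (simp add: c_def linear_neg[OF matrix_vector_mul_linear] matrix_vector_mul_assoc matrix_inv_right)
    then have "krylov A w ?p = 0" by (simp add: krylov_add comb)
    moreover have "coeff ?p CARD('n) = 1"
      by (simp add: coeff_sum less_imp_neq)
    ultimately show ?thesis by (metis coeff_0 zero_neq_one)
  next
    case False
    then obtain c where c: "c \<noteq> 0" "Kr *v c = 0"
      by (metis invertible_left_inverse matrix_left_invertible_ker)
    then obtain k where "c $ k \<noteq> 0" by (auto simp: vec_eq_iff)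
    then have "(\<Sum>j\<in>UNIV. monom (c $ j) (tuple_index j :: nat)) \<noteq> 0" using coeff by (metis coeff_0)
    then show ?thesis using c comb by metis
  qed
qed

text \<open>This is an eigenvector in the quotient by \<open>W\<close>, found without forming the
  quotient. Linear factors are stripped from an annihilating polynomial of \<open>w\<close> until
  the resulting vector leaves \<open>W\<close>; the vector just outside is \<open>u\<close>.\<close>

lemma eigenvector_modulo:
  fixes A :: "complex^'n^'n"
  assumes W: "\<And>c v. v \<in> W \<Longrightarrow> c *s v \<in> W" "0 \<in> W" and w: "w \<notin> W"
  obtains u a where "u \<notin> W" "(A - mat a) *v u \<in> W"
proof -
  have "\<exists>u a. u \<notin> W \<and> (A - mat a) *v u \<in> W" if "p \<noteq> 0" "krylov A w p \<in> W" for p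
    using that
  proof (induction "degree p" arbitrary: p rule: less_induct)
    case less
    show ?case
    proof (cases "degree p = 0")
      case True
      then obtain c where "p = [:c:]" by (rule degree_eq_zeroE)
      then have "c \<noteq> 0" "c *s w \<in> W" using less.prems by auto
      then have "w \<in> W" using W(1)[of "c *s w" "inverse c"] by (simp add: vector_smult_assoc)
      with w show ?thesis by blast
    next
      case False
      then have "\<not> constant (poly p)" by (simp add: constant_degree)
      then obtain a where "poly p a = 0" using fundamental_theorem_of_algebra by blast
      then obtain q where q: "p = [:- a, 1:] * q" by (auto simp: poly_eq_0_iff_dvd elim: dvdE)
      then have "q \<noteq> 0" using less.prems by auto
      then have deg: "degree q < degree p" unfolding q by (subst degree_mult_eq) auto
      show ?thesis
      proof (cases "krylov A w q \<in> W")
        case True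
        then show ?thesis using less.hyps[OF deg \<open>q \<noteq> 0\<close>] by blast
      next
        case False
        then show ?thesis using less.prems(2) unfolding q krylov_linear_factor by blast
      qed
    qed
  qed
  moreover obtain p where "p \<noteq> 0" "krylov A w p = 0" using krylov_annihilator by blast
  ultimately show ?thesis using W(2) that by metis
qed

lemma matrix_mult_axis: "(A *v axis j 1) $ i = A $ i $ j" for A :: "complex^'n^'m"
  by (simp add: matrix_vector_mult_def axis_def if_distrib cong: if_cong)

text \<open>The span \<open>W\<close> of the first \<open>m\<close> unit vectors is invariant under
  \<open>M\<close>. An eigenvector modulo \<open>W\<close> becomes the next column, and as
  \<open>R\<close> is the identity on \<open>W\<close>, the columns treated before survive.\<close>

lemma triangularize_step:
  fixes M :: "complex^'n^'n" and j0 :: 'n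
  assumes tri: "\<And>i j. tuple_index j < m \<Longrightarrow> tuple_index j < tuple_index i \<Longrightarrow> M $ i $ j = 0"
    and j0: "tuple_index j0 = m"
  obtains R where "invertible R"
    "\<And>i j. tuple_index j < Suc m \<Longrightarrow> tuple_index j < tuple_index i \<Longrightarrow> conj_by (matrix_inv R) M $ i $ j = 0"
proof -
  define W where "W = {v :: complex^'n. \<forall>i. m \<le> tuple_index i \<longrightarrow> v $ i = 0}"
  have "axis j0 1 \<notin> W" using j0 by (auto simp: W_def axis_def)
  moreover have "c *s v \<in> W" if "v \<in> W" for c v using that by (simp add: W_def)
  moreover have "0 \<in> W" by (simp add: W_def)
  ultimately obtain u a where u: "u \<notin> W" "(M - mat a) *v u \<in> W"
    using eigenvector_modulo[of W "axis j0 1" M] by metis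
  obtain i0 where i0: "m \<le> tuple_index i0" "u $ i0 \<noteq> 0" using u(1) by (auto simp: W_def)
  \<comment> \<open>If \<open>u\<close> vanishes at \<open>j0\<close>, merely replacing column
    \<open>j0\<close> by \<open>u\<close> is singular. The unit vector of \<open>j0\<close> is
    therefore moved to column \<open>i0\<close>, where \<open>u\<close> is nonzero.\<close>
  define R :: "complex^'n^'n" where
    "R = (\<chi> i j. if j = j0 then u $ i else if j = i0 then axis j0 1 $ i else axis j 1 $ i)"
  have RW: "R *v q = q" if "q \<in> W" for q
  proof -
    have "(R *v q) $ i = q $ i" for i
    proof -
      have "(R *v q) $ i = (\<Sum>j\<in>UNIV. R $ i $ j * q $ j)" by (simp add: matrix_vector_mult_def)
      also have "\<dots> = (\<Sum>j\<in>UNIV. if j = i then q $ i else 0)"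
        using that i0 j0 by (intro sum.cong) (auto simp: W_def axis_def R_def)
      finally show ?thesis by simp
    qed
    then show ?thesis by (simp add: vec_eq_iff)
  qed
  have "c = 0" if "R *v c = 0" for c
  proof -
    have eq: "(\<Sum>j\<in>UNIV. R $ i $ j * c $ j) = 0" for i
      using arg_cong[OF that, of "\<lambda>v. v $ i"] by (simp add: matrix_vector_mult_def)
    have "(\<Sum>j\<in>UNIV. R $ i0 $ j * c $ j) = (\<Sum>j\<in>UNIV. if j = j0 then u $ i0 * c $ j0 else 0)"
      by (intro sum.cong) (auto simp: R_def axis_def)
    then have c0: "c $ j0 = 0" using eq[of i0] i0(2) by simp
    have "c $ k = 0" for k
    proof (cases "k = j0")
      case False
      define i where "i = (if k = i0 then j0 else k)"
      have "(\<Sum>j\<in>UNIV. R $ i $ j * c $ j) = (\<Sum>j\<in>UNIV. if j = k then c $ k else 0)"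
        by (intro sum.cong) (use False c0 in \<open>auto simp: R_def axis_def i_def\<close>)
      then show ?thesis using eq[of i] by simp
    qed (use c0 in simp)
    then show ?thesis by (simp add: vec_eq_iff)
  qed
  then have R: "invertible R" by (metis invertible_left_inverse matrix_left_invertible_ker)
  have RW': "matrix_inv R *v q = q" if "q \<in> W" for q
    using RW[OF that] R by (metis matrix_inv_left matrix_vector_mul_assoc matrix_vector_mul_lid)
  have Ru: "R *v axis j0 1 = u" by (simp add: vec_eq_iff matrix_mult_axis) (simp add: R_def)
  then have Ru': "matrix_inv R *v u = axis j0 1"
    using R by (metis matrix_inv_left matrix_vector_mul_assoc matrix_vector_mul_lid)
  have col: "conj_by (matrix_inv R) M $ i $ j = (matrix_inv R *v (M *v (R *v axis j 1))) $ i" for i j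
  proof -
    have "matrix_inv (matrix_inv R) = R" using R by (intro matrix_inv_unique_left matrix_inv_left)
    then show ?thesis
      by (simp add: conj_by_def matrix_vector_mul_assoc matrix_mul_assoc flip: matrix_mult_axis)
  qed
  have "conj_by (matrix_inv R) M $ i $ j = 0" if ij: "tuple_index j < Suc m" "tuple_index j < tuple_index i" for i j
  proof (cases "j = j0")
    case True
    define q where "q = (M - mat a) *v u"
    have "M *v u = a *s u + q" by (simp add: q_def matrix_vector_mult_diff_rdistrib mat_mult_vec)
    then have "matrix_inv R *v (M *v u) = a *s axis j0 1 + q"
      using RW'[of q] u(2) Ru' by (simp add: q_def matrix_vector_right_distrib vector_scalar_commute)
    then show ?thesis
      unfolding col True Ru using ij u(2) j0 True by (auto simp: W_def axis_def simp flip: q_def)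
  next
    case False
    then have jm: "tuple_index j < m" using ij j0 by (metis less_antisym tuple_index_inject)
    have ax: "R *v axis j 1 = axis j 1" using jm by (intro RW) (auto simp: W_def axis_def)
    have "M *v axis j 1 \<in> W" using tri[OF jm] jm by (simp add: W_def matrix_mult_axis)
    then show ?thesis unfolding col ax using RW' tri[OF jm ij(2)] by (simp add: matrix_mult_axis)
  qed
  with R that show ?thesis by blast
qed

theorem triangularize:
  fixes A :: "complex^'n^'n"
  obtains P U where "invertible P" "A = conj_by P U"
    "\<And>i j. tuple_index j < tuple_index i \<Longrightarrow> U $ i $ j = 0"
proof -
  have "\<exists>P. invertible P \<and> (\<forall>i j. tuple_index j < m \<longrightarrow> tuple_index j < tuple_index i \<longrightarrow>
      conj_by (matrix_inv P) A $ i $ j = 0)" if "m \<le> CARD('n)" for m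
    using that
  proof (induction m)
    case 0
    then show ?case by (intro exI[of _ "mat 1"]) simp
  next
    case (Suc m)
    then obtain P where P: "invertible P" "\<And>i j. tuple_index j < m \<Longrightarrow> tuple_index j < tuple_index i \<Longrightarrow>
      conj_by (matrix_inv P) A $ i $ j = 0" by force
    have "tuple_index (inv tuple_index m :: 'n) = m" using Suc.prems by simp
    then obtain R where R: "invertible R"
      "\<And>i j. tuple_index j < Suc m \<Longrightarrow> tuple_index j < tuple_index i \<Longrightarrow>
        conj_by (matrix_inv R) (conj_by (matrix_inv P) A) $ i $ j = 0"
      using triangularize_step[OF P(2)] by blast
    then show ?case using P(1)
      by (intro exI[of _ "P ** R"]) (simp add: conj_by_conj_by invertible_matrix_inv matrix_inv_mult invertible_mult)
  qed
  then obtain P where "invertible P" "\<And>i j. tuple_index j < tuple_index i \<Longrightarrow>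
      conj_by (matrix_inv P) A $ i $ j = 0" by (metis order_refl tuple_index_less)
  then show ?thesis using that conj_by_inv' by metis
qed

section \<open>Density of the matrices with simple spectrum\<close>

definition simple_matrices :: "complex set \<Rightarrow> (complex^'n^'n) set" where
  "simple_matrices X = {conj_by g (diag_mat w) | g w. invertible g \<and> inj w \<and> range w \<subseteq> X}"

lemma simple_matricesI:
  "invertible g \<Longrightarrow> inj w \<Longrightarrow> range w \<subseteq> X \<Longrightarrow> conj_by g (diag_mat w) \<in> simple_matrices X"
  by (auto simp: simple_matrices_def)

lemma simple_matricesE:
  assumes "A \<in> simple_matrices X"
  obtains g w where "invertible g" "inj w" "range w \<subseteq> X" "A = conj_by g (diag_mat w)"
  using assms by (auto simp: simple_matrices_def)

lemma simple_spectrum_in_simple_matrices: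
  fixes A :: "complex^'n^'n" and w :: "'n \<Rightarrow> complex"
  shows "inj w \<Longrightarrow> range w \<subseteq> spectrum A \<Longrightarrow> range w \<subseteq> X \<Longrightarrow> A \<in> simple_matrices X"
  using simple_spectrum_diagonalizable[of w A "A \<in> simple_matrices X"] simple_matricesI[of _ w X] by blast

lemma simple_matrices_subset: "simple_matrices X \<subseteq> sigma_minus X"
  by (auto simp: simple_matrices_def intro: sigma_minus_conj_diag)

lemma perfect_islimpt: "perfect (top_of_set X) \<Longrightarrow> x \<in> X \<Longrightarrow> x islimpt X"
  by (auto simp: perfect_def closure_of_subtopology islimpt_in_closure Int_absorb1)

lemma distinct_approximation:
  fixes y :: "'i \<Rightarrow> complex"
  assumes X: "\<And>x. x \<in> X \<Longrightarrow> x islimpt X" and "finite I" and y: "\<And>i. i \<in> I \<Longrightarrow> y i \<in> X" and e: "e > 0"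
  shows "\<exists>x. inj_on x I \<and> (\<forall>i\<in>I. x i \<in> X \<and> dist (x i) (y i) < e)"
  using \<open>finite I\<close> y
proof (induction I)
  case (insert i I)
  then obtain x where x: "inj_on x I" "\<forall>i\<in>I. x i \<in> X \<and> dist (x i) (y i) < e" by auto
  have "infinite (X \<inter> ball (y i) e)"
    using X[of "y i"] insert.prems e by (auto simp: islimpt_eq_infinite_ball)
  then have "X \<inter> ball (y i) e - x ` I \<noteq> {}" 
    using Diff_infinite_finite[of "x ` I" "X \<inter> ball (y i) e"] insert.hyps(1) by force
  then obtain c where "c \<in> X \<inter> ball (y i) e - x ` I" by blast
  then have "c \<in> X" "dist (y i) c < e" "c \<notin> x ` I" by auto
  then show ?case using x insert.hyps
    by (intro exI[of _ "x(i := c)"]) (auto simp: inj_on_def dist_commute)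
qed simp

lemma distinct_sequence:
  fixes y :: "'n::finite \<Rightarrow> complex"
  assumes "\<And>x. x \<in> X \<Longrightarrow> x islimpt X" "\<And>i. y i \<in> X"
  obtains x :: "nat \<Rightarrow> 'n \<Rightarrow> complex"
  where "\<And>n. inj (x n)" "\<And>n i. x n i \<in> X" "\<And>i. (\<lambda>n. x n i) \<longlonglongrightarrow> y i"
proof -
  have "\<exists>x. inj_on x UNIV \<and> (\<forall>i\<in>UNIV. x i \<in> X \<and> dist (x i) (y i) < inverse (Suc n))" for n
    by (rule distinct_approximation) (use assms in auto)
  then have "\<exists>x. inj x \<and> (\<forall>i. x i \<in> X \<and> dist (x i) (y i) < inverse (Suc n))" for n
    by simp
  then obtain x where x: "\<And>n. inj (x n)" "\<And>n i. x n i \<in> X" "\<And>n i. dist (x n i) (y i) < inverse (Suc n)"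
    by metis
  have "(\<lambda>n. x n i) \<longlonglongrightarrow> y i" for i
  proof (rule tendsto_dist_iff[THEN iffD2], rule tendsto_sandwich[OF _ _ tendsto_const LIMSEQ_inverse_real_of_nat])
    show "\<forall>\<^sub>F n in sequentially. dist (x n i) (y i) \<le> inverse (real (Suc n))"
      using x(3) by (intro always_eventually allI less_imp_le)
  qed simp
  with x(1,2) that show ?thesis by blast
qed

lemma simple_matrices_perturb:
  fixes U :: "complex^'n^'n"
  assumes P: "invertible P" and tri: "\<And>i j. tuple_index j < tuple_index i \<Longrightarrow> U $ i $ j = 0"
    and x: "inj x" "range x \<subseteq> X"
  shows "conj_by P (U + diag_mat (\<lambda>i. x i - U $ i $ i)) \<in> simple_matrices X"
proof (rule simple_spectrum_in_simple_matrices[OF x(1) _ x(2)])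
  let ?U = "U + diag_mat (\<lambda>i. x i - U $ i $ i)"
  have "spectrum ?U = range (\<lambda>i. ?U $ i $ i)"
    by (rule spectrum_upper_triangular[OF inj_tuple_index]) (auto simp: tri diag_mat_nth)
  also have "\<dots> = range x" by (simp add: diag_mat_nth)
  finally show "range x \<subseteq> spectrum (conj_by P ?U)" using P by (simp add: spectrum_conj_by)
qed

text \<open>Only the diagonal of a triangular form is perturbed, so the new eigenvalues are
  prescribed and can be kept inside \<open>X\<close>.\<close>

lemma simple_matrices_dense:
  fixes A :: "complex^'n^'n"
  assumes X: "\<And>x. x \<in> X \<Longrightarrow> x islimpt X" and A: "A \<in> sigma_minus X"
  shows "A \<in> closure (simple_matrices X)"
proof -
  obtain P U where P: "invertible P" and AU: "A = conj_by P U"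
    and tri: "\<And>i j. tuple_index j < tuple_index i \<Longrightarrow> U $ i $ j = 0" using triangularize by blast
  define y where "y i = U $ i $ i" for i
  have "spectrum A = range y"
    using spectrum_upper_triangular[OF inj_tuple_index tri] P
    by (simp add: AU spectrum_conj_by y_def[abs_def])
  then have yX: "y i \<in> X" for i using A by (auto simp: sigma_minus_def)
  obtain x where x: "\<And>n. inj (x n)" "\<And>n i. x n i \<in> X" "\<And>i. (\<lambda>n. x n i) \<longlonglongrightarrow> y i"
    by (rule distinct_sequence[of X y], erule X, rule yX, rule that)
  have "(\<lambda>n. conj_by P (U + diag_mat (\<lambda>i. x n i - U $ i $ i))) \<longlonglongrightarrow> conj_by P (U + diag_mat (\<lambda>i. y i - U $ i $ i))"
    by (intro tendsto_intros tendsto_diag_mat x(3))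
  moreover have "conj_by P (U + diag_mat (\<lambda>i. y i - U $ i $ i)) = A"
  proof -
    have "diag_mat (\<lambda>i. y i - U $ i $ i) = 0" by (simp add: vec_eq_iff diag_mat_nth y_def)
    then show ?thesis by (simp add: AU)
  qed
  moreover have "conj_by P (U + diag_mat (\<lambda>i. x n i - U $ i $ i)) \<in> simple_matrices X" for n
    using x by (intro simple_matrices_perturb P tri) auto
  ultimately show ?thesis
    unfolding closure_sequential
    by (intro exI[of _ "\<lambda>n. conj_by P (U + diag_mat (\<lambda>i. x n i - U $ i $ i))"]) simp
qed

section \<open>Eigenvalues of convergent sequences of matrices\<close>

lemma spectrum_bound:
  fixes A :: "complex^'n^'n"
  assumes "c \<in> spectrum A"
  shows "norm c \<le> (\<Sum>i\<in>UNIV. \<Sum>j\<in>UNIV. norm (A $ i $ j))"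
proof -
  obtain v where v: "v \<noteq> 0" "A *v v = c *s v" using assms by (auto simp: spectrum_def)
  have "\<exists>i. \<forall>j. norm (v $ j) \<le> norm (v $ i)"
    using Max_in[of "range (\<lambda>j. norm (v $ j))"] Max_ge[of "range (\<lambda>j. norm (v $ j))"] by fastforce
  then obtain i where i: "\<And>j. norm (v $ j) \<le> norm (v $ i)" by blast
  have "v $ i \<noteq> 0" using v(1) i by (auto simp: vec_eq_iff)
  have "c * v $ i = (\<Sum>j\<in>UNIV. A $ i $ j * v $ j)"
    using arg_cong[OF v(2), of "\<lambda>v. v $ i"] by (simp add: matrix_vector_mult_def)
  then have "norm c * norm (v $ i) \<le> (\<Sum>j\<in>UNIV. norm (A $ i $ j) * norm (v $ j))"
    by (metis (mono_tags, lifting) norm_mult norm_sum sum.cong)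
  also have "\<dots> \<le> (\<Sum>j\<in>UNIV. norm (A $ i $ j) * norm (v $ i))"
    by (intro sum_mono mult_left_mono i) auto
  also have "\<dots> = (\<Sum>j\<in>UNIV. norm (A $ i $ j)) * norm (v $ i)" by (simp add: sum_distrib_right)
  finally have "norm c \<le> (\<Sum>j\<in>UNIV. norm (A $ i $ j))" using \<open>v $ i \<noteq> 0\<close> by simp
  also have "\<dots> \<le> (\<Sum>i\<in>UNIV. \<Sum>j\<in>UNIV. norm (A $ i $ j))"
    by (rule member_le_sum) (auto intro: sum_nonneg)
  finally show ?thesis .
qed

lemma tendsto_det [tendsto_intros]:
  fixes A :: "'a \<Rightarrow> complex^'n^'n"
  shows "(A \<longlongrightarrow> B) F \<Longrightarrow> ((\<lambda>x. det (A x)) \<longlongrightarrow> det B) F"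
  unfolding det_def by (intro tendsto_intros)

text \<open>Roots are compared with multiplicity. This identifies limits of eigenvalues with the
  diagonal of a triangular form, up to order.\<close>

lemma prod_linear_factors_eq_imp_permuted:
  fixes w y :: "'n::finite \<Rightarrow> complex"
  assumes "\<And>t. (\<Prod>i\<in>UNIV. w i - t) = (\<Prod>i\<in>UNIV. y i - t)"
  obtains \<pi> where "bij \<pi>" "\<And>i. w (\<pi> i) = y i"
proof -
  have poly: "poly (\<Prod>i\<in>UNIV. [:- w i, 1:]) t = (- 1) ^ CARD('n) * (\<Prod>i\<in>UNIV. w i - t)" for w :: "'n \<Rightarrow> complex" and t
  proof -
    have "poly (\<Prod>i\<in>UNIV. [:- w i, 1:]) t = (\<Prod>i\<in>UNIV. - 1 * (w i - t))"
      by (simp add: poly_prod)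
    also have "\<dots> = (- 1) ^ CARD('n) * (\<Prod>i\<in>UNIV. w i - t)"
      by (subst prod.distrib) simp
    finally show ?thesis .
  qed
  have "poly (\<Prod>i\<in>UNIV. [:- w i, 1:]) = poly (\<Prod>i\<in>UNIV. [:- y i, 1:])"
    by (rule ext) (simp only: poly assms)
  then have "(\<Prod>i\<in>UNIV. [:- w i, 1:]) = (\<Prod>i\<in>UNIV. [:- y i, 1:])" by (simp only: poly_eq_poly_eq_iff)
  moreover have "proots (\<Prod>i\<in>UNIV. [:- w i, 1:]) = image_mset w (mset_set UNIV)" for w :: "'n \<Rightarrow> complex"
    by (subst proots_prod) (auto simp: sum_unfold_sum_mset)
  ultimately have "image_mset w (mset_set UNIV) = image_mset y (mset_set UNIV)" by metis
  then obtain \<pi> where "\<pi> permutes UNIV" "\<And>i. y i = w (\<pi> i)"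
    using image_mset_eq_implies_permutes[of UNIV y w] by auto
  then show ?thesis using that permutes_bij by metis
qed

section \<open>Divided differences\<close>

text \<open>Lagrange's form over a set of nodes: symmetry in the nodes is built in.\<close>

definition divided_diff :: "(complex \<Rightarrow> complex) \<Rightarrow> complex set \<Rightarrow> complex" where
  "divided_diff f S = (\<Sum>s\<in>S. f s / (\<Prod>t\<in>S - {s}. s - t))"

lemma divided_diff_singleton [simp]: "divided_diff f {a} = f a"
  by (simp add: divided_diff_def)

text \<open>Term by term this is the partial fraction decomposition of
  \<open>1 / ((s - a) * (s - b))\<close>.\<close>

lemma divided_diff_recursion:
  assumes S: "finite S" "a \<notin> S" "b \<notin> S" "a \<noteq> b"
  shows "divided_diff f (insert a (insert b S)) * (b - a) = divided_diff f (insert b S) - divided_diff f (insert a S)"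
proof -
  let ?p = "\<lambda>s. \<Prod>t\<in>S - {s}. s - t" and ?q = "\<lambda>s. \<Prod>t\<in>S. s - t"
  have nz: "?q a \<noteq> 0" "?q b \<noteq> 0" "?p s \<noteq> 0" for s using S by auto
  have 1: "divided_diff f (insert a (insert b S)) =
    f a / ((a - b) * ?q a) + f b / ((b - a) * ?q b) + (\<Sum>s\<in>S. f s / ((s - a) * ((s - b) * ?p s)))"
  proof -
    have "insert a (insert b S) - {a} = insert b S" "insert a (insert b S) - {b} = insert a S" using S by auto
    moreover have "(\<Sum>s\<in>S. f s / (\<Prod>t\<in>insert a (insert b S) - {s}. s - t)) = (\<Sum>s\<in>S. f s / ((s - a) * ((s - b) * ?p s)))"
    proof (rule sum.cong[OF refl])
      fix s assume "s \<in> S"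
      then have "insert a (insert b S) - {s} = insert a (insert b (S - {s}))" using S by auto
      then show "f s / (\<Prod>t\<in>insert a (insert b S) - {s}. s - t) = f s / ((s - a) * ((s - b) * ?p s))"
        using S by simp
    qed
    ultimately show ?thesis using S by (simp add: divided_diff_def)
  qed
  have 2: "divided_diff f (insert c S) = f c / ?q c + (\<Sum>s\<in>S. f s / ((s - c) * ?p s))" if "c \<notin> S" for c
  proof -
    have "(\<Sum>s\<in>S. f s / (\<Prod>t\<in>insert c S - {s}. s - t)) = (\<Sum>s\<in>S. f s / ((s - c) * ?p s))"
    proof (rule sum.cong[OF refl])
      fix s assume "s \<in> S"
      then have "insert c S - {s} = insert c (S - {s})" using that by auto
      then show "f s / (\<Prod>t\<in>insert c S - {s}. s - t) = f s / ((s - c) * ?p s)"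
        using S that by simp
    qed
    then show ?thesis using S that by (simp add: divided_diff_def)
  qed
  have 3: "(\<Sum>s\<in>S. f s / ((s - a) * ((s - b) * ?p s))) * (b - a) =
    (\<Sum>s\<in>S. f s / ((s - b) * ?p s)) - (\<Sum>s\<in>S. f s / ((s - a) * ?p s))"
    unfolding sum_distrib_right sum_subtractf[symmetric]
  proof (rule sum.cong[OF refl])
    fix s assume "s \<in> S"
    then have "s - a \<noteq> 0" "s - b \<noteq> 0" using S by auto
    then have "f s / ((s - a) * ((s - b) * p)) * (b - a) = f s / ((s - b) * p) - f s / ((s - a) * p)"
      if "p \<noteq> 0" for p using that by (simp add: divide_simps) (simp add: algebra_simps)
    then show "f s / ((s - a) * ((s - b) * ?p s)) * (b - a) = f s / ((s - b) * ?p s) - f s / ((s - a) * ?p s)"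
      using nz(3) by blast
  qed
  have "(x / ((a - b) * p) + y / ((b - a) * q)) * (b - a) = y / q - x / p" if "p \<noteq> 0" "q \<noteq> 0" for x y p q
    using that S(4) by (simp add: divide_simps) (simp add: algebra_simps)
  then show ?thesis
    unfolding 1 2[OF S(2)] 2[OF S(3)] using 3 nz by (simp add: distrib_right)
qed

lemma Delta_iter_eq_divided_diff:
  "inj_on z {..k} \<Longrightarrow> Delta_iter k f z = divided_diff f (z ` {..k})"
proof (induction k arbitrary: z)
  case (Suc k)
  let ?S = "z ` {1..k}"
  have "Delta_iter k f (\<lambda>i\<in>{..<Suc k}. z (Suc i)) = divided_diff f ((\<lambda>i\<in>{..<Suc k}. z (Suc i)) ` {..k})"
    using Suc.prems by (intro Suc.IH) (auto simp: inj_on_def)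
  also have "(\<lambda>i\<in>{..<Suc k}. z (Suc i)) ` {..k} = z ` Suc ` {..k}"
    unfolding image_image by (intro image_cong) auto
  also have "z ` Suc ` {..k} = insert (z (Suc k)) ?S"
    by (simp add: image_Suc_atMost atLeastAtMostSuc_conv)
  finally have 1: "Delta_iter k f (\<lambda>i\<in>{..<Suc k}. z (Suc i)) = divided_diff f (insert (z (Suc k)) ?S)" .
  have "Delta_iter k f (\<lambda>i\<in>{..<Suc k}. z i) = divided_diff f ((\<lambda>i\<in>{..<Suc k}. z i) ` {..k})"
    using Suc.prems by (intro Suc.IH) (auto simp: inj_on_def)
  also have "(\<lambda>i\<in>{..<Suc k}. z i) ` {..k} = z ` {..k}"
    by (intro image_cong) auto
  also have "{..k} = insert 0 {1..k}" by auto
  finally have 2: "Delta_iter k f (\<lambda>i\<in>{..<Suc k}. z i) = divided_diff f (insert (z 0) ?S)"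
    unfolding image_insert .
  have ne: "z 0 \<notin> ?S" "z (Suc k) \<notin> ?S" "z 0 \<noteq> z (Suc k)"
    using inj_onD[OF Suc.prems, of 0] inj_onD[OF Suc.prems, of "Suc k"] by force+
  have "{..Suc k} = insert 0 (insert (Suc k) {1..k})" by auto
  then have img: "z ` {..Suc k} = insert (z 0) (insert (z (Suc k)) ?S)" by simp
  have "Delta_iter (Suc k) f z = (divided_diff f (insert (z (Suc k)) ?S) - divided_diff f (insert (z 0) ?S)) / (z (Suc k) - z 0)"
    by (simp add: Delta_def 1 2)
  also have "\<dots> = divided_diff f (z ` {..Suc k})"
    unfolding img using divided_diff_recursion[of ?S "z 0" "z (Suc k)" f] ne by (simp add: field_simps)
  finally show ?case .
qed (simp add: divided_diff_def)

lemma newton_remainder: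
  fixes x :: "nat \<Rightarrow> complex"
  assumes "inj_on x {..<m}" "t \<notin> x ` {..<m}"
  shows "f t = (\<Sum>k<m. divided_diff f (x ` {..k}) * (\<Prod>j<k. t - x j))
    + divided_diff f (insert t (x ` {..<m})) * (\<Prod>j<m. t - x j)"
  using assms
proof (induction m)
  case (Suc m)
  let ?S = "x ` {..<m}"
  have "inj_on x {..<m}" "t \<notin> ?S" "t \<noteq> x m" "x m \<notin> ?S" using Suc.prems by (auto simp: inj_on_def lessThan_Suc)
  moreover have "divided_diff f (insert t ?S) = divided_diff f (x ` {..m}) + divided_diff f (insert t (x ` {..<Suc m})) * (t - x m)"
    using divided_diff_recursion[of ?S "x m" t f] calculation
    by (simp add: lessThan_Suc insert_commute lessThan_Suc_atMost[symmetric])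
  ultimately have eq: "divided_diff f (insert t ?S) = divided_diff f (x ` {..m}) + divided_diff f (insert t (x ` {..<Suc m})) * (t - x m)"
    and ft: "f t = (\<Sum>k<m. divided_diff f (x ` {..k}) * (\<Prod>j<k. t - x j)) + divided_diff f (insert t ?S) * (\<Prod>j<m. t - x j)"
    using Suc.IH by blast+
  show ?case unfolding ft eq by (simp add: algebra_simps)
qed simp

text \<open>At the node \<open>x i\<close> all terms beyond \<open>k = i\<close> vanish, and the
  term \<open>k = i\<close> is the remainder of Newton's formula with the nodes before
  \<open>x i\<close>.\<close>

lemma newton_interpolation:
  fixes x :: "nat \<Rightarrow> complex"
  assumes "inj_on x {..<n}" "i < n"
  shows "(\<Sum>k<n. divided_diff f (x ` {..k}) * (\<Prod>j<k. x i - x j)) = f (x i)"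
proof -
  have zero: "(\<Prod>j<k. x i - x j) = 0" if "i < k" for k using that by (intro prod_zero) auto
  have "(\<Sum>k<n. divided_diff f (x ` {..k}) * (\<Prod>j<k. x i - x j)) = (\<Sum>k<Suc i. divided_diff f (x ` {..k}) * (\<Prod>j<k. x i - x j))"
    using assms(2) by (intro sum.mono_neutral_right) (auto simp: zero)
  moreover have "f (x i) = (\<Sum>k<i. divided_diff f (x ` {..k}) * (\<Prod>j<k. x i - x j))
    + divided_diff f (insert (x i) (x ` {..<i})) * (\<Prod>j<i. x i - x j)"
  proof (rule newton_remainder)
    show "inj_on x {..<i}" using assms by (auto intro: inj_on_subset)
    show "x i \<notin> x ` {..<i}"
    proof
      assume "x i \<in> x ` {..<i}"
      then obtain j where "j < i" "x i = x j" by auto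
      then show False using inj_onD[OF assms(1), of i j] assms(2) by simp
    qed
  qed
  moreover have "insert (x i) (x ` {..<i}) = x ` {..i}" by (auto simp: lessThan_Suc_atMost[symmetric] lessThan_Suc)
  ultimately show ?thesis by simp
qed

text \<open>Coefficients and nodes are separate arguments because in the limit nodes may coincide,
  where the coefficients are limits of divided differences. Reversing the list makes the newest node
  the rightmost factor.\<close>

definition newton_matrix :: "(nat \<Rightarrow> complex) \<Rightarrow> (nat \<Rightarrow> complex) \<Rightarrow> complex^'n^'n \<Rightarrow> complex^'n^'n" where
  "newton_matrix c x A = (\<Sum>k<CARD('n). mat (c k) ** shifted_prod A (map x (rev [0..<k])))"

lemma newton_matrix_interpolation:
  fixes w :: "'n::finite \<Rightarrow> complex"
  assumes P: "invertible P" and w: "inj w" "\<And>i. x (tuple_index i) = w i"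
  shows "newton_matrix (\<lambda>k. divided_diff f (x ` {..k})) x (conj_by P (diag_mat w)) = conj_by P (diag_mat (f \<circ> w))"
proof -
  have inj: "inj_on x {..<CARD('n)}"
  proof (rule inj_onI)
    fix p q assume "p \<in> {..<CARD('n)}" "q \<in> {..<CARD('n)}" "x p = x q"
    then show "p = q"
      using w(2)[of "inv tuple_index p"] w(2)[of "inv tuple_index q"] injD[OF w(1)]
      by (metis lessThan_iff tuple_index_inv)
  qed
  have sum_mat: "(\<Sum>k\<in>J. mat (c k) ** diag_mat (d k)) = diag_mat (\<lambda>i. \<Sum>k\<in>J. c k * d k i)" for J :: "nat set" and c d
    by (auto simp: vec_eq_iff sum_component mat_mult_nth diag_mat_nth)
  have list: "(\<Prod>a\<leftarrow>map x (rev [0..<k]). c - a) = (\<Prod>j<k. c - x j)" for c k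
    by (induction k) (simp_all add: mult.commute)
  have "newton_matrix (\<lambda>k. divided_diff f (x ` {..k})) x (conj_by P (diag_mat w)) =
    conj_by P (diag_mat (\<lambda>i. \<Sum>k<CARD('n). divided_diff f (x ` {..k}) * (\<Prod>j<k. w i - x j)))"
    unfolding newton_matrix_def shifted_prod_conj_by[OF P] shifted_prod_diag list
    by (simp add: conj_by_sum[symmetric] conj_by_mat_mult[symmetric] sum_mat)
  also have "(\<lambda>i. \<Sum>k<CARD('n). divided_diff f (x ` {..k}) * (\<Prod>j<k. w i - x j)) = f \<circ> w"
    using newton_interpolation[OF inj tuple_index_less] by (auto simp: fun_eq_iff w(2))
  finally show ?thesis .
qed

section \<open>Limits of divided differences\<close>

lemma limit_at_diagonal_iff:
  fixes g :: "(nat \<Rightarrow> complex) \<Rightarrow> complex"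
  assumes z: "z \<in> X" and m: "2 \<le> m"
  shows "(g \<longlongrightarrow> L) (atin_within (tuple_space m X) (\<lambda>i\<in>{..<m}. z) (configurations m X)) \<longleftrightarrow>
    (\<forall>\<epsilon>>0. \<exists>\<delta>>0. \<forall>x\<in>configurations m X. (\<forall>i<m. dist (x i) z < \<delta>) \<longrightarrow> dist (g x) L < \<epsilon>)"
proof -
  let ?d = "\<lambda>i\<in>{..<m}. z" and ?T = "tuple_space m X"
  have d: "?d \<in> topspace ?T" using z by (auto simp: topspace_tuple_space)
  \<comment> \<open>A constant tuple of length at least 2 is not a configuration, so puncturing its
    neighbourhoods removes nothing.\<close>
  have ne: "x \<noteq> ?d" if "x \<in> configurations m X" for x
  proof
    assume "x = ?d"
    then have "x 0 = x 1" using m by simp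
    then show False using that m inj_onD[of x "{..<m}" 0 1] by (auto simp: configurations_iff)
  qed
  have "eventually P (atin_within ?T ?d (configurations m X)) \<longleftrightarrow>
    (\<exists>\<delta>>0. \<forall>x\<in>configurations m X. (\<forall>i<m. dist (x i) z < \<delta>) \<longrightarrow> P x)" for P
  proof
    assume "eventually P (atin_within ?T ?d (configurations m X))"
    then obtain U where U: "openin ?T U" "?d \<in> U" "\<And>x. x \<in> U \<Longrightarrow> x \<in> configurations m X \<Longrightarrow> x \<noteq> ?d \<Longrightarrow> P x"
      using d unfolding eventually_atin_within by blast
    obtain V where V0: "\<forall>i\<in>{..<m}. openin (top_of_set X) (V i)"
      and V: "?d \<in> Pi\<^sub>E {..<m} V" "Pi\<^sub>E {..<m} V \<subseteq> U"
      using U(1)[unfolded tuple_space_def openin_product_topology_alt, rule_format, OF U(2)] by blast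
    have "\<exists>\<delta>>0. \<forall>c\<in>X. dist c z < \<delta> \<longrightarrow> c \<in> V i" if "i < m" for i
    proof -
      have "z \<in> V i" using PiE_mem[OF V(1), of i] that by simp
      then show ?thesis using V0 that unfolding openin_euclidean_subtopology_iff by blast
    qed
    then obtain \<delta> where \<delta>: "\<And>i. i < m \<Longrightarrow> \<delta> i > 0" "\<And>i c. i < m \<Longrightarrow> c \<in> X \<Longrightarrow> dist c z < \<delta> i \<Longrightarrow> c \<in> V i"
      by metis
    define \<epsilon> where "\<epsilon> = Min (\<delta> ` {..<m})"
    have \<epsilon>: "\<epsilon> > 0" "\<And>i. i < m \<Longrightarrow> \<epsilon> \<le> \<delta> i"
      using m \<delta>(1) unfolding \<epsilon>_def by (auto simp: Min_gr_iff lessThan_empty_iff)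
    have "P x" if x: "x \<in> configurations m X" "\<forall>i<m. dist (x i) z < \<epsilon>" for x
    proof (rule U(3)[OF _ x(1) ne[OF x(1)]])
      have xe: "x \<in> {..<m} \<rightarrow>\<^sub>E X" using x(1) by (simp add: configurations_iff)
      have "x i \<in> V i" if "i < m" for i
        using \<delta>(2)[OF that] PiE_mem[OF xe, of i] x(2) \<epsilon>(2)[OF that] that by force
      then have "x \<in> Pi\<^sub>E {..<m} V" using xe by (auto simp: PiE_iff)
      then show "x \<in> U" using V(2) by blast
    qed
    then show "\<exists>\<delta>>0. \<forall>x\<in>configurations m X. (\<forall>i<m. dist (x i) z < \<delta>) \<longrightarrow> P x" using \<epsilon>(1) by blast
  next
    assume "\<exists>\<delta>>0. \<forall>x\<in>configurations m X. (\<forall>i<m. dist (x i) z < \<delta>) \<longrightarrow> P x"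
    then obtain \<delta> where \<delta>: "\<delta> > 0" "\<And>x. x \<in> configurations m X \<Longrightarrow> (\<And>i. i < m \<Longrightarrow> dist (x i) z < \<delta>) \<Longrightarrow> P x" by blast
    let ?U = "Pi\<^sub>E {..<m} (\<lambda>i. X \<inter> ball z \<delta>)"
    have "openin ?T ?U"
      unfolding tuple_space_def by (auto simp: openin_PiE_gen intro: openin_open_Int)
    moreover have "?d \<in> ?U" using z \<delta>(1) by auto
    moreover have "P x" if "x \<in> ?U" "x \<in> configurations m X" for x
      using \<delta>(2)[OF that(2)] PiE_mem[OF that(1)] by (auto simp: dist_commute)
    ultimately show "eventually P (atin_within ?T ?d (configurations m X))"
      unfolding eventually_atin_within by blast
  qed
  then show ?thesis by (simp add: tendsto_iff)
qed

text \<open>Existence of the limit at the diagonal point over \<open>z\<close>, in Cauchy form, so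
  that no limit value has to be carried through the descent to lower orders.\<close>

definition dd_cauchy :: "(complex \<Rightarrow> complex) \<Rightarrow> complex set \<Rightarrow> complex \<Rightarrow> nat \<Rightarrow> bool" where
  "dd_cauchy f X z m \<longleftrightarrow> (\<forall>\<epsilon>>0. \<exists>\<delta>>0. \<forall>S S'. S \<subseteq> X \<inter> ball z \<delta> \<longrightarrow> S' \<subseteq> X \<inter> ball z \<delta> \<longrightarrow>
     card S = m \<longrightarrow> card S' = m \<longrightarrow> dist (divided_diff f S) (divided_diff f S') < \<epsilon>)"

lemma C_Delta_imp_dd_cauchy:
  assumes C: "C_Delta k X f" and k: "1 \<le> k" and z: "z \<in> X" "z islimpt X"
  shows "dd_cauchy f X z (Suc k)"
  unfolding dd_cauchy_def
proof (intro allI impI)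
  fix \<epsilon> :: real assume "\<epsilon> > 0"
  obtain L where "(Delta_iter k f \<longlongrightarrow> L) (atin_within (tuple_space (Suc k) X) (\<lambda>i\<in>{..<Suc k}. z) (configurations (Suc k) X))"
    using C z unfolding C_Delta_def by blast
  then obtain \<delta> where \<delta>: "\<delta> > 0" "\<And>x. x \<in> configurations (Suc k) X \<Longrightarrow> \<forall>i<Suc k. dist (x i) z < \<delta> \<Longrightarrow>
      dist (Delta_iter k f x) L < \<epsilon> / 2"
    using limit_at_diagonal_iff[OF z(1), of "Suc k" "Delta_iter k f" L] k \<open>\<epsilon> > 0\<close>
    by (metis Suc_le_mono numeral_2_eq_2 One_nat_def half_gt_zero)
  have *: "dist (divided_diff f S) L < \<epsilon> / 2" if S: "S \<subseteq> X \<inter> ball z \<delta>" "card S = Suc k" for S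
  proof -
    have "finite S" using S(2) card.infinite by fastforce
    then obtain h where h: "bij_betw h {0..<Suc k} S" using ex_bij_betw_nat_finite[of S] S(2) by auto
    define x where "x = (\<lambda>i\<in>{..<Suc k}. h i)"
    have bij: "bij_betw x {..<Suc k} S"
      using h unfolding x_def lessThan_atLeast0 by (subst bij_betw_cong[of _ _ h]) auto
    then have x: "x ` {..<Suc k} = S" "inj_on x {..<Suc k}" by (auto simp: bij_betw_def)
    have xX: "x i \<in> X \<inter> ball z \<delta>" if "i < Suc k" for i using x(1) S(1) that by blast
    then have "x \<in> configurations (Suc k) X"
      using x(2) by (auto simp: configurations_iff x_def)
    moreover have "\<forall>i<Suc k. dist (x i) z < \<delta>" using xX by (auto simp: dist_commute)
    ultimately have "dist (Delta_iter k f x) L < \<epsilon> / 2" by (rule \<delta>(2))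
    moreover have "Delta_iter k f x = divided_diff f S"
      using Delta_iter_eq_divided_diff[of x k f] x by (simp add: lessThan_Suc_atMost)
    ultimately show ?thesis by simp
  qed
  have "dist (divided_diff f S) (divided_diff f S') < \<epsilon>"
    if "S \<subseteq> X \<inter> ball z \<delta>" "S' \<subseteq> X \<inter> ball z \<delta>" "card S = Suc k" "card S' = Suc k" for S S'
    using *[OF that(1,3)] *[OF that(2,4)] dist_triangle_half_l by (metis dist_commute)
  then show "\<exists>\<delta>>0. \<forall>S S'. S \<subseteq> X \<inter> ball z \<delta> \<longrightarrow> S' \<subseteq> X \<inter> ball z \<delta> \<longrightarrow>
     card S = Suc k \<longrightarrow> card S' = Suc k \<longrightarrow> dist (divided_diff f S) (divided_diff f S') < \<epsilon>"
    using \<delta>(1) by blast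
qed

text \<open>Exchanging the nodes one at a time costs a divided difference of the next order times
  the distance of the exchanged nodes.\<close>

lemma divided_diff_exchange:
  fixes B d :: real
  assumes bound: "\<And>S. S \<subseteq> Y \<Longrightarrow> card S = Suc m \<Longrightarrow> norm (divided_diff f S) \<le> B"
    and diam: "\<And>a b. a \<in> Y \<Longrightarrow> b \<in> Y \<Longrightarrow> norm (b - a) \<le> d"
    and fin: "finite A" "finite R" and sub: "A \<subseteq> Y" "A' \<subseteq> Y" "R \<subseteq> Y"
    and disj: "A \<inter> A' = {}" "A \<inter> R = {}" "A' \<inter> R = {}" and card: "card A' = card A" "card A + card R = m"
    and A': "finite A'" and pos: "0 \<le> B" "0 \<le> d"
  shows "norm (divided_diff f (A \<union> R) - divided_diff f (A' \<union> R)) \<le> real (card A) * (B * d)"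
  using fin sub disj card A'
proof (induction A arbitrary: A' R)
  case empty
  then show ?case by simp
next
  case (insert a A)
  then obtain b B' where B': "A' = insert b B'" "b \<notin> B'"
    by (metis card.empty card_0_eq card_Suc_eq card_insert_disjoint)
  have IH: "norm (divided_diff f (A \<union> insert a R) - divided_diff f (B' \<union> insert a R)) \<le> real (card A) * (B * d)"
    using insert.prems insert.hyps B' by (intro insert.IH) auto
  let ?S = "B' \<union> R"
  have ab: "a \<notin> ?S" "b \<notin> ?S" "a \<noteq> b" "finite ?S" using insert.prems insert.hyps B' by auto
  have cS: "card ?S + 1 = m"
    using insert.prems insert.hyps B' by (subst card_Un_disjoint) auto
  have "card (insert a (insert b ?S)) = Suc m" using ab cS by simp
  moreover have "insert a (insert b ?S) \<subseteq> Y" using insert.prems B' by auto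
  ultimately have "norm (divided_diff f (insert a (insert b ?S))) \<le> B" by (intro bound)
  moreover have "norm (b - a) \<le> d" using insert.prems B' by (intro diam) auto
  ultimately have "norm (divided_diff f (insert a (insert b ?S)) * (b - a)) \<le> B * d"
    unfolding norm_mult using pos by (intro mult_mono) auto
  then have "norm (divided_diff f (insert b ?S) - divided_diff f (insert a ?S)) \<le> B * d"
    using divided_diff_recursion[of ?S a b f] ab by simp
  then have "norm (divided_diff f (B' \<union> insert a R) - divided_diff f (A' \<union> R)) \<le> B * d"
    unfolding B'(1) by (simp add: norm_minus_commute)
  then have "norm (divided_diff f (A \<union> insert a R) - divided_diff f (A' \<union> R)) \<le> real (card A) * (B * d) + B * d"
    using IH norm_triangle_ineq[of "divided_diff f (A \<union> insert a R) - divided_diff f (B' \<union> insert a R)"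
        "divided_diff f (B' \<union> insert a R) - divided_diff f (A' \<union> R)"] by simp
  then show ?case using insert.hyps by (simp add: algebra_simps)
qed

text \<open>The Cauchy condition bounds the differences of order one higher near \<open>z\<close>;
  then trading all \<open>m\<close> nodes within a small ball changes the value by a multiple of the
  radius.\<close>

lemma dd_cauchy_Suc:
  assumes c: "dd_cauchy f X z (Suc m)" and m: "1 \<le> m" and z: "z islimpt X"
  shows "dd_cauchy f X z m"
proof -
  obtain \<delta>0 where \<delta>0: "\<delta>0 > 0" "\<And>S S'. S \<subseteq> X \<inter> ball z \<delta>0 \<Longrightarrow> S' \<subseteq> X \<inter> ball z \<delta>0 \<Longrightarrow>
     card S = Suc m \<Longrightarrow> card S' = Suc m \<Longrightarrow> dist (divided_diff f S) (divided_diff f S') < 1"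
    using c unfolding dd_cauchy_def by (meson zero_less_one)
  obtain B where B: "B > 0" "\<And>S. S \<subseteq> X \<inter> ball z \<delta>0 \<Longrightarrow> card S = Suc m \<Longrightarrow> norm (divided_diff f S) \<le> B"
  proof (cases "\<exists>S0. S0 \<subseteq> X \<inter> ball z \<delta>0 \<and> card S0 = Suc m")
    case True
    then obtain S0 where S0: "S0 \<subseteq> X \<inter> ball z \<delta>0" "card S0 = Suc m" by blast
    show ?thesis
    proof (rule that[of "norm (divided_diff f S0) + 1"])
      show "norm (divided_diff f S) \<le> norm (divided_diff f S0) + 1" if "S \<subseteq> X \<inter> ball z \<delta>0" "card S = Suc m" for S
        using \<delta>0(2)[OF that(1) S0(1) that(2) S0(2)] norm_triangle_ineq2[of "divided_diff f S" "divided_diff f S0"]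
        by (simp add: dist_norm)
    qed (simp add: add_nonneg_pos)
  next
    case False
    then show ?thesis using that[of 1] by auto
  qed
  show ?thesis
    unfolding dd_cauchy_def
  proof (intro allI impI)
    fix \<epsilon> :: real assume \<epsilon>: "\<epsilon> > 0"
    \<comment> \<open>The factor 8 makes the passage from a node set to \<open>W\<close> cost at
      most \<open>\<epsilon> / 4\<close>: there are \<open>m\<close> exchanges, each at most
      \<open>B\<close> times the diameter bound \<open>2 * \<delta>\<close>.\<close>
    define \<delta> where "\<delta> = min \<delta>0 (\<epsilon> / (8 * m * B))"
    have \<delta>: "\<delta> > 0" "\<delta> \<le> \<delta>0" "\<delta> \<le> \<epsilon> / (8 * m * B)" using \<delta>0(1) \<epsilon> B(1) m by (auto simp: \<delta>_def)
    let ?Y = "X \<inter> ball z \<delta>"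
    have Y: "?Y \<subseteq> X \<inter> ball z \<delta>0" using \<delta>(2) by auto
    have diam: "norm (b - a) \<le> 2 * \<delta>" if "a \<in> ?Y" "b \<in> ?Y" for a b
      using that dist_triangle2[of b a z] by (auto simp: dist_norm norm_minus_commute)
    have le: "m * (B * (2 * \<delta>)) \<le> \<epsilon> / 4"
      using \<delta>(3) B(1) m by (simp add: field_simps)
    have inf: "infinite ?Y" using z \<delta>(1) by (auto simp: islimpt_eq_infinite_ball)
    have "dist (divided_diff f S) (divided_diff f S') < \<epsilon>"
      if S: "S \<subseteq> ?Y" "S' \<subseteq> ?Y" "card S = m" "card S' = m" for S S'
    proof -
      have fin: "finite S" "finite S'" using S m card.infinite by fastforce+
      then have "infinite (?Y - (S \<union> S'))" using inf by simp
      \<comment> \<open>The exchange argument wants disjoint node sets, while \<open>S\<close> and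
        \<open>S'\<close> may meet; both are compared with a third set.\<close>
      then obtain W where W: "finite W" "card W = m" "W \<subseteq> ?Y - (S \<union> S')"
        using infinite_arbitrarily_large by blast
      have *: "norm (divided_diff f T - divided_diff f W) \<le> \<epsilon> / 4" if "T = S \<or> T = S'" for T
      proof -
        have "norm (divided_diff f (T \<union> {}) - divided_diff f (W \<union> {})) \<le> real (card T) * (B * (2 * \<delta>))"
        proof (rule divided_diff_exchange[where Y="?Y" and m=m])
          show "norm (divided_diff f R) \<le> B" if "R \<subseteq> ?Y" "card R = Suc m" for R
            using B(2)[OF order_trans[OF that(1) Y] that(2)] .
          show "norm (b - a) \<le> 2 * \<delta>" if "a \<in> ?Y" "b \<in> ?Y" for a b using diam that .
        qed (use \<open>T = S \<or> T = S'\<close> S W fin B(1) \<delta>(1) in auto)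
        then show ?thesis using le that S by auto
      qed
      have "norm (divided_diff f S - divided_diff f S') \<le> \<epsilon> / 4 + \<epsilon> / 4"
        using *[of S] *[of S'] norm_triangle_ineq4[of "divided_diff f S - divided_diff f W" "divided_diff f S' - divided_diff f W"]
        by simp
      then show ?thesis using \<epsilon> by (simp add: dist_norm)
    qed
    then show "\<exists>\<delta>>0. \<forall>S S'. S \<subseteq> X \<inter> ball z \<delta> \<longrightarrow> S' \<subseteq> X \<inter> ball z \<delta> \<longrightarrow>
       card S = m \<longrightarrow> card S' = m \<longrightarrow> dist (divided_diff f S) (divided_diff f S') < \<epsilon>"
      using \<delta>(1) by blast
  qed
qed

lemma dd_cauchy_le:
  assumes "dd_cauchy f X z n" "z islimpt X" "1 \<le> m" "m \<le> n"
  shows "dd_cauchy f X z m"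
  using assms(4,1)
proof (induction rule: inc_induct)
  case (step k)
  then show ?case using dd_cauchy_Suc assms by (metis le_trans)
qed

text \<open>Where all nodes tend to one point the Cauchy condition applies. Otherwise two nodes have
  different limits, and the recursion along them reduces the number of nodes with a denominator that
  stays away from 0.\<close>

lemma divided_diff_convergent:
  fixes x :: "nat \<Rightarrow> nat \<Rightarrow> complex"
  assumes c: "\<And>z m. z \<in> X \<Longrightarrow> 1 \<le> m \<Longrightarrow> m \<le> n \<Longrightarrow> dd_cauchy f X z m"
    and I: "finite I" "I \<noteq> {}" "card I \<le> n" and y: "\<And>i. i \<in> I \<Longrightarrow> y i \<in> X"
    and x: "\<And>m. inj_on (x m) I" "\<And>m i. i \<in> I \<Longrightarrow> x m i \<in> X" "\<And>i. i \<in> I \<Longrightarrow> (\<lambda>m. x m i) \<longlonglongrightarrow> y i"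
  shows "convergent (\<lambda>m. divided_diff f (x m ` I))"
  using I y x
proof (induction "card I" arbitrary: I rule: less_induct)
  case less
  note I = less.prems(1-3) and y = less.prems(4) and x = less.prems(5-7)
  show ?case
  proof (cases "\<exists>a\<in>I. \<exists>b\<in>I. y a \<noteq> y b")
    case False
    then obtain z where z: "\<And>i. i \<in> I \<Longrightarrow> y i = z" using I(2) by blast
    have "z \<in> X" using z y I(2) by blast
    have "1 \<le> card I" using I(1,2) by (simp add: Suc_leI card_gt_0_iff)
    then have dd: "dd_cauchy f X z (card I)" using c \<open>z \<in> X\<close> I(3) by blast
    have "Cauchy (\<lambda>m. divided_diff f (x m ` I))"
    proof (rule metric_CauchyI)
      fix e :: real assume "e > 0"
      then obtain \<delta> where \<delta>: "\<delta> > 0" "\<And>S S'. S \<subseteq> X \<inter> ball z \<delta> \<Longrightarrow> S' \<subseteq> X \<inter> ball z \<delta> \<Longrightarrow>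
        card S = card I \<Longrightarrow> card S' = card I \<Longrightarrow> dist (divided_diff f S) (divided_diff f S') < e"
        using dd unfolding dd_cauchy_def by meson
      have "\<forall>\<^sub>F m in sequentially. \<forall>i\<in>I. dist (x m i) z < \<delta>"
        using I(1) x(3) z \<delta>(1) by (intro eventually_ball_finite ballI) (auto dest: tendstoD)
      then obtain M where M: "\<And>m i. m \<ge> M \<Longrightarrow> i \<in> I \<Longrightarrow> dist (x m i) z < \<delta>"
        unfolding eventually_sequentially by blast
      have "x m ` I \<subseteq> X \<inter> ball z \<delta>" "card (x m ` I) = card I" if "m \<ge> M" for m
        using M[OF that] x(1,2) by (auto simp: card_image dist_commute)
      then have "dist (divided_diff f (x m ` I)) (divided_diff f (x k ` I)) < e" if "m \<ge> M" "k \<ge> M" for m k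
        using that by (intro \<delta>(2))
      then show "\<exists>M. \<forall>m\<ge>M. \<forall>n\<ge>M. dist (divided_diff f (x m ` I)) (divided_diff f (x n ` I)) < e"
        by (intro exI[of _ M] allI impI)
    qed
    then show ?thesis by (rule Cauchy_convergent)
  next
    case True
    then obtain a b where ab: "a \<in> I" "b \<in> I" "y a \<noteq> y b" by blast
    then have "a \<noteq> b" by blast
    have *: "convergent (\<lambda>m. divided_diff f (x m ` (I - {d})))" if d: "d \<in> {a, b}" for d
    proof (rule less.hyps)
      show "card (I - {d}) < card I" using d ab I(1) by (intro psubset_card_mono) auto
      then show "card (I - {d}) \<le> n" using I(3) by simp
      show "I - {d} \<noteq> {}" using d ab \<open>a \<noteq> b\<close> by auto
      show "inj_on (x m) (I - {d})" for m using x(1)[of m] by (rule inj_on_subset) auto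
    qed (use I y x in auto)
    obtain la lb where l: "(\<lambda>m. divided_diff f (x m ` (I - {a}))) \<longlonglongrightarrow> la" "(\<lambda>m. divided_diff f (x m ` (I - {b}))) \<longlonglongrightarrow> lb"
      using *[of a] *[of b] by (auto simp: convergent_def)
    have "divided_diff f (x m ` I) = (divided_diff f (x m ` (I - {a})) - divided_diff f (x m ` (I - {b}))) / (x m b - x m a)" for m
    proof -
      let ?S = "x m ` (I - {a, b})"
      have ne: "x m a \<notin> ?S" "x m b \<notin> ?S" "x m a \<noteq> x m b"
        using x(1)[of m] ab \<open>a \<noteq> b\<close> by (auto simp: inj_on_def)
      have "I = insert a (insert b (I - {a, b}))" "I - {a} = insert b (I - {a, b})" "I - {b} = insert a (I - {a, b})"
        using ab \<open>a \<noteq> b\<close> by auto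
      then have "x m ` I = insert (x m a) (insert (x m b) ?S)" "x m ` (I - {a}) = insert (x m b) ?S" "x m ` (I - {b}) = insert (x m a) ?S"
        by (metis image_insert)+
      then show ?thesis
        using divided_diff_recursion[of ?S "x m a" "x m b" f] ne I(1) by (simp add: field_simps)
    qed
    moreover have "(\<lambda>m. (divided_diff f (x m ` (I - {a})) - divided_diff f (x m ` (I - {b}))) / (x m b - x m a)) \<longlonglongrightarrow> (la - lb) / (y b - y a)"
      using ab by (intro tendsto_intros l x(3)) auto
    ultimately show ?thesis by (auto simp: convergent_def)
  qed
qed

text \<open>Any two admissible sequences of nodes can be interleaved into a third, whose convergence
  forces equal limits. Hence the limit depends only on \<open>y\<close>.\<close>

lemma divided_diff_limit:
  assumes c: "\<And>z m. z \<in> X \<Longrightarrow> 1 \<le> m \<Longrightarrow> m \<le> n \<Longrightarrow> dd_cauchy f X z m"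
    and I: "finite I" "I \<noteq> {}" "card I \<le> n" and y: "\<And>i. i \<in> I \<Longrightarrow> y i \<in> X"
  shows "\<exists>l. \<forall>x :: nat \<Rightarrow> nat \<Rightarrow> complex. (\<forall>m. inj_on (x m) I) \<longrightarrow> (\<forall>m. \<forall>i\<in>I. x m i \<in> X) \<longrightarrow>
    (\<forall>i\<in>I. (\<lambda>m. x m i) \<longlonglongrightarrow> y i) \<longrightarrow> (\<lambda>m. divided_diff f (x m ` I)) \<longlonglongrightarrow> l"
proof -
  define admissible where "admissible x \<longleftrightarrow> (\<forall>m. inj_on (x m) I) \<and> (\<forall>m. \<forall>i\<in>I. x m i \<in> X) \<and>
    (\<forall>i\<in>I. (\<lambda>m. x m i) \<longlonglongrightarrow> y i)" for x :: "nat \<Rightarrow> nat \<Rightarrow> complex"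
  have conv: "convergent (\<lambda>m. divided_diff f (x m ` I))" if "admissible x" for x
    using that unfolding admissible_def by (intro divided_diff_convergent[OF c I y]) auto
  have "\<exists>l. \<forall>x. admissible x \<longrightarrow> (\<lambda>m. divided_diff f (x m ` I)) \<longlonglongrightarrow> l"
  proof (cases "\<exists>x. admissible x")
    case True
    then obtain x0 where x0: "admissible x0" by blast
    then obtain l where l: "(\<lambda>m. divided_diff f (x0 m ` I)) \<longlonglongrightarrow> l" using conv by (auto simp: convergent_def)
    have "(\<lambda>m. divided_diff f (x m ` I)) \<longlonglongrightarrow> l" if x: "admissible x" for x
    proof -
      \<comment> \<open>Even positions follow \<open>x\<close> and odd positions follow
        \<open>x0\<close>.\<close>
      define u where "u m = (if even m then x (m div 2) else x0 (m div 2))" for m :: nat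
      have "admissible u"
        unfolding admissible_def
      proof (intro conjI allI ballI)
        show "inj_on (u m) I" for m using x x0 by (simp add: u_def admissible_def)
        show "u m i \<in> X" if "i \<in> I" for m i using x x0 that by (simp add: u_def admissible_def)
        fix i assume "i \<in> I"
        then have lim: "(\<lambda>m. x m i) \<longlonglongrightarrow> y i" "(\<lambda>m. x0 m i) \<longlonglongrightarrow> y i" using x x0 by (auto simp: admissible_def)
        show "(\<lambda>m. u m i) \<longlonglongrightarrow> y i"
          unfolding LIMSEQ_def
        proof (intro allI impI)
          fix r :: real assume "r > 0"
          then obtain N1 N2 where N: "\<And>m. m \<ge> N1 \<Longrightarrow> dist (x m i) (y i) < r" "\<And>m. m \<ge> N2 \<Longrightarrow> dist (x0 m i) (y i) < r"
            using lim unfolding LIMSEQ_def by meson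
          have "dist (u m i) (y i) < r" if "m \<ge> 2 * (N1 + N2)" for m
            using N(1)[of "m div 2"] N(2)[of "m div 2"] that by (simp add: u_def)
          then show "\<exists>no. \<forall>m\<ge>no. dist (u m i) (y i) < r" by blast
        qed
      qed
      then obtain l' where l': "(\<lambda>m. divided_diff f (u m ` I)) \<longlonglongrightarrow> l'" using conv by (auto simp: convergent_def)
      have "(\<lambda>m. divided_diff f (u (2 * m) ` I)) \<longlonglongrightarrow> l'" "(\<lambda>m. divided_diff f (u (2 * m + 1) ` I)) \<longlonglongrightarrow> l'"
        using LIMSEQ_subseq_LIMSEQ[OF l', of "\<lambda>m. 2 * m"] LIMSEQ_subseq_LIMSEQ[OF l', of "\<lambda>m. 2 * m + 1"]
        by (auto simp: strict_mono_def o_def)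
      then have "(\<lambda>m. divided_diff f (x m ` I)) \<longlonglongrightarrow> l'" "(\<lambda>m. divided_diff f (x0 m ` I)) \<longlonglongrightarrow> l'"
        by (auto simp: u_def)
      then show ?thesis using LIMSEQ_unique[OF l] by blast
    qed
    then show ?thesis by blast
  qed blast
  then show ?thesis unfolding admissible_def by blast
qed

section \<open>Continuity of the functional calculus\<close>

text \<open>Specified only for diagonalizable \<open>B\<close>.\<close>

definition fun_calc :: "(complex \<Rightarrow> complex) \<Rightarrow> complex^'n^'n \<Rightarrow> complex^'n^'n" where
  "fun_calc f B = (SOME M. \<exists>P x. invertible P \<and> B = conj_by P (diag_mat x) \<and> M = conj_by P (diag_mat (f \<circ> x)))"

lemma fun_calc_conj_diag:
  assumes "invertible P"
  shows "fun_calc f (conj_by P (diag_mat x)) = conj_by P (diag_mat (f \<circ> x))"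
proof -
  let ?Q = "\<lambda>M. \<exists>R y. invertible R \<and> conj_by P (diag_mat x) = conj_by R (diag_mat y) \<and> M = conj_by R (diag_mat (f \<circ> y))"
  have "?Q (fun_calc f (conj_by P (diag_mat x)))"
    unfolding fun_calc_def by (rule someI_ex) (use assms in blast)
  then show ?thesis using functional_calculus_unique[OF assms] by metis
qed

section \<open>Limits of Newton polynomials in matrices\<close>

lemma tendsto_mat: "(c \<longlongrightarrow> l) F \<Longrightarrow> ((\<lambda>m. mat (c m) :: complex^'n^'n) \<longlongrightarrow> mat l) F"
  by (auto simp: tendsto_matrix_iff mat_def)

lemma tendsto_shifted_prod:
  "(A \<longlongrightarrow> B) F \<Longrightarrow> (\<And>k. k \<in> set ks \<Longrightarrow> ((\<lambda>m. x m k) \<longlongrightarrow> y k) F) \<Longrightarrow>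
    ((\<lambda>m. shifted_prod (A m) (map (x m) ks)) \<longlongrightarrow> shifted_prod B (map y ks)) F"
  by (induction ks) (auto intro!: tendsto_intros tendsto_mat)

lemma tendsto_newton_matrix:
  fixes A :: "'a \<Rightarrow> complex^'n^'n"
  assumes "(A \<longlongrightarrow> B) F" "\<And>k. k < CARD('n) \<Longrightarrow> ((\<lambda>m. x m k) \<longlongrightarrow> y k) F"
    "\<And>k. k < CARD('n) \<Longrightarrow> ((\<lambda>m. c m k) \<longlongrightarrow> l k) F"
  shows "((\<lambda>m. newton_matrix (c m) (x m) (A m)) \<longlongrightarrow> newton_matrix l y B) F"
  unfolding newton_matrix_def
  by (intro tendsto_sum tendsto_matrix_mult tendsto_mat tendsto_shifted_prod) (use assms in auto)

lemma newton_matrix_commute: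
  assumes "A ** B = B ** A"
  shows "newton_matrix c x A ** B = B ** newton_matrix c x A"
  unfolding newton_matrix_def matrix_sum_ldistrib matrix_sum_rdistrib
proof (rule sum.cong[OF refl])
  fix k
  have "mat (c k) ** S ** B = B ** (mat (c k) ** S)" if "S ** B = B ** S" for S :: "complex^'a^'a"
    using that by (metis matrix_mul_assoc matrix_mult_mat_commute)
  then show "mat (c k) ** shifted_prod A (map x (rev [0..<k])) ** B = B ** (mat (c k) ** shifted_prod A (map x (rev [0..<k])))"
    using shifted_prod_commute[OF assms] by blast
qed

lemma bounded_eigenvalues:
  fixes A :: "nat \<Rightarrow> complex^'n^'n" and x :: "nat \<Rightarrow> 'n \<Rightarrow> complex"
  assumes "A \<longlonglongrightarrow> B" "\<And>m. range (x m) \<subseteq> spectrum (A m)"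
  shows "bounded (range (\<lambda>m. \<chi> i. x m i))"
proof -
  have "convergent (\<lambda>m. \<Sum>i\<in>UNIV. \<Sum>j\<in>UNIV. norm (A m $ i $ j))"
    by (rule convergentI[of _ "\<Sum>i\<in>UNIV. \<Sum>j\<in>UNIV. norm (B $ i $ j)"]) (intro tendsto_sum tendsto_norm tendsto_vec_nth assms(1))
  then have "Bseq (\<lambda>m. \<Sum>i\<in>UNIV. \<Sum>j\<in>UNIV. norm (A m $ i $ j))" by (rule convergent_imp_Bseq)
  then obtain C where C: "\<And>m. norm (\<Sum>i\<in>UNIV. \<Sum>j\<in>UNIV. norm (A m $ i $ j)) \<le> C" by (auto simp: Bseq_def)
  have "norm (x m i) \<le> C" for m i
  proof -
    have "norm (x m i) \<le> (\<Sum>i\<in>UNIV. \<Sum>j\<in>UNIV. norm (A m $ i $ j))"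
      using assms(2)[of m] by (intro spectrum_bound) auto
    also have "\<dots> \<le> C" using C[of m] unfolding real_norm_def by (rule abs_le_D1)
    finally show ?thesis .
  qed
  then have "norm (\<chi> i. x m i) \<le> (\<Sum>i\<in>(UNIV :: 'n set). C)" for m
    unfolding norm_vec_def by (intro order_trans[OF L2_set_le_sum] sum_mono) auto
  then show ?thesis unfolding bounded_iff by blast
qed

text \<open>The candidate limit is Newton's polynomial with the eigenvalues of \<open>A\<close> as
  nodes, in a fixed order, and limits of divided differences as coefficients. Being a polynomial in
  \<open>A\<close>, it commutes with all that commutes with \<open>A\<close>; this later yields
  preservation of commutativity.\<close>

theorem functional_calculus_limit:
  fixes A :: "complex^'n^'n"
  assumes n: "2 \<le> CARD('n)" and X: "\<And>z. z \<in> X \<Longrightarrow> z islimpt X" and C: "C_Delta (CARD('n) - 1) X f"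
    and A: "A \<in> sigma_minus X"
  shows "\<exists>L. (\<forall>B. (\<forall>m. B m \<in> simple_matrices X) \<longrightarrow> B \<longlonglongrightarrow> A \<longrightarrow> (\<lambda>m. fun_calc f (B m)) \<longlonglongrightarrow> L) \<and>
    (\<forall>M. A ** M = M ** A \<longrightarrow> L ** M = M ** L)"
proof -
  have "dd_cauchy f X z CARD('n)" if "z \<in> X" for z
    using C_Delta_imp_dd_cauchy[OF C _ that X[OF that]] n by simp
  then have dd: "dd_cauchy f X z m" if "z \<in> X" "1 \<le> m" "m \<le> CARD('n)" for z m
    using dd_cauchy_le X that by blast
  obtain P0 U where P0: "invertible P0" and AU: "A = conj_by P0 U"
    and tri: "\<And>i j. tuple_index j < tuple_index i \<Longrightarrow> U $ i $ j = 0" using triangularize by blast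
  define y where "y i = U $ i $ i" for i
  have "spectrum A = range y"
    using spectrum_upper_triangular[OF inj_tuple_index tri] P0
    by (simp add: AU spectrum_conj_by y_def[abs_def])
  then have yX: "y i \<in> X" for i using A by (auto simp: sigma_minus_def)
  have detA: "det (A - mat t) = (\<Prod>i\<in>UNIV. y i - t)" for t
  proof -
    have "det (U - mat t) = (\<Prod>i\<in>UNIV. (U - mat t) $ i $ i)"
      by (rule det_upper_triangular[OF inj_tuple_index]) (auto simp: mat_def tri)
    also have "\<dots> = (\<Prod>i\<in>UNIV. y i - t)" by (simp add: y_def mat_def)
    finally show ?thesis using P0 by (simp add: AU det_conj_by_diff_mat)
  qed
  define yt where "yt k = y (inv tuple_index k)" for k
  have "\<exists>l. \<forall>x :: nat \<Rightarrow> nat \<Rightarrow> complex. (\<forall>m. inj_on (x m) {..k}) \<longrightarrow> (\<forall>m. \<forall>i\<in>{..k}. x m i \<in> X) \<longrightarrow>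
    (\<forall>i\<in>{..k}. (\<lambda>m. x m i) \<longlonglongrightarrow> yt i) \<longrightarrow> (\<lambda>m. divided_diff f (x m ` {..k})) \<longlonglongrightarrow> l" if "k < CARD('n)" for k
    by (rule divided_diff_limit[OF dd]) (use that yX in \<open>auto simp: yt_def\<close>)
  then obtain l where l: "\<And>k x. k < CARD('n) \<Longrightarrow> (\<And>m. inj_on (x m) {..k}) \<Longrightarrow> (\<And>m i. i \<le> k \<Longrightarrow> x m i \<in> X) \<Longrightarrow>
      (\<And>i. i \<le> k \<Longrightarrow> (\<lambda>m. x m i) \<longlonglongrightarrow> yt i) \<Longrightarrow> (\<lambda>m. divided_diff f (x m ` {..k :: nat})) \<longlonglongrightarrow> l k"
    by (metis atMost_iff)
  define L where "L = newton_matrix l yt A"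
  have sub: "\<exists>r :: nat \<Rightarrow> nat. strict_mono r \<and> (\<lambda>m. fun_calc f (B (r m))) \<longlonglongrightarrow> L"
    if B: "\<And>m. B m \<in> simple_matrices X" "B \<longlonglongrightarrow> A" for B
  proof -
    have "\<forall>m. \<exists>P w. invertible P \<and> inj w \<and> range w \<subseteq> X \<and> B m = conj_by P (diag_mat w)"
      using B(1) unfolding simple_matrices_def by blast
    then obtain P w where P: "\<And>m. invertible (P m)" and w: "\<And>m. inj (w m)" "\<And>m. range (w m) \<subseteq> X"
      and BP: "\<And>m. B m = conj_by (P m) (diag_mat (w m))" by metis
    have spec: "range (w m) = spectrum (B m)" for m using P by (simp add: BP spectrum_conj_by spectrum_diag)
    have "bounded (range (\<lambda>m. \<chi> i. w m i))" using bounded_eigenvalues[OF B(2)] spec by blast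
    then obtain v r where r: "strict_mono (r :: nat \<Rightarrow> nat)" and v: "((\<lambda>m. \<chi> i. w m i) \<circ> r) \<longlonglongrightarrow> v"
      using bounded_imp_convergent_subsequence by blast
    have wlim: "(\<lambda>m. w (r m) i) \<longlonglongrightarrow> v $ i" for i
      using tendsto_vec_nth[OF v, of i] by simp
    have Br: "(\<lambda>m. B (r m)) \<longlonglongrightarrow> A" using LIMSEQ_subseq_LIMSEQ[OF B(2) r] by (simp add: o_def)
    have "(\<Prod>i\<in>UNIV. v $ i - t) = (\<Prod>i\<in>UNIV. y i - t)" for t
    proof (rule LIMSEQ_unique)
      have "det (B (r m) - mat t) = (\<Prod>i\<in>UNIV. w (r m) i - t)" for m
        using P by (simp add: BP det_conj_by_diff_mat diag_mat_diff_mat det_diag)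
      moreover have "(\<lambda>m. det (B (r m) - mat t)) \<longlonglongrightarrow> det (A - mat t)" by (intro tendsto_intros Br)
      ultimately show "(\<lambda>m. \<Prod>i\<in>UNIV. w (r m) i - t) \<longlonglongrightarrow> (\<Prod>i\<in>UNIV. y i - t)" by (simp add: detA)
      show "(\<lambda>m. \<Prod>i\<in>UNIV. w (r m) i - t) \<longlonglongrightarrow> (\<Prod>i\<in>UNIV. v $ i - t)" by (intro tendsto_intros wlim)
    qed
    \<comment> \<open>Characteristic polynomials determine the limits of the eigenvalues only up to
      order. Reordering by \<open>\<pi>\<close> makes the nodes converge in the order for which
      \<open>l\<close> was chosen.\<close>
    then obtain \<pi> where \<pi>: "bij \<pi>" "\<And>i. v $ \<pi> i = y i" using prod_linear_factors_eq_imp_permuted by metis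
    define z where "z m k = w (r m) (\<pi> (inv tuple_index k))" for m k
    have zi: "z m (tuple_index i) = w (r m) (\<pi> i)" for m i by (simp add: z_def)
    have inj': "inj (\<lambda>i. w (r m) (\<pi> i))" for m
      using inj_compose[OF w(1)[of "r m"] bij_is_inj[OF \<pi>(1)]] by (simp add: o_def)
    have fc: "fun_calc f (B (r m)) = newton_matrix (\<lambda>k. divided_diff f (z m ` {..k})) (z m) (B (r m))" for m
    proof -
      have "range (\<lambda>i. w (r m) (\<pi> i)) \<subseteq> spectrum (B (r m))" using spec by auto
      then obtain R where R: "invertible R" "B (r m) = conj_by R (diag_mat (\<lambda>i. w (r m) (\<pi> i)))"
        using simple_spectrum_diagonalizable[OF inj'] by metis
      show ?thesis
        unfolding R(2) using fun_calc_conj_diag[OF R(1)] newton_matrix_interpolation[OF R(1) inj', of "z m"] zi by simp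
    qed
    have "(\<lambda>m. newton_matrix (\<lambda>k. divided_diff f (z m ` {..k})) (z m) (B (r m))) \<longlonglongrightarrow> L"
      unfolding L_def
    proof (rule tendsto_newton_matrix[OF Br])
      show zlim: "(\<lambda>m. z m k) \<longlonglongrightarrow> yt k" for k
        using wlim[of "\<pi> (inv tuple_index k)"] \<pi>(2) by (simp add: z_def yt_def)
      show "(\<lambda>m. divided_diff f (z m ` {..k})) \<longlonglongrightarrow> l k" if k: "k < CARD('n)" for k
      proof (rule l[OF k])
        show "inj_on (z m) {..k}" for m
        proof (rule inj_onI)
          fix p q assume pq: "p \<in> {..k}" "q \<in> {..k}" "z m p = z m q"
          then have "inv (tuple_index :: 'n \<Rightarrow> nat) p = inv tuple_index q"
            using injD[OF inj'[of m]] by (simp add: z_def)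
          then show "p = q" using pq(1,2) k tuple_index_inv[where 'n='n] by (metis atMost_iff le_less_trans)
        qed
        show "z m i \<in> X" for m i using w(2)[of "r m"] by (auto simp: z_def)
      qed (rule zlim)
    qed
    then show ?thesis using r fc by auto
  qed
  \<comment> \<open>A subsequence staying away from \<open>L\<close> again satisfies the assumptions
    of \<open>sub\<close> and would have a further subsequence tending to \<open>L\<close>.\<close>
  have "(\<lambda>m. fun_calc f (B m)) \<longlonglongrightarrow> L" if B: "\<And>m. B m \<in> simple_matrices X" "B \<longlonglongrightarrow> A" for B
  proof (rule ccontr)
    assume "\<not> (\<lambda>m. fun_calc f (B m)) \<longlonglongrightarrow> L"
    then obtain e where e: "e > 0" "\<And>N. \<exists>m\<ge>N. \<not> dist (fun_calc f (B m)) L < e"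
      unfolding LIMSEQ_def by blast
    then have "infinite {m. \<not> dist (fun_calc f (B m)) L < e}"
      unfolding infinite_nat_iff_unbounded_le by auto
    then obtain s :: "nat \<Rightarrow> nat" where s: "strict_mono s" "\<And>m. \<not> dist (fun_calc f (B (s m))) L < e"
      using infinite_enumerate by blast
    have "(\<lambda>m. B (s m)) \<longlonglongrightarrow> A" using LIMSEQ_subseq_LIMSEQ[OF B(2) s(1)] by (simp add: o_def)
    then obtain r :: "nat \<Rightarrow> nat" where "(\<lambda>m. fun_calc f (B (s (r m)))) \<longlonglongrightarrow> L"
      using sub[of "\<lambda>m. B (s m)"] B(1) by blast
    then have "\<exists>m. dist (fun_calc f (B (s (r m)))) L < e" using e(1) unfolding LIMSEQ_def by blast
    then show False using s(2) by blast
  qed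
  moreover have "L ** M = M ** L" if "A ** M = M ** A" for M
    unfolding L_def using that by (rule newton_matrix_commute)
  ultimately show ?thesis by blast
qed

text \<open>Each point of a convergent sequence in \<open>S\<close> is replaced by a nearby point of
  \<open>D\<close> whose \<open>F\<close>-value is close to the value of \<open>L\<close>; the
  replaced sequence falls under \<open>lim\<close>.\<close>

lemma continuous_on_dense_limit:
  fixes F L :: "'a::metric_space \<Rightarrow> 'b::metric_space"
  assumes lim: "\<And>a b. a \<in> S \<Longrightarrow> (\<And>m. b m \<in> D) \<Longrightarrow> b \<longlonglongrightarrow> a \<Longrightarrow> (\<lambda>m. F (b m)) \<longlonglongrightarrow> L a"
    and dense: "\<And>a. a \<in> S \<Longrightarrow> a \<in> closure D"
  shows "continuous_on S L"
proof (subst continuous_on_sequentially, intro allI ballI impI, elim conjE)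
  fix x a assume a: "a \<in> S" and x: "\<forall>n. x n \<in> S" "x \<longlonglongrightarrow> a"
  have "\<exists>b. b \<in> D \<and> dist b (x n) < inverse (Suc n) \<and> dist (F b) (L (x n)) < inverse (Suc n)" for n
  proof -
    obtain b where b: "\<And>m. b m \<in> D" "b \<longlonglongrightarrow> x n" using dense x(1) closure_sequential by metis
    have "\<forall>\<^sub>F m in sequentially. dist (b m) (x n) < inverse (Suc n)"
      "\<forall>\<^sub>F m in sequentially. dist (F (b m)) (L (x n)) < inverse (Suc n)"
      using b lim[of "x n" b] x(1) by (auto intro!: tendstoD)
    then have "\<forall>\<^sub>F m in sequentially. dist (b m) (x n) < inverse (Suc n) \<and> dist (F (b m)) (L (x n)) < inverse (Suc n)"
      by (rule eventually_conj)
    then show ?thesis using b(1) by (auto simp: eventually_sequentially)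
  qed
  then obtain b where b: "\<And>n. b n \<in> D" "\<And>n. dist (b n) (x n) < inverse (Suc n)"
    "\<And>n. dist (F (b n)) (L (x n)) < inverse (Suc n)" by metis
  have small: "(\<lambda>n. dist (u n) (v n)) \<longlonglongrightarrow> 0" if "\<And>n. dist (u n) (v n) < inverse (Suc n)"
    for u v :: "nat \<Rightarrow> 'c::metric_space"
    by (rule tendsto_sandwich[OF _ _ tendsto_const LIMSEQ_inverse_real_of_nat])
      (use that in \<open>auto intro!: always_eventually less_imp_le\<close>)
  have shift: "v \<longlonglongrightarrow> c" if "u \<longlonglongrightarrow> c" "(\<lambda>n. dist (u n) (v n)) \<longlonglongrightarrow> 0" for u v and c :: "'c::metric_space"
  proof (rule tendsto_dist_iff[THEN iffD2], rule tendsto_sandwich[OF _ _ tendsto_const])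
    show "\<forall>\<^sub>F n in sequentially. dist (v n) c \<le> dist (u n) (v n) + dist (u n) c"
      by (intro always_eventually allI dist_triangle3)
    show "(\<lambda>n. dist (u n) (v n) + dist (u n) c) \<longlonglongrightarrow> 0"
      using tendsto_add[OF that(2) tendsto_dist_iff[THEN iffD1, OF that(1)]] by simp
  qed simp
  have "b \<longlonglongrightarrow> a" using shift[OF x(2)] small[OF b(2)] by (simp add: dist_commute)
  then have "(\<lambda>n. F (b n)) \<longlonglongrightarrow> L a" using lim[OF a] b(1) by blast
  then have "(\<lambda>n. L (x n)) \<longlonglongrightarrow> L a" by (rule shift[OF _ small[OF b(3)]])
  then show "(L \<circ> x) \<longlonglongrightarrow> L a" by (simp add: o_def)
qed

section \<open>The map \<open>\<Phi>\<close> on diagonalizable matrices\<close>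

definition adjoint_matrix :: "complex^'n^'n \<Rightarrow> complex^'n^'n" where
  "adjoint_matrix A = Finite_Cartesian_Product.transpose (map_matrix cnj A)"

lemma adjoint_matrix_nth: "adjoint_matrix A $ i $ j = cnj (A $ j $ i)"
  by (simp add: adjoint_matrix_def Finite_Cartesian_Product.transpose_def)

lemma adjoint_matrix_mult: "adjoint_matrix (A ** B) = adjoint_matrix B ** adjoint_matrix A"
  by (simp add: adjoint_matrix_def map_matrix_mult matrix_transpose_mul)

lemma adjoint_matrix_one: "adjoint_matrix (mat 1) = mat 1"
  by (simp add: adjoint_matrix_def map_matrix_mult transpose_mat)

lemma adjoint_matrix_inverse:
  assumes "invertible P"
  shows "invertible (adjoint_matrix P)" "matrix_inv (adjoint_matrix P) = adjoint_matrix (matrix_inv P)"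
proof -
  have "adjoint_matrix P ** adjoint_matrix (matrix_inv P) = mat 1"
    using assms by (simp add: matrix_inv_left adjoint_matrix_one flip: adjoint_matrix_mult)
  then show "invertible (adjoint_matrix P)" "matrix_inv (adjoint_matrix P) = adjoint_matrix (matrix_inv P)"
    by (auto simp: invertible_right_inverse intro: matrix_inv_unique_left)
qed

lemma adjoint_conj_diag:
  assumes "invertible P"
  shows "adjoint_matrix (conj_by P (diag_mat (cnj \<circ> c))) = conj_by (matrix_inv (adjoint_matrix P)) (diag_mat c)"
proof -
  have "adjoint_matrix (diag_mat (cnj \<circ> c)) = diag_mat c"
    by (auto simp: vec_eq_iff adjoint_matrix_nth diag_mat_nth)
  moreover have "matrix_inv (matrix_inv (adjoint_matrix P)) = adjoint_matrix P"
    using adjoint_matrix_inverse[OF assms] by (intro matrix_inv_unique_left matrix_inv_left)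
  ultimately show ?thesis
    by (simp add: conj_by_def adjoint_matrix_mult adjoint_matrix_inverse[OF assms] matrix_mul_assoc)
qed

lemma continuous_on_adjoint_matrix [continuous_intros]:
  "continuous_on S A \<Longrightarrow> continuous_on S (\<lambda>x. adjoint_matrix (A x))"
  unfolding adjoint_matrix_def by (intro continuous_intros)

section \<open>Frames of lines and their duals\<close>

lemma column_eq_mult_axis: "column i P = P *v axis i (1 :: complex)"
  by (simp add: vec_eq_iff matrix_mult_axis column_def)

lemma spanning_lines_basis:
  fixes L :: "'n \<Rightarrow> (complex^'n) set"
  assumes "spanning_lines L"
  obtains P :: "complex^'n^'n" where "invertible P" "\<And>i. L i = vec.span {column i P}"
proof -
  have "\<exists>v. L i = vec.span {v}" for i
  proof -
    have sub: "vec.subspace (L i)" and dim: "vec.dim (L i) = 1" using assms by (auto simp: spanning_lines_def)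
    obtain B where B: "B \<subseteq> L i" "vec.independent B" "L i \<subseteq> vec.span B" "card B = vec.dim (L i)"
      using vec.basis_exists by blast
    then have "card B = 1" using dim by simp
    then obtain v where v: "B = {v}" by (rule card_1_singletonE)
    have "vec.span B = L i" by (rule vec.span_subspace[OF B(1,3) sub])
    then show ?thesis unfolding v by blast
  qed
  then obtain v where v: "\<And>i. L i = vec.span {v i}" by metis
  define P :: "complex^'n^'n" where "P = (\<chi> i j. v j $ i)"
  have col: "column i P = v i" for i by (simp add: P_def column_def vec_eq_iff)
  have "(\<Union>i. L i) \<subseteq> vec.span (columns P)"
  proof (rule UN_least)
    fix i
    have "column i P \<in> columns P" by (auto simp: columns_def)
    then have "v i \<in> columns P" by (simp only: col)
    then show "L i \<subseteq> vec.span (columns P)" unfolding v by (intro vec.span_mono) simp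
  qed
  then have "vec.span (\<Union>i. L i) \<subseteq> vec.span (columns P)" by (rule vec.span_minimal) simp
  then have "vec.span (columns P) = UNIV" using assms by (auto simp: spanning_lines_def)
  then have "invertible P" by (simp add: invertible_right_inverse matrix_right_invertible_span_columns)
  then show ?thesis using that v col by simp
qed

lemma line_operator_eq:
  fixes P :: "complex^'n^'n"
  assumes P: "invertible P" and L: "\<And>i. L i = vec.span {column i P}"
  shows "line_operator L c = conj_by P (diag_mat c)"
  unfolding line_operator_def
proof (rule the_equality)
  have "conj_by P (diag_mat c) *v column i P = c i *s column i P" for i
  proof -
    have "conj_by P (diag_mat c) ** P = P ** diag_mat c"
      using P by (simp add: conj_by_def matrix_inv_left flip: matrix_mul_assoc)
    then have "conj_by P (diag_mat c) *v column i P = P *v (diag_mat c *v axis i 1)"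
      by (metis column_eq_mult_axis matrix_vector_mul_assoc)
    moreover have "diag_mat c *v axis i 1 = c i *s axis i 1"
      by (simp add: vec_eq_iff matrix_mult_axis diag_mat_nth) (simp add: axis_def)
    ultimately show ?thesis by (simp add: column_eq_mult_axis vector_scalar_commute)
  qed
  then show "\<forall>i. \<forall>v\<in>L i. conj_by P (diag_mat c) *v v = c i *s v"
    unfolding L by (auto simp: vec.span_singleton vector_scalar_commute vector_smult_assoc mult.commute)
next
  fix T assume T: "\<forall>i. \<forall>v\<in>L i. T *v v = c i *s v"
  have "T *v column i P = c i *s column i P" for i using T by (simp add: L vec.span_base)
  then have "(T ** P) *v axis i 1 = c i *s (P *v axis i 1)" for i
    by (simp add: column_eq_mult_axis matrix_vector_mul_assoc)
  then have "(T ** P) $ a $ i = c i * P $ a $ i" for a i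
    by (metis matrix_mult_axis vector_smult_component)
  then have "T ** P = P ** diag_mat c" by (simp add: vec_eq_iff mult_diag_nth mult.commute)
  then show "T = conj_by P (diag_mat c)"
    using P by (metis conj_by_def matrix_inv_right matrix_mul_assoc matrix_mul_rid)
qed

text \<open>The inner products of \<open>v\<close> with the columns of \<open>P\<close> are the
  coordinates of \<open>adjoint_matrix P *v v\<close>. Orthogonality to all columns but the
  \<open>i\<close>-th means that this vector is a multiple of the \<open>i\<close>-th unit
  vector.\<close>

lemma dual_lines_eq:
  fixes P :: "complex^'n^'n"
  assumes P: "invertible P" and L: "\<And>i. L i = vec.span {column i P}"
  shows "dual_lines L i = vec.span {column i (matrix_inv (adjoint_matrix P))}"
proof -
  let ?R = "matrix_inv (adjoint_matrix P)"
  have inner: "hermitian_inner v (column j P) = (adjoint_matrix P *v v) $ j" for v j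
    by (simp add: hermitian_inner_def column_def matrix_vector_mult_def adjoint_matrix_nth mult.commute)
  have "v \<in> dual_lines L i \<longleftrightarrow> (\<forall>j. j \<noteq> i \<longrightarrow> (adjoint_matrix P *v v) $ j = 0)" for v
  proof
    assume "v \<in> dual_lines L i"
    then have "\<forall>w\<in>vec.span (\<Union>j\<in>-{i}. L j). hermitian_inner v w = 0"
      by (simp add: dual_lines_def hermitian_complement_def)
    moreover have "column j P \<in> vec.span (\<Union>j\<in>-{i}. L j)" if "j \<noteq> i" for j
      using that by (intro vec.span_base UN_I[of j]) (auto simp: L vec.span_base)
    ultimately show "\<forall>j. j \<noteq> i \<longrightarrow> (adjoint_matrix P *v v) $ j = 0" by (metis inner)
  next
    assume z: "\<forall>j. j \<noteq> i \<longrightarrow> (adjoint_matrix P *v v) $ j = 0"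
    have sub: "vec.subspace {w. hermitian_inner v w = 0}"
      by (rule vec.subspaceI)
        (auto simp: hermitian_inner_def distrib_left sum.distrib mult.left_commute[of "v $ _"] simp flip: sum_distrib_left)
    have "L j \<subseteq> {w. hermitian_inner v w = 0}" if "j \<noteq> i" for j
      unfolding L using z that by (intro vec.span_minimal sub) (simp add: inner)
    then have "vec.span (\<Union>j\<in>-{i}. L j) \<subseteq> {w. hermitian_inner v w = 0}"
      by (intro vec.span_minimal sub) auto
    then show "v \<in> dual_lines L i" by (auto simp: dual_lines_def hermitian_complement_def)
  qed
  also have "(\<forall>j. j \<noteq> i \<longrightarrow> (adjoint_matrix P *v v) $ j = 0) \<longleftrightarrow> v \<in> vec.span {column i ?R}" for v
  proof
    assume z: "\<forall>j. j \<noteq> i \<longrightarrow> (adjoint_matrix P *v v) $ j = 0"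
    then have "adjoint_matrix P *v v = ((adjoint_matrix P *v v) $ i) *s axis i 1"
      by (auto simp: vec_eq_iff axis_def)
    then have "?R *v (adjoint_matrix P *v v) = ((adjoint_matrix P *v v) $ i) *s column i ?R"
      by (metis column_eq_mult_axis vector_scalar_commute)
    moreover have "?R *v (adjoint_matrix P *v v) = v"
      using adjoint_matrix_inverse(1)[OF P] by (simp add: matrix_vector_mul_assoc matrix_inv_left)
    ultimately show "v \<in> vec.span {column i ?R}" by (metis vec.span_singleton rangeI)
  next
    assume "v \<in> vec.span {column i ?R}"
    then obtain k where "v = k *s column i ?R" by (auto simp: vec.span_singleton)
    then have "adjoint_matrix P *v v = k *s axis i 1"
      using adjoint_matrix_inverse(1)[OF P]
      by (simp add: column_eq_mult_axis vector_scalar_commute matrix_vector_mul_assoc matrix_inv_right)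
    then show "\<forall>j. j \<noteq> i \<longrightarrow> (adjoint_matrix P *v v) $ j = 0" by (simp add: axis_def)
  qed
  finally show ?thesis by blast
qed

lemma line_operator_dual_lines:
  fixes P :: "complex^'n^'n"
  assumes "invertible P" "\<And>i. L i = vec.span {column i P}"
  shows "line_operator (dual_lines L) c = adjoint_matrix (conj_by P (diag_mat (cnj \<circ> c)))"
  using line_operator_eq[of "matrix_inv (adjoint_matrix P)" "dual_lines L" c] dual_lines_eq[OF assms]
    adjoint_matrix_inverse(1)[OF assms(1)] adjoint_conj_diag[OF assms(1)] by (simp add: invertible_matrix_inv)

text \<open>Any two representations by lines and eigenvalues lead to the same right-hand side,
  because \<open>fun_calc\<close> is independent of the frame. This is the uniqueness that
  \<open>THE\<close> asks for.\<close>

theorem Phi_conj_diag: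
  fixes P :: "complex^'n^'n"
  assumes P: "invertible P"
  shows "Phi (conj_by P (diag_mat c)) = adjoint_matrix (fun_calc cnj (conj_by P (diag_mat c)))"
  unfolding Phi_def
proof (rule the_equality)
  define L where "L i = vec.span {column i P}" for i
  have "spanning_lines L"
    unfolding spanning_lines_def
  proof (intro conjI allI)
    show "vec.subspace (L i)" for i by (simp add: L_def)
    have "column i P \<noteq> 0" for i
      using invertible_mult_vec_nonzero[OF P, of "axis i 1"] by (simp add: column_eq_mult_axis axis_eq_0_iff)
    then have "vec.independent {column i P}" for i by (simp add: vec.dependent_single)
    then show "vec.dim (L i) = 1" for i
      unfolding L_def vec.dim_span by (subst vec.dim_eq_card_independent) auto
    have "columns P \<subseteq> (\<Union>i. L i)" by (auto simp: columns_def L_def intro: vec.span_base)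
    then have "vec.span (columns P) \<subseteq> vec.span (\<Union>i. L i)" by (rule vec.span_mono)
    moreover have "vec.span (columns P) = UNIV"
      using P by (simp add: invertible_right_inverse flip: matrix_right_invertible_span_columns)
    ultimately show "vec.span (\<Union>i. L i) = UNIV" by blast
  qed
  then show "\<exists>L d. spanning_lines L \<and> conj_by P (diag_mat c) = line_operator L d
      \<and> adjoint_matrix (fun_calc cnj (conj_by P (diag_mat c))) = line_operator (dual_lines L) d"
    using line_operator_eq[OF P, of L c] line_operator_dual_lines[OF P, of L c] fun_calc_conj_diag[OF P]
    by (intro exI[of _ L] exI[of _ c]) (simp add: L_def)
next
  fix S assume "\<exists>L d. spanning_lines L \<and> conj_by P (diag_mat c) = line_operator L d \<and> S = line_operator (dual_lines L) d"
  then obtain L d where L: "spanning_lines L" "conj_by P (diag_mat c) = line_operator L d" "S = line_operator (dual_lines L) d" by blast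
  obtain R where R: "invertible R" "\<And>i. L i = vec.span {column i R}" using spanning_lines_basis[OF L(1)] by blast
  have "S = adjoint_matrix (conj_by R (diag_mat (cnj \<circ> d)))"
    using line_operator_dual_lines[OF R] L(3) by simp
  moreover have "conj_by P (diag_mat c) = conj_by R (diag_mat d)" using L(2) line_operator_eq[OF R] by simp
  ultimately show "S = adjoint_matrix (fun_calc cnj (conj_by P (diag_mat c)))"
    using fun_calc_conj_diag[OF R(1)] by simp
qed

section \<open>Necessity of the differentiability condition\<close>

text \<open>A Jordan block with its eigenvalues pulled apart; constant \<open>w\<close> gives the
  Jordan block itself.\<close>

definition bidiagonal :: "('n::finite \<Rightarrow> complex) \<Rightarrow> complex^'n^'n" where
  "bidiagonal w = (\<chi> i j. if i = j then w i else if tuple_index j = Suc (tuple_index i) then 1 else 0)"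

lemma spectrum_bidiagonal: "spectrum (bidiagonal w) = range w"
proof -
  have "spectrum (bidiagonal w) = range (\<lambda>i. bidiagonal w $ i $ i)"
    by (rule spectrum_upper_triangular[OF inj_tuple_index]) (auto simp: bidiagonal_def)
  also have "(\<lambda>i. bidiagonal w $ i $ i) = w" by (simp add: bidiagonal_def)
  finally show ?thesis .
qed

lemma bidiagonal_in_simple_matrices:
  "inj w \<Longrightarrow> range w \<subseteq> X \<Longrightarrow> bidiagonal w \<in> simple_matrices X"
  by (rule simple_spectrum_in_simple_matrices[of w]) (auto simp: spectrum_bidiagonal)

lemma norm_bidiagonal_diff:
  fixes w v :: "'n::finite \<Rightarrow> complex"
  shows "norm (bidiagonal w - bidiagonal v) \<le> (\<Sum>i\<in>UNIV. norm (w i - v i))"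
proof -
  have "norm ((bidiagonal w - bidiagonal v) $ i) \<le> norm (w i - v i)" for i
  proof -
    have "norm ((bidiagonal w - bidiagonal v) $ i) \<le> (\<Sum>j\<in>UNIV. norm ((bidiagonal w - bidiagonal v) $ i $ j))"
      unfolding norm_vec_def by (rule L2_set_le_sum) simp
    also have "\<dots> = (\<Sum>j\<in>UNIV. if j = i then norm (w i - v i) else 0)"
      by (rule sum.cong) (auto simp: bidiagonal_def)
    finally show ?thesis by simp
  qed
  moreover have "norm (bidiagonal w - bidiagonal v) \<le> (\<Sum>i\<in>UNIV. norm ((bidiagonal w - bidiagonal v) $ i))"
    unfolding norm_vec_def[of "bidiagonal w - bidiagonal v"] by (rule L2_set_le_sum) simp
  ultimately show ?thesis by (meson order_trans sum_mono)
qed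

text \<open>Only the last term of Newton's formula reaches the corner entry.\<close>

lemma fun_calc_bidiagonal:
  fixes x :: "nat \<Rightarrow> complex" and i0 i1 :: "'n::finite"
  assumes inj: "inj (\<lambda>i :: 'n. x (tuple_index i))"
    and i0: "tuple_index i0 = 0" and i1: "Suc (tuple_index i1) = CARD('n)"
  shows "fun_calc f (bidiagonal (\<lambda>i :: 'n. x (tuple_index i))) $ i0 $ i1 = divided_diff f (x ` {..tuple_index i1})"
proof -
  let ?w = "\<lambda>i :: 'n. x (tuple_index i)"
  let ?J = "bidiagonal ?w"
  obtain P where P: "invertible P" "?J = conj_by P (diag_mat ?w)"
    using simple_spectrum_diagonalizable[OF inj, of ?J] by (auto simp: spectrum_bidiagonal)
  have fc: "fun_calc f ?J = newton_matrix (\<lambda>k. divided_diff f (x ` {..k})) x ?J"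
    using fun_calc_conj_diag[OF P(1)] newton_matrix_interpolation[OF P(1) inj, of x f] by (simp add: P(2))
  \<comment> \<open>Multiplying the unit row at position \<open>k\<close> by
    \<open>?J - mat (x k)\<close> cancels its diagonal entry and leaves the unit row at position
    \<open>Suc k\<close>.\<close>
  have row: "shifted_prod ?J (map x (rev [0..<k])) $ i0 $ j = (if tuple_index j = k then 1 else 0)"
    if "k < CARD('n)" for k j
    using that
  proof (induction k arbitrary: j)
    case 0
    then show ?case using tuple_index_inject[of i0 j] i0 by (auto simp: mat_def)
  next
    case (Suc k)
    define a where "a = (inv tuple_index k :: 'n)"
    have a: "tuple_index a = k" using Suc.prems by (simp add: a_def)
    have "shifted_prod ?J (map x (rev [0..<Suc k])) $ i0 $ j =
      (\<Sum>b\<in>UNIV. (if tuple_index b = k then 1 else 0) * (?J - mat (x k)) $ b $ j)"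
      using Suc by (simp add: matrix_mult_nth)
    also have "\<dots> = (\<Sum>b\<in>UNIV. if b = a then (?J - mat (x k)) $ a $ j else 0)"
      using a by (intro sum.cong) auto
    also have "\<dots> = (if tuple_index j = Suc k then 1 else 0)"
      using a by (auto simp: bidiagonal_def mat_def)
    finally show ?case .
  qed
  have "fun_calc f ?J $ i0 $ i1 =
    (\<Sum>k<CARD('n). divided_diff f (x ` {..k}) * shifted_prod ?J (map x (rev [0..<k])) $ i0 $ i1)"
    unfolding fc newton_matrix_def by (simp add: sum_component mat_mult_nth)
  also have "\<dots> = (\<Sum>k<CARD('n). if k = tuple_index i1 then divided_diff f (x ` {..tuple_index i1}) else 0)"
    by (rule sum.cong) (auto simp: row)
  also have "\<dots> = divided_diff f (x ` {..tuple_index i1})" by simp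
  finally show ?thesis .
qed

text \<open>The Jordan block with eigenvalue \<open>z\<close> is approached by bidiagonal matrices
  with distinct eigenvalues in \<open>X\<close>; continuity of \<open>F\<close> there is convergence
  of the corner entries.\<close>

theorem C_Delta_of_continuous_extension:
  fixes F :: "complex^'n^'n \<Rightarrow> complex^'n^'n"
  assumes n: "2 \<le> CARD('n)" and cont: "continuous_on (sigma_minus X) F"
    and F: "\<And>A. A \<in> simple_matrices X \<Longrightarrow> F A = fun_calc f A"
  shows "C_Delta (CARD('n) - 1) X f"
  unfolding C_Delta_def
proof (intro ballI impI)
  fix z assume z: "z \<in> X"
  define i0 where "i0 = (inv tuple_index 0 :: 'n)"
  define i1 where "i1 = (inv tuple_index (CARD('n) - 1) :: 'n)"
  have i0: "tuple_index i0 = 0" and i1: "tuple_index i1 = CARD('n) - 1" using n by (simp_all add: i0_def i1_def)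
  have Suc: "Suc (CARD('n) - 1) = CARD('n)" using n by simp
  let ?J = "bidiagonal (\<lambda>i :: 'n. z)"
  let ?g = "Delta_iter (CARD('n) - 1) f"
  have JX: "?J \<in> sigma_minus X" using z by (auto simp: sigma_minus_def spectrum_bidiagonal)
  have "continuous_on (sigma_minus X) (\<lambda>A. F A $ i0 $ i1)" by (intro continuous_intros cont)
  have "\<forall>\<epsilon>>0. \<exists>\<delta>>0. \<forall>x\<in>configurations CARD('n) X. (\<forall>i<CARD('n). dist (x i) z < \<delta>) \<longrightarrow> dist (?g x) (F ?J $ i0 $ i1) < \<epsilon>"
  proof (intro allI impI)
    fix \<epsilon> :: real assume "\<epsilon> > 0"
    then obtain \<eta> where \<eta>: "\<eta> > 0" "\<And>A. A \<in> sigma_minus X \<Longrightarrow> dist A ?J < \<eta> \<Longrightarrow> dist (F A $ i0 $ i1) (F ?J $ i0 $ i1) < \<epsilon>"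
      using \<open>continuous_on (sigma_minus X) (\<lambda>A. F A $ i0 $ i1)\<close> JX unfolding continuous_on_iff by metis
    \<comment> \<open>The distance to the Jordan block is at most the sum of the
      \<open>CARD('n)\<close> diagonal deviations, each below \<open>\<delta>\<close>.\<close>
    define \<delta> where "\<delta> = \<eta> / CARD('n)"
    have "\<delta> > 0" using \<eta>(1) by (simp add: \<delta>_def)
    have "dist (?g x) (F ?J $ i0 $ i1) < \<epsilon>"
      if x: "x \<in> configurations CARD('n) X" and close: "\<forall>i<CARD('n). dist (x i) z < \<delta>" for x
    proof -
      let ?w = "\<lambda>i :: 'n. x (tuple_index i)"
      have w: "inj ?w" "range ?w \<subseteq> X" using tuple_vec_configuration[where 'n='n, OF x] by (simp_all add: inj_def)
      have simple: "bidiagonal ?w \<in> simple_matrices X" using w by (rule bidiagonal_in_simple_matrices)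
      have "dist (bidiagonal ?w) ?J \<le> (\<Sum>i\<in>UNIV. norm (?w i - z))"
        unfolding dist_norm by (rule norm_bidiagonal_diff)
      also have "\<dots> < (\<Sum>i\<in>(UNIV :: 'n set). \<delta>)"
        using close by (intro sum_strict_mono) (auto simp: dist_norm)
      also have "\<dots> = \<eta>" by (simp add: \<delta>_def)
      finally have "dist (F (bidiagonal ?w) $ i0 $ i1) (F ?J $ i0 $ i1) < \<epsilon>"
        using simple simple_matrices_subset by (intro \<eta>(2)) auto
      moreover have "F (bidiagonal ?w) $ i0 $ i1 = divided_diff f (x ` {..CARD('n) - 1})"
        using fun_calc_bidiagonal[OF w(1) i0, of i1 f] i1 Suc by (simp add: F[OF simple])
      moreover have "?g x = divided_diff f (x ` {..CARD('n) - 1})"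
      proof (rule Delta_iter_eq_divided_diff)
        have "{..CARD('n) - 1} = {..<CARD('n)}" using Suc by (metis lessThan_Suc_atMost)
        then show "inj_on x {..CARD('n) - 1}" using x by (simp add: configurations_iff)
      qed
      ultimately show ?thesis by simp
    qed
    then show "\<exists>\<delta>>0. \<forall>x\<in>configurations CARD('n) X. (\<forall>i<CARD('n). dist (x i) z < \<delta>) \<longrightarrow> dist (?g x) (F ?J $ i0 $ i1) < \<epsilon>"
      using \<open>\<delta> > 0\<close> by blast
  qed
  then show "\<exists>L. (?g \<longlongrightarrow> L) (atin_within (tuple_space (Suc (CARD('n) - 1)) X)
      (\<lambda>i\<in>{..<Suc (CARD('n) - 1)}. z) (configurations (Suc (CARD('n) - 1)) X))"
    unfolding Suc limit_at_diagonal_iff[OF z n] by blast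
qed

section \<open>The classification\<close>

lemma simple_matrices_approximation:
  fixes A :: "complex^'n^'n"
  assumes "\<And>z. z \<in> X \<Longrightarrow> z islimpt X" "A \<in> sigma_minus X"
  obtains B where "\<And>m. B m \<in> simple_matrices X" "B \<longlonglongrightarrow> A"
  using simple_matrices_dense[OF assms] by (auto simp: closure_sequential)

lemma continuous_eq_on_sigma_minus:
  fixes F G :: "complex^'n^'n \<Rightarrow> complex^'n^'n"
  assumes X: "\<And>z. z \<in> X \<Longrightarrow> z islimpt X"
    and cont: "continuous_on (sigma_minus X) F" "continuous_on (sigma_minus X) G"
    and eq: "\<And>A. A \<in> simple_matrices X \<Longrightarrow> F A = G A" and A: "A \<in> sigma_minus X"
  shows "F A = G A"
proof -
  obtain B where B: "\<And>m. B m \<in> simple_matrices X" "B \<longlonglongrightarrow> A"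
    using simple_matrices_approximation[OF X A] by blast
  have BX: "B m \<in> sigma_minus X" for m using B(1) simple_matrices_subset by blast
  have "(F \<circ> B) \<longlonglongrightarrow> F A" "(G \<circ> B) \<longlonglongrightarrow> G A"
    using cont A B(2) BX unfolding continuous_on_sequentially by blast+
  moreover have "F \<circ> B = G \<circ> B" using eq B(1) by auto
  ultimately show ?thesis using LIMSEQ_unique by metis
qed

lemma CS_preserver_conj_by:
  assumes D: "invertible D"
  shows "CS_preserver S \<phi> \<Longrightarrow> CS_preserver S (\<lambda>A. conj_by D (\<phi> A))"
    and "CS_preserver S \<phi> \<Longrightarrow> CS_preserver S (\<lambda>A. conj_by D (Finite_Cartesian_Product.transpose (\<phi> A)))"
  using D by (auto simp: CS_preserver_def spectrum_conj_by spectrum_transpose conj_by_mult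
      simp flip: matrix_transpose_mul)

lemma conjugation_iff: "conjugation \<alpha> \<longleftrightarrow> (\<exists>D. invertible D \<and> \<alpha> = conj_by D)"
  unfolding conjugation_def conj_by_def[abs_def] by blast

lemma transpose_conjugation_iff:
  "transpose_conjugation \<alpha> \<longleftrightarrow> (\<exists>D. invertible D \<and> \<alpha> = (\<lambda>A. conj_by D (Finite_Cartesian_Product.transpose A)))"
  unfolding transpose_conjugation_def conj_by_def by blast

lemma conjugation_comp_preserver:
  fixes \<psi> :: "complex^'n^'n \<Rightarrow> complex^'n^'n"
  assumes "conjugation \<alpha> \<or> transpose_conjugation \<alpha>" "continuous_on S \<psi>" "CS_preserver S \<psi>"
    "\<And>A. A \<in> S \<Longrightarrow> \<phi> A = \<alpha> (\<psi> A)"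
  shows "continuous_on S \<phi> \<and> CS_preserver S \<phi>"
proof -
  have "continuous_on S (\<lambda>A. \<alpha> (\<psi> A)) \<and> CS_preserver S (\<lambda>A. \<alpha> (\<psi> A))"
    using assms(1)
  proof
    assume "conjugation \<alpha>"
    then obtain D where D: "invertible D" "\<alpha> = conj_by D" by (auto simp: conjugation_iff)
    then show ?thesis
      using CS_preserver_conj_by(1)[OF D(1) assms(3)] assms(2) by (simp add: continuous_on_conj_by)
  next
    assume "transpose_conjugation \<alpha>"
    then obtain D where D: "invertible D" "\<alpha> = (\<lambda>A. conj_by D (Finite_Cartesian_Product.transpose A))"
      by (auto simp: transpose_conjugation_iff)
    then show ?thesis
      using CS_preserver_conj_by(2)[OF D(1) assms(3)] assms(2)
      by (simp add: continuous_on_conj_by continuous_on_transpose)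
  qed
  moreover have "CS_preserver S \<phi> = CS_preserver S (\<lambda>A. \<alpha> (\<psi> A))"
    unfolding CS_preserver_def using assms(4) by (intro conj_cong ball_cong refl) auto
  moreover have "continuous_on S \<phi> = continuous_on S (\<lambda>A. \<alpha> (\<psi> A))"
    by (rule continuous_on_cong) (use assms(4) in auto)
  ultimately show ?thesis by simp
qed

text \<open>The extension is the adjoint of the limiting functional calculus. Agreement with
  \<open>Phi\<close> has to be checked also at diagonalizable matrices with repeated eigenvalues,
  where \<open>simple_matrices\<close> only provides approximations.\<close>

theorem Phi_extension:
  assumes n: "2 \<le> CARD('n::finite)" and X: "\<And>z. z \<in> X \<Longrightarrow> z islimpt X" and C: "C_Delta (CARD('n) - 1) X cnj"
  obtains \<Psi> :: "complex^'n^'n \<Rightarrow> complex^'n^'n"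
  where "continuous_on (sigma_minus X) \<Psi>" "CS_preserver (sigma_minus X) \<Psi>"
    "\<And>A. A \<in> sigma_minus_ss X \<Longrightarrow> \<Psi> A = Phi A"
    "\<And>A. A \<in> simple_matrices X \<Longrightarrow> \<Psi> A = adjoint_matrix (fun_calc cnj A)"
proof -
  have "\<forall>A \<in> sigma_minus X. \<exists>L. (\<forall>B. (\<forall>m. B m \<in> simple_matrices X) \<longrightarrow> B \<longlonglongrightarrow> A \<longrightarrow> (\<lambda>m. fun_calc cnj (B m)) \<longlonglongrightarrow> L) \<and>
    (\<forall>M. A ** M = M ** A \<longrightarrow> L ** M = M ** (L :: complex^'n^'n))"
    using functional_calculus_limit[OF n _ C] X by blast
  then obtain L :: "complex^'n^'n \<Rightarrow> complex^'n^'n" where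
    lim: "\<And>A B. A \<in> sigma_minus X \<Longrightarrow> (\<And>m. B m \<in> simple_matrices X) \<Longrightarrow> B \<longlonglongrightarrow> A \<Longrightarrow> (\<lambda>m. fun_calc cnj (B m)) \<longlonglongrightarrow> L A"
    and comm: "\<And>A M. A \<in> sigma_minus X \<Longrightarrow> A ** M = M ** A \<Longrightarrow> L A ** M = M ** L A"
    by metis
  have contL: "continuous_on (sigma_minus X) L"
    by (rule continuous_on_dense_limit[where D="simple_matrices X" and F="fun_calc cnj"])
      (use lim simple_matrices_dense[OF X] in auto)
  define \<Psi> where "\<Psi> A = adjoint_matrix (L A)" for A
  have cont: "continuous_on (sigma_minus X) \<Psi>"
    unfolding \<Psi>_def by (intro continuous_intros contL)
  have ss: "\<Psi> A = Phi A" if A: "A \<in> sigma_minus_ss X" for A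
  proof -
    obtain P D :: "complex^'n^'n" where PD: "invertible P" "\<forall>i j. i \<noteq> j \<longrightarrow> D $ i $ j = 0" "A = P ** D ** matrix_inv P"
      using A unfolding sigma_minus_ss_def semisimple_def by blast
    define y where "y i = D $ i $ i" for i
    have "D = diag_mat y" using PD(2) by (simp add: vec_eq_iff diag_mat_nth y_def)
    then have AP: "A = conj_by P (diag_mat y)" using PD(3) by (simp add: conj_by_def)
    have AX: "A \<in> sigma_minus X" using A by (simp add: sigma_minus_ss_def)
    then have yX: "y i \<in> X" for i using PD(1) by (auto simp: AP sigma_minus_def spectrum_conj_by spectrum_diag)
    \<comment> \<open>The frame \<open>P\<close> is kept and only the eigenvalues are separated;
      along this sequence the limit can be computed directly, since \<open>cnj\<close> is
      continuous.\<close>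
    obtain x where x: "\<And>n. inj (x n)" "\<And>n i. x n i \<in> X" and xlim: "\<And>i. (\<lambda>n. x n i) \<longlonglongrightarrow> y i"
      by (rule distinct_sequence[of X y], erule X, rule yX, rule that)
    have "(\<lambda>n. fun_calc cnj (conj_by P (diag_mat (x n)))) \<longlonglongrightarrow> L A"
      by (rule lim[OF AX]) (use x(1,2) PD(1) xlim in \<open>auto simp: AP intro!: simple_matricesI tendsto_conj_by tendsto_diag_mat\<close>)
    moreover have "(\<lambda>n. fun_calc cnj (conj_by P (diag_mat (x n)))) \<longlonglongrightarrow> fun_calc cnj A"
      unfolding AP fun_calc_conj_diag[OF PD(1)]
      by (intro tendsto_conj_by tendsto_diag_mat) (simp add: tendsto_cnj xlim)
    ultimately have "L A = fun_calc cnj A" by (rule LIMSEQ_unique)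
    then show ?thesis using Phi_conj_diag[OF PD(1), of y] by (simp add: \<Psi>_def AP)
  qed
  have simple: "\<Psi> A = adjoint_matrix (fun_calc cnj A)" if A: "A \<in> simple_matrices X" for A
  proof -
    have "(\<lambda>m :: nat. fun_calc cnj A) \<longlonglongrightarrow> L A"
      using A simple_matrices_subset by (intro lim) auto
    then have "L A = fun_calc cnj A" using LIMSEQ_unique tendsto_const by blast
    then show ?thesis by (simp add: \<Psi>_def)
  qed
  have "CS_preserver (sigma_minus X) \<Psi>"
    unfolding CS_preserver_def
  proof (intro conjI ballI impI)
    fix A :: "complex^'n^'n" assume A: "A \<in> sigma_minus X"
    obtain B where B: "\<And>m. B m \<in> simple_matrices X" "B \<longlonglongrightarrow> A"
      using simple_matrices_approximation[OF X A] by blast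
    have BX: "B m \<in> sigma_minus X" for m using B(1) simple_matrices_subset by blast
    have "(\<Psi> \<circ> B) \<longlonglongrightarrow> \<Psi> A"
      using cont A B(2) BX unfolding continuous_on_sequentially by blast
    \<comment> \<open>Spectra need not vary continuously as sets in a convenient way, but
      characteristic polynomials do; equality passes to the limit through them.\<close>
    have "det (\<Psi> A - mat c) = det (A - mat c)" for c
    proof (rule LIMSEQ_unique)
      have "det (\<Psi> (B m) - mat c) = det (B m - mat c)" for m
      proof -
        obtain P w where P: "invertible P" "B m = conj_by P (diag_mat w)" using B(1) by (rule simple_matricesE)
        have "\<Psi> (B m) = conj_by (matrix_inv (adjoint_matrix P)) (diag_mat w)"
          using simple[OF B(1), of m] fun_calc_conj_diag[OF P(1)] adjoint_conj_diag[OF P(1)] by (simp add: P(2))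
        moreover have "invertible (matrix_inv (adjoint_matrix P))"
          using adjoint_matrix_inverse(1)[OF P(1)] by (rule invertible_matrix_inv)
        ultimately show ?thesis using P by (simp add: det_conj_by_diff_mat)
      qed
      moreover have "(\<lambda>m. det (\<Psi> (B m) - mat c)) \<longlonglongrightarrow> det (\<Psi> A - mat c)"
        using \<open>(\<Psi> \<circ> B) \<longlonglongrightarrow> \<Psi> A\<close> by (intro tendsto_intros) (simp add: o_def)
      ultimately show "(\<lambda>m. det (B m - mat c)) \<longlonglongrightarrow> det (\<Psi> A - mat c)" by simp
      show "(\<lambda>m. det (B m - mat c)) \<longlonglongrightarrow> det (A - mat c)" by (intro tendsto_intros B(2))
    qed
    then show "spectrum (\<Psi> A) = spectrum A" by (simp add: spectrum_det)
  next
    fix A B :: "complex^'n^'n" assume AB: "A \<in> sigma_minus X" "B \<in> sigma_minus X" "A ** B = B ** A"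
    \<comment> \<open>The commutation property of \<open>L\<close> is applied twice: at
      \<open>A\<close> with the matrix \<open>B\<close>, then at \<open>B\<close> with the matrix
      \<open>L A\<close>.\<close>
    have "B ** L A = L A ** B" using comm[OF AB(1,3)] by simp
    then have "L B ** L A = L A ** L B" by (rule comm[OF AB(2)])
    then show "\<Psi> A ** \<Psi> B = \<Psi> B ** \<Psi> A" by (simp add: \<Psi>_def flip: adjoint_matrix_mult)
  qed
  then show ?thesis using that cont ss simple by blast
qed

lemma fun_calc_id: "A \<in> simple_matrices X \<Longrightarrow> fun_calc id A = A"
  by (auto simp: simple_matrices_def fun_calc_conj_diag)

lemma map_matrix_id: "map_matrix id A = (A :: complex^'n^'n)"
  by (simp add: vec_eq_iff)

lemma simple_matrices_in_sigma_minus_ss: "simple_matrices X \<subseteq> sigma_minus_ss X"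
proof
  fix A assume A: "A \<in> simple_matrices X"
  then obtain P w where "invertible P" "A = conj_by P (diag_mat w)" by (rule simple_matricesE)
  then have "semisimple A"
    unfolding semisimple_def conj_by_def by (intro exI[of _ P] exI[of _ "diag_mat w"]) (simp add: diag_mat_nth)
  then show "A \<in> sigma_minus_ss X" using A simple_matrices_subset by (auto simp: sigma_minus_ss_def)
qed

lemma CS_preserver_id: "CS_preserver S (\<lambda>A. A)"
  by (simp add: CS_preserver_def)

theorem theorem1p9:
  fixes X :: "complex set"
  assumes "CARD('n::finite) \<ge> 3"
    and "perfect (top_of_set X)"
    and "\<forall>x \<in> configurations CARD('n) X. contains_cycle CARD('n) (Gamma_graph CARD('n) X x)"
    and "transitive_on_components CARD('n) X"
    and "\<not> free_on_components CARD('n) X"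
  shows
    "(\<not> C_Delta (CARD('n) - 1) X cnj \<longrightarrow>
       (\<forall>\<phi> :: complex^'n^'n \<Rightarrow> complex^'n^'n.
          continuous_on (sigma_minus X) \<phi> \<and> CS_preserver (sigma_minus X) \<phi> \<longleftrightarrow>
          (\<exists>\<alpha>. (conjugation \<alpha> \<or> transpose_conjugation \<alpha>) \<and> (\<forall>A\<in>sigma_minus X. \<phi> A = \<alpha> A))))
     \<and>
     (C_Delta (CARD('n) - 1) X cnj \<longrightarrow>
       (\<exists>\<Psi> :: complex^'n^'n \<Rightarrow> complex^'n^'n.
          continuous_on (sigma_minus X) \<Psi> \<and> (\<forall>A\<in>sigma_minus_ss X. \<Psi> A = Phi A) \<and>
          (\<forall>\<Psi>'. continuous_on (sigma_minus X) \<Psi>' \<and> (\<forall>A\<in>sigma_minus_ss X. \<Psi>' A = Phi A) \<longrightarrow>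
                (\<forall>A\<in>sigma_minus X. \<Psi>' A = \<Psi> A)) \<and>
          (\<forall>\<phi> :: complex^'n^'n \<Rightarrow> complex^'n^'n.
             continuous_on (sigma_minus X) \<phi> \<and> CS_preserver (sigma_minus X) \<phi> \<longleftrightarrow>
             (\<exists>\<alpha>. (conjugation \<alpha> \<or> transpose_conjugation \<alpha>) \<and>
                  ((\<forall>A\<in>sigma_minus X. \<phi> A = \<alpha> A) \<or> (\<forall>A\<in>sigma_minus X. \<phi> A = \<alpha> (\<Psi> A)))))))"
proof -
  let ?S = "sigma_minus X :: (complex^'n^'n) set"
  let ?T = "Finite_Cartesian_Product.transpose :: complex^'n^'n \<Rightarrow> complex^'n^'n"
  have n: "2 \<le> CARD('n)" using assms(1) by simp
  have X: "z islimpt X" if "z \<in> X" for z using perfect_islimpt[OF assms(2) that] .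
  have conv: "continuous_on ?S \<phi> \<and> CS_preserver ?S \<phi>"
    if "conjugation \<alpha> \<or> transpose_conjugation \<alpha>" "\<forall>A\<in>?S. \<phi> A = \<alpha> A" for \<phi> \<alpha>
    using that(2) by (intro conjugation_comp_preserver[OF that(1) continuous_on_id CS_preserver_id]) simp
  have conj_cont: "continuous_on ?S (\<lambda>A. conj_by D A)" "continuous_on ?S (\<lambda>A. conj_by D (?T A))" for D
    by (intro continuous_intros)+
  have conj: "conjugation (conj_by D)" and tconj: "transpose_conjugation (\<lambda>A. conj_by D (?T A))"
    if "invertible D" for D :: "complex^'n^'n"
    using that conjugation_iff transpose_conjugation_iff by blast+
  have main: "(\<exists>\<alpha>. (conjugation \<alpha> \<or> transpose_conjugation \<alpha>) \<and> (\<forall>A\<in>?S. \<phi> A = \<alpha> A)) \<or>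
      (C_Delta (CARD('n) - 1) X cnj \<and>
       (\<exists>\<alpha>. (conjugation \<alpha> \<or> transpose_conjugation \<alpha>) \<and>
         (\<forall>A\<in>simple_matrices X. \<phi> A = \<alpha> (adjoint_matrix (fun_calc cnj A)))))"
    if \<phi>: "continuous_on ?S \<phi>" "CS_preserver ?S \<phi>" for \<phi>
  proof (rule CS_preserver_simple_spectrum_configurations[OF assms(1,3-5) \<phi>])
    fix D \<sigma> assume D: "invertible D" and \<sigma>: "\<sigma> = id \<or> \<sigma> = cnj"
      and eq: "\<And>g w. invertible g \<Longrightarrow> inj w \<Longrightarrow> range w \<subseteq> X \<Longrightarrow>
        \<phi> (conj_by g (diag_mat w)) = conj_by D (map_matrix \<sigma> (conj_by g (diag_mat (\<sigma> \<circ> w))))"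
    have eq': "\<phi> A = conj_by D (map_matrix \<sigma> (fun_calc \<sigma> A))" if "A \<in> simple_matrices X" for A
      using that by (rule simple_matricesE) (simp add: eq fun_calc_conj_diag)
    from \<sigma> show ?thesis
    proof
      assume "\<sigma> = id"
      then have "\<phi> A = conj_by D A" if "A \<in> ?S" for A
        using continuous_eq_on_sigma_minus[OF X \<phi>(1) conj_cont(1) _ that] eq'
        by (simp add: map_matrix_id fun_calc_id)
      then show ?thesis using conj[OF D] by blast
    next
      assume \<sigma>: "\<sigma> = cnj"
      \<comment> \<open>Undoing \<open>D\<close> and the entrywise conjugation turns
        \<open>\<phi>\<close> into a continuous function that agrees with
        \<open>fun_calc cnj\<close> on simple spectra, which forces the differentiability
        class.\<close>
      have inv: "map_matrix cnj (conj_by (matrix_inv D) (\<phi> A)) = fun_calc cnj A" if "A \<in> simple_matrices X" for A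
        using eq'[OF that] D by (simp add: \<sigma> conj_by_inv) (simp add: vec_eq_iff)
      have "continuous_on ?S (\<lambda>A. map_matrix cnj (conj_by (matrix_inv D) (\<phi> A)))"
        by (intro continuous_intros \<phi>(1))
      then have "C_Delta (CARD('n) - 1) X cnj" using C_Delta_of_continuous_extension[OF n] inv by blast
      \<comment> \<open>The entrywise conjugate is the transpose of the adjoint, so a conjugation of
        it becomes a transpose conjugation after \<open>\<Psi>\<close>; in the transposed case below
        the roles are swapped.\<close>
      moreover have "\<phi> A = conj_by D (?T (adjoint_matrix (fun_calc cnj A)))" if "A \<in> simple_matrices X" for A
        using eq'[OF that] by (simp add: \<sigma> adjoint_matrix_def)
      ultimately show ?thesis
        using tconj[OF D] by blast
    qed
  next
    fix D \<sigma> assume D: "invertible D" and \<sigma>: "\<sigma> = id \<or> \<sigma> = cnj"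
      and eq: "\<And>g w. invertible g \<Longrightarrow> inj w \<Longrightarrow> range w \<subseteq> X \<Longrightarrow>
        \<phi> (conj_by g (diag_mat w)) = conj_by D (?T (map_matrix \<sigma> (conj_by g (diag_mat (\<sigma> \<circ> w)))))"
    have eq': "\<phi> A = conj_by D (?T (map_matrix \<sigma> (fun_calc \<sigma> A)))" if "A \<in> simple_matrices X" for A
      using that by (rule simple_matricesE) (simp add: eq fun_calc_conj_diag)
    from \<sigma> show ?thesis
    proof
      assume "\<sigma> = id"
      then have "\<phi> A = conj_by D (?T A)" if "A \<in> ?S" for A
        using continuous_eq_on_sigma_minus[OF X \<phi>(1) conj_cont(2) _ that] eq'
        by (simp add: map_matrix_id fun_calc_id)
      then show ?thesis using tconj[OF D] by blast
    next
      assume \<sigma>: "\<sigma> = cnj"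
      have inv: "map_matrix cnj (?T (conj_by (matrix_inv D) (\<phi> A))) = fun_calc cnj A" if "A \<in> simple_matrices X" for A
        using eq'[OF that] D by (simp add: \<sigma> conj_by_inv) (simp add: vec_eq_iff)
      have "continuous_on ?S (\<lambda>A. map_matrix cnj (?T (conj_by (matrix_inv D) (\<phi> A))))"
        by (intro continuous_intros \<phi>(1))
      then have "C_Delta (CARD('n) - 1) X cnj" using C_Delta_of_continuous_extension[OF n] inv by blast
      moreover have "\<phi> A = conj_by D (adjoint_matrix (fun_calc cnj A))" if "A \<in> simple_matrices X" for A
        using eq'[OF that] by (simp add: \<sigma> adjoint_matrix_def)
      ultimately show ?thesis
        using conj[OF D] by blast
    qed
  qed
  show ?thesis
  proof (intro conjI impI)
    assume "\<not> C_Delta (CARD('n) - 1) X cnj"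
    then show "\<forall>\<phi> :: complex^'n^'n \<Rightarrow> complex^'n^'n. continuous_on ?S \<phi> \<and> CS_preserver ?S \<phi> \<longleftrightarrow>
          (\<exists>\<alpha>. (conjugation \<alpha> \<or> transpose_conjugation \<alpha>) \<and> (\<forall>A\<in>?S. \<phi> A = \<alpha> A))"
      using main conv by blast
  next
    assume C: "C_Delta (CARD('n) - 1) X cnj"
    obtain \<Psi> :: "complex^'n^'n \<Rightarrow> complex^'n^'n"
      where \<Psi>: "continuous_on ?S \<Psi>" "CS_preserver ?S \<Psi>" "\<And>A. A \<in> sigma_minus_ss X \<Longrightarrow> \<Psi> A = Phi A"
        "\<And>A. A \<in> simple_matrices X \<Longrightarrow> \<Psi> A = adjoint_matrix (fun_calc cnj A)"
      using Phi_extension[where 'n='n, OF n X C, of thesis] by blast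
    have unique: "\<Psi>' A = \<Psi> A"
      if "continuous_on ?S \<Psi>'" "\<forall>A\<in>sigma_minus_ss X. \<Psi>' A = Phi A" "A \<in> ?S" for \<Psi>' A
    proof (rule continuous_eq_on_sigma_minus[OF X that(1) \<Psi>(1) _ that(3)])
      fix B :: "complex^'n^'n" assume "B \<in> simple_matrices X"
      then have "B \<in> sigma_minus_ss X" using simple_matrices_in_sigma_minus_ss by blast
      then show "\<Psi>' B = \<Psi> B" using that(2) \<Psi>(3) by simp
    qed
    have comp_cont: "continuous_on ?S (\<lambda>A. \<alpha> (\<Psi> A))" if "conjugation \<alpha> \<or> transpose_conjugation \<alpha>" for \<alpha>
      using conjugation_comp_preserver[OF that \<Psi>(1,2), of "\<lambda>A. \<alpha> (\<Psi> A)"] by simp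
    have "(\<exists>\<alpha>. (conjugation \<alpha> \<or> transpose_conjugation \<alpha>) \<and> ((\<forall>A\<in>?S. \<phi> A = \<alpha> A) \<or> (\<forall>A\<in>?S. \<phi> A = \<alpha> (\<Psi> A))))"
      if \<phi>: "continuous_on ?S \<phi>" "CS_preserver ?S \<phi>" for \<phi>
    proof -
      consider \<alpha> where "conjugation \<alpha> \<or> transpose_conjugation \<alpha>" "\<forall>A\<in>?S. \<phi> A = \<alpha> A"
        | \<alpha> where "conjugation \<alpha> \<or> transpose_conjugation \<alpha>"
            "\<forall>A\<in>simple_matrices X. \<phi> A = \<alpha> (adjoint_matrix (fun_calc cnj A))"
        using main[OF \<phi>] by blast
      then show ?thesis
      proof cases
        case 1
        then show ?thesis by blast
      next
        case (2 \<alpha>)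
        have "\<phi> A = \<alpha> (\<Psi> A)" if "A \<in> ?S" for A
          using continuous_eq_on_sigma_minus[OF X \<phi>(1) comp_cont[OF 2(1)] _ that] 2(2) \<Psi>(4) by simp
        then show ?thesis using 2(1) by blast
      qed
    qed
    moreover have "continuous_on ?S \<phi> \<and> CS_preserver ?S \<phi>"
      if "conjugation \<alpha> \<or> transpose_conjugation \<alpha>" "\<forall>A\<in>?S. \<phi> A = \<alpha> (\<Psi> A)" for \<phi> \<alpha>
      using that(2) by (intro conjugation_comp_preserver[OF that(1) \<Psi>(1,2)]) simp
    ultimately show "\<exists>\<Psi> :: complex^'n^'n \<Rightarrow> complex^'n^'n.
          continuous_on ?S \<Psi> \<and> (\<forall>A\<in>sigma_minus_ss X. \<Psi> A = Phi A) \<and>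
          (\<forall>\<Psi>'. continuous_on ?S \<Psi>' \<and> (\<forall>A\<in>sigma_minus_ss X. \<Psi>' A = Phi A) \<longrightarrow> (\<forall>A\<in>?S. \<Psi>' A = \<Psi> A)) \<and>
          (\<forall>\<phi> :: complex^'n^'n \<Rightarrow> complex^'n^'n. continuous_on ?S \<phi> \<and> CS_preserver ?S \<phi> \<longleftrightarrow>
             (\<exists>\<alpha>. (conjugation \<alpha> \<or> transpose_conjugation \<alpha>) \<and>
                  ((\<forall>A\<in>?S. \<phi> A = \<alpha> A) \<or> (\<forall>A\<in>?S. \<phi> A = \<alpha> (\<Psi> A)))))"
      using \<Psi>(1,3) unique conv by (intro exI[of _ \<Psi>]) blast
  qed
qed

end
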